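(* There is an algorithm which, given a finite graph $G$ and two independent sets $S,T$ of $G$, decides whether $S\leftrightsquigarrow T$ under the Token Sliding rule in time $O^*(2^{\mathrm{mw}(G)})$.
   Context: Token Sliding ($\mathsf{TS}$): for independent sets $S,S'$ of $G$ with $|S|=|S'|$, write $S\leftrightarrow S'$ if $|S\triangle S'|=2$ and the two vertices of $S\triangle S'$ are adjacent in $G$. Write $S\leftrightsquigarrow S'$ if there exist $\ell\ge 0$ and independent sets $S_0=S,\dots,S_\ell=S'$ of $G$ with $S_{i-1}\leftrightarrow S_i$ for all $i$. A module of $G=(V,E)$ is a set $M\subseteq V$ such that every vertex of $V\setminus M$ is adjacent to all or to none of the vertices of $M$. A graph has modular-width at most $k$ if either it has at most $k$ vertices, or its vertex set can be partitioned into at most $k$ modules $V_1,\dots,V_s$ such that each $G[V_i]$ has modular-width at most $k$; $\mathrm{mw}(G)$ is the minimum such $k$. $O^*(\cdot)$ suppresses factors polynomial in the input size. *)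

theory Defs
  imports
    "Graph_Theory.Digraph_Component"
    "Graph_Theory.Pair_Digraph"
    "HOL-Library.Disjoint_Sets"
    "HOL-Computational_Algebra.Polynomial"
begin

text \<open>
  Graphs are those of Graph_Theory: an undirected graph is a symmetric digraph, and
  \<open>pair_graph G\<close> says that \<open>G\<close> is finite, symmetric and loop-free, without parallel arcs.
  The notions below use only \<open>verts G\<close> and adjacency \<open>u \<rightarrow>\<^bsub>G\<^esub> v\<close>.
\<close>

definition indep_set :: "('a, 'b) pre_digraph \<Rightarrow> 'a set \<Rightarrow> bool" where
  "indep_set G S \<longleftrightarrow> S \<subseteq> verts G \<and> (\<forall>u\<in>S. \<forall>v\<in>S. \<not> u \<rightarrow>\<^bsub>G\<^esub> v)"

definition ts_step :: "('a, 'b) pre_digraph \<Rightarrow> 'a set \<Rightarrow> 'a set \<Rightarrow> bool" where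
  "ts_step G S S' \<longleftrightarrow>
     indep_set G S \<and> indep_set G S' \<and> card S = card S' \<and>
     card (sym_diff S S') = 2 \<and> (\<exists>u v. sym_diff S S' = {u, v} \<and> u \<rightarrow>\<^bsub>G\<^esub> v)"

definition ts_reachable :: "('a, 'b) pre_digraph \<Rightarrow> 'a set \<Rightarrow> 'a set \<Rightarrow> bool" where
  "ts_reachable G S T \<longleftrightarrow> indep_set G S \<and> (ts_step G)\<^sup>*\<^sup>* S T"

definition graph_module :: "('a, 'b) pre_digraph \<Rightarrow> 'a set \<Rightarrow> bool" where
  "graph_module G M \<longleftrightarrow> M \<subseteq> verts G \<and>
     (\<forall>x \<in> verts G - M. (\<forall>y\<in>M. x \<rightarrow>\<^bsub>G\<^esub> y) \<or> (\<forall>y\<in>M. \<not> x \<rightarrow>\<^bsub>G\<^esub> y))"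

inductive mw_le :: "nat \<Rightarrow> ('a, 'b) pre_digraph \<Rightarrow> bool" for k where
  small: "finite (verts G) \<Longrightarrow> card (verts G) \<le> k \<Longrightarrow> mw_le k G"
| split: "partition_on (verts G) \<V> \<Longrightarrow> finite \<V> \<Longrightarrow> card \<V> \<le> k \<Longrightarrow>
          (\<And>M. M \<in> \<V> \<Longrightarrow> graph_module G M) \<Longrightarrow>
          (\<And>M. M \<in> \<V> \<Longrightarrow> mw_le k (G \<restriction> M)) \<Longrightarrow> mw_le k G"

definition mw :: "('a, 'b) pre_digraph \<Rightarrow> nat" where
  "mw G = (LEAST k. mw_le k G)"

lemma mw_le_mw:
  assumes "finite (verts G)"
  shows "mw_le (mw G) G"
  unfolding mw_def using mw_le.small[OF assms order_refl] by (rule LeastI)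

text \<open>
  Algorithms are programs of a first-order call-by-value functional language (pure first-order
  Lisp) whose only values are binary trees built from cons cells. A program is a list of function
  bodies, which may call each other by index; a body refers to its arguments, and to the bindings
  of enclosing \<open>ELet\<close>s, by de Bruijn indices. As usual \<open>Leaf\<close> serves as false and as the empty
  list.

  Every evaluation step costs 1. This is a realistic cost measure: a tree is represented by a
  pointer to an immutable, possibly shared, cell, so that each step takes a constant number of RAM
  instructions on pointers (environments have bounded length, since the program is fixed). In
  particular there is no unit-cost arithmetic and no unit-cost comparison of trees. Conversely, a
  RAM whose memory is kept in a balanced tree is simulated with logarithmic overhead, a factor
  which \<open>O\<^sup>*\<close> suppresses.
\<close>

datatype tree = Leaf | Node tree tree

fun left :: "tree \<Rightarrow> tree" where
  "left Leaf = Leaf"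
| "left (Node l r) = l"

fun right :: "tree \<Rightarrow> tree" where
  "right Leaf = Leaf"
| "right (Node l r) = r"

datatype expr =
    EVar nat
  | ELeaf
  | ENode expr expr
  | ELeft expr
  | ERight expr
  | EIf expr expr expr
  | ELet expr expr
  | ECall nat "expr list"

type_synonym program = "expr list"

text \<open>\<open>eval P env e v t\<close>: in environment \<open>env\<close>, expression \<open>e\<close> evaluates to \<open>v\<close> in \<open>t\<close> steps.\<close>

inductive eval :: "program \<Rightarrow> tree list \<Rightarrow> expr \<Rightarrow> tree \<Rightarrow> nat \<Rightarrow> bool"
  and evals :: "program \<Rightarrow> tree list \<Rightarrow> expr list \<Rightarrow> tree list \<Rightarrow> nat \<Rightarrow> bool"
  for P where
  Var: "i < length env \<Longrightarrow> eval P env (EVar i) (env ! i) 1"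
| Leaf: "eval P env ELeaf Leaf 1"
| Node: "eval P env e1 v1 t1 \<Longrightarrow> eval P env e2 v2 t2 \<Longrightarrow>
         eval P env (ENode e1 e2) (Node v1 v2) (t1 + t2 + 1)"
| Left: "eval P env e v t \<Longrightarrow> eval P env (ELeft e) (left v) (t + 1)"
| Right: "eval P env e v t \<Longrightarrow> eval P env (ERight e) (right v) (t + 1)"
| If_true: "eval P env e1 v1 t1 \<Longrightarrow> v1 \<noteq> Leaf \<Longrightarrow> eval P env e2 v t2 \<Longrightarrow>
            eval P env (EIf e1 e2 e3) v (t1 + t2 + 1)"
| If_false: "eval P env e1 v1 t1 \<Longrightarrow> v1 = Leaf \<Longrightarrow> eval P env e3 v t2 \<Longrightarrow>
             eval P env (EIf e1 e2 e3) v (t1 + t2 + 1)"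
| Let: "eval P env e1 v1 t1 \<Longrightarrow> eval P (v1 # env) e2 v t2 \<Longrightarrow>
        eval P env (ELet e1 e2) v (t1 + t2 + 1)"
| Call: "evals P env es vs t1 \<Longrightarrow> f < length P \<Longrightarrow> eval P vs (P ! f) v t2 \<Longrightarrow>
         eval P env (ECall f es) v (t1 + t2 + 1)"
| Nil: "evals P env [] [] 0"
| Cons: "eval P env e v t1 \<Longrightarrow> evals P env es vs t2 \<Longrightarrow>
         evals P env (e # es) (v # vs) (t1 + t2)"

inductive_cases eval_elims:
  "eval P env (EVar i) v t"
  "eval P env ELeaf v t"
  "eval P env (ENode e1 e2) v t"
  "eval P env (ELeft e) v t"
  "eval P env (ERight e) v t"
  "eval P env (EIf e1 e2 e3) v t"
  "eval P env (ELet e1 e2) v t"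
  "eval P env (ECall f es) v t"
  "evals P env [] vs t"
  "evals P env (e # es) vs t"

lemma eval_deterministic:
  "eval P env e v t \<Longrightarrow> (\<And>v' t'. eval P env e v' t' \<Longrightarrow> v' = v \<and> t' = t)"
  "evals P env es vs s \<Longrightarrow> (\<And>vs' s'. evals P env es vs' s' \<Longrightarrow> vs' = vs \<and> s' = s)"
  by (induction rule: eval_evals.inducts) ((erule eval_elims; (metis | simp))+)

definition run :: "program \<Rightarrow> tree \<Rightarrow> tree \<Rightarrow> nat \<Rightarrow> bool" where
  "run P x v t \<longleftrightarrow> eval P [x] (ECall 0 [EVar 0]) v t"

definition enc_bool :: "bool \<Rightarrow> tree" where
  "enc_bool b = (if b then Node Leaf Leaf else Leaf)"

definition enc_list :: "tree list \<Rightarrow> tree" where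
  "enc_list xs = foldr Node xs Leaf"

definition enc_set :: "'a list \<Rightarrow> 'a set \<Rightarrow> tree" where
  "enc_set vs S = enc_list (map (\<lambda>v. enc_bool (v \<in> S)) vs)"

text \<open>
  The list \<open>vs\<close> enumerates the vertices; the input consists of the adjacency matrix
  and the characteristic vectors of \<open>S\<close> and \<open>T\<close> with respect to it.
\<close>

definition enc_instance :: "('a, 'b) pre_digraph \<Rightarrow> 'a list \<Rightarrow> 'a set \<Rightarrow> 'a set \<Rightarrow> tree" where
  "enc_instance G vs S T =
     enc_list [enc_list (map (\<lambda>u. enc_set vs {v. u \<rightarrow>\<^bsub>G\<^esub> v}) vs), enc_set vs S, enc_set vs T]"

end

theory Submission
  imports Defs "HOL-Library.While_Combinator"
begin

text \<open>
  Partition the vertex set into modules. A token that leaves a module \<open>M\<close> moves to a common neighbour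
  of \<open>M\<close>, so it was the only token in \<open>M\<close>; likewise a token only enters an empty module. Hence modules
  with at least two tokens keep their number of tokens, all others hold at most one token, and a
  configuration is described by its set of occupied modules, up to the positions inside the modules.
  Call a module frozen if it is occupied in every reachable state. In a frozen module the tokens move
  as if the rest of the graph was absent. In any other module the position of the token is arbitrary:
  walk to a state in which the module is empty, and walk back, entering it elsewhere. So \<open>T\<close> is
  reachable from \<open>S\<close> iff its state is reachable, its modules that are not frozen hold at most one token,
  and for each frozen \<open>M\<close> the restriction of \<open>T\<close> to \<open>M\<close> is reachable from that of \<open>S\<close> inside \<open>M\<close>.

  A partition into at most \<open>mw G\<close> modules is found greedily: starting with singletons, merge two parts
  into the least union of parts that is a module and contains both, as long as this is not everything.
  If at least three parts remain, every proper module lies within one part, hence no partition into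
  proper modules has fewer parts.

  The search through the at most \<open>2 ^ mw G\<close> states keeps the visited states in a binary trie, where a
  lookup takes time linear in the number of modules. Everything else is polynomial.
\<close>

section \<open>Programs with time bounds\<close>

text \<open>The base of the exponential must be exactly 2, so a state may spend only one bit per
  module. This is enough because a module with two or more tokens stays occupied and its internal
  moves never interact with the other modules. The exponential factor must not multiply along the
  recursion either: the search runs once per vertex set, recursion enters only frozen modules, and
  these are disjoint proper subsets, so polynomially many vertex sets occur. Each of them,
  \<open>W\<close>, must again have at most mw(G) parts. The decomposition behind mw(G) has a node
  at which \<open>W\<close> is split for the first time, and the modules of that node cut
  \<open>W\<close> into proper modules of the graph induced on \<open>W\<close>; the greedy
  partition is compared with these. If only two parts remain, the comparison is trivial, since a
  partition into proper modules has at least two members. Walking back relies on slides being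
  reversible.\<close>

class treeable = fixes enc :: "'a \<Rightarrow> tree"

instantiation tree :: treeable begin
definition tree_enc: "enc (x :: tree) = x"
instance ..
end

instantiation bool :: treeable begin
definition bool_enc: "enc (b :: bool) = enc_bool b"
instance ..
end

instantiation unit :: treeable begin
definition unit_enc: "enc (u :: unit) = Leaf"
instance ..
end

text \<open>Unary, so that successor, predecessor and zero test are single cell operations. The
  numbers that occur are vertex indices and lengths, hence polynomial in the input even in
  unary.\<close>

instantiation nat :: treeable begin
definition nat_enc: "enc (n :: nat) = enc_list (replicate n Leaf)"
instance ..
end

instantiation prod :: (treeable, treeable) treeable begin
definition prod_enc: "enc p = Node (enc (fst p)) (enc (snd p))"
instance ..
end

instantiation list :: (treeable) treeable begin
definition list_enc: "enc xs = enc_list (map enc xs)"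
instance ..
end

lemma enc_simps [simp]:
  "enc (t :: tree) = t"
  "enc True = Node Leaf Leaf" "enc False = Leaf"
  "enc () = Leaf"
  "enc (0 :: nat) = Leaf" "enc (Suc n) = Node Leaf (enc n)"
  "enc (a, b) = Node (enc a) (enc b)"
  "enc [] = Leaf" "enc (x # xs) = Node (enc x) (enc xs)"
  by (simp_all add: tree_enc bool_enc unit_enc nat_enc prod_enc list_enc enc_bool_def enc_list_def)

text \<open>Variables are local to a body, so relocating a program behind \<open>k\<close> other
  functions changes only the call targets.\<close>

primrec shift :: "nat \<Rightarrow> expr \<Rightarrow> expr" where
  "shift k (EVar i) = EVar i"
| "shift k ELeaf = ELeaf"
| "shift k (ENode a b) = ENode (shift k a) (shift k b)"
| "shift k (ELeft a) = ELeft (shift k a)"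
| "shift k (ERight a) = ERight (shift k a)"
| "shift k (EIf a b c) = EIf (shift k a) (shift k b) (shift k c)"
| "shift k (ELet a b) = ELet (shift k a) (shift k b)"
| "shift k (ECall f es) = ECall (k + f) (map (shift k) es)"

lemma eval_shift:
  "eval P env e v t \<Longrightarrow> eval (Q @ map (shift (length Q)) P) env (shift (length Q) e) v t"
  "evals P env es vs t \<Longrightarrow>
     evals (Q @ map (shift (length Q)) P) env (map (shift (length Q)) es) vs t"
  by (induction rule: eval_evals.inducts) (auto intro: eval_evals.intros simp: nth_append simp del: One_nat_def)

lemma eval_append:
  "eval P env e v t \<Longrightarrow> eval (P @ Q) env e v t"
  "evals P env es vs t \<Longrightarrow> evals (P @ Q) env es vs t"
  by (induction rule: eval_evals.inducts) (auto intro: eval_evals.intros simp: nth_append simp del: One_nat_def)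

definition eval_within :: "program \<Rightarrow> tree list \<Rightarrow> expr \<Rightarrow> tree \<Rightarrow> nat \<Rightarrow> bool" where
  "eval_within P env e v t \<longleftrightarrow> (\<exists>t' \<le> t. eval P env e v t')"

lemma eval_within_mono: "eval_within P env e v t \<Longrightarrow> t \<le> t' \<Longrightarrow> eval_within P env e v t'"
  unfolding eval_within_def using le_trans by blast

lemma eval_within_append: "eval_within P env e v t \<Longrightarrow> eval_within (P @ Q) env e v t"
  unfolding eval_within_def using eval_append by blast

lemma eval_within_shift:
  "eval_within P env e v t \<Longrightarrow>
     eval_within (Q @ map (shift (length Q)) P) env (shift (length Q) e) v t"
  unfolding eval_within_def using eval_shift by blast

lemma eval_within_Var0: "eval_within P (x # env) (EVar 0) x 1"
  unfolding eval_within_def using eval_evals.Var[of 0 "x # env" P] by auto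

lemma eval_within_Leaf: "eval_within P env ELeaf Leaf 1"
  unfolding eval_within_def using eval_evals.Leaf by blast

lemma eval_within_Node:
  "eval_within P env e1 v1 t1 \<Longrightarrow> eval_within P env e2 v2 t2 \<Longrightarrow>
     eval_within P env (ENode e1 e2) (Node v1 v2) (t1 + t2 + 1)"
  unfolding eval_within_def
  by (metis (no_types, opaque_lifting) eval_evals.Node add_mono add_le_mono1)

lemma eval_within_Left: "eval_within P env e v t \<Longrightarrow> eval_within P env (ELeft e) (left v) (t + 1)"
  unfolding eval_within_def by (metis eval_evals.Left add_le_mono1)

lemma eval_within_Right: "eval_within P env e v t \<Longrightarrow> eval_within P env (ERight e) (right v) (t + 1)"
  unfolding eval_within_def by (metis eval_evals.Right add_le_mono1)

lemma eval_within_If: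
  "eval_within P env e1 v1 t1 \<Longrightarrow> (v1 \<noteq> Leaf \<Longrightarrow> eval_within P env e2 v t2) \<Longrightarrow>
     (v1 = Leaf \<Longrightarrow> eval_within P env e3 v t2) \<Longrightarrow>
     eval_within P env (EIf e1 e2 e3) v (t1 + t2 + 1)"
  unfolding eval_within_def
  by (cases "v1 = Leaf")
    (metis eval_evals.If_false add_mono add_le_mono1, metis eval_evals.If_true add_mono add_le_mono1)

lemma eval_within_Call:
  assumes "eval_within P env e x t1" "eval_within P [x] (P ! f) v t2" "f < length P"
  shows "eval_within P env (ECall f [e]) v (t1 + t2 + 1)"
proof -
  from assms obtain s1 s2 where s: "s1 \<le> t1" "eval P env e x s1" "s2 \<le> t2" "eval P [x] (P ! f) v s2"
    unfolding eval_within_def by blast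
  have "evals P env [e] [x] (s1 + 0)"
    using s(2) eval_evals.Nil by (rule eval_evals.Cons)
  from eval_evals.Call[OF this assms(3) s(4)] show ?thesis
    unfolding eval_within_def using s by (intro exI[of _ "s1 + 0 + s2 + 1"]) auto
qed

section \<open>Functions computable within a time bound, and their combinators\<close>

definition computes ::
    "program \<Rightarrow> nat \<Rightarrow> ('a::treeable \<Rightarrow> bool) \<Rightarrow> ('a \<Rightarrow> 'b::treeable) \<Rightarrow> ('a \<Rightarrow> nat) \<Rightarrow> bool" where
  "computes P i D f T \<longleftrightarrow>
     i < length P \<and> (\<forall>x. D x \<longrightarrow> eval_within P [enc x] (P ! i) (enc (f x)) (T x))"

text \<open>\<open>D\<close> carries the invariants of the argument: outside of it neither a value
  nor termination is claimed.\<close>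

definition timed :: "('a::treeable \<Rightarrow> bool) \<Rightarrow> ('a \<Rightarrow> 'b::treeable) \<Rightarrow> ('a \<Rightarrow> nat) \<Rightarrow> bool" where
  "timed D f T \<longleftrightarrow> (\<exists>P i. computes P i D f T)"

lemma timed_mono:
  assumes "timed D f T" "\<And>x. D' x \<Longrightarrow> D x" "\<And>x. D' x \<Longrightarrow> f x = g x" "\<And>x. D' x \<Longrightarrow> T x \<le> T' x"
  shows "timed D' g T'"
  using assms unfolding timed_def computes_def by (metis eval_within_mono)

lemma computes_append: "computes P i D f T \<Longrightarrow> computes (P @ Q) i D f T"
  unfolding computes_def by (auto simp: nth_append eval_within_append)

lemma computes_shift:
  "computes P i D f T \<Longrightarrow> computes (Q @ map (shift (length Q)) P) (length Q + i) D f T"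
  unfolding computes_def by (auto simp: nth_append eval_within_shift)

text \<open>
  Programs are combined by appending the shifted copy of one to the other, so that all functions
  of a construction are available in one program.
\<close>

lemma timed_extend: "timed D f T \<Longrightarrow> \<exists>Q j. computes (P @ Q) j D f T"
  unfolding timed_def using computes_shift by blast

lemma eval_within_computed:
  assumes "computes P i D f T" "D x" "eval_within P env e (enc x) t"
  shows "eval_within P env (ECall i [e]) (enc (f x)) (t + T x + 1)"
  using assms eval_within_Call unfolding computes_def by blast

text \<open>The new body sits at index \<open>length P\<close> of \<open>P @ [e]\<close>, and the
  premise evaluates it in this extended program. So \<open>e\<close> may call everything in
  \<open>P\<close>, and also itself.\<close>

lemma timed_body:
  assumes "\<And>x. D x \<Longrightarrow> eval_within (P @ [e]) [enc x] e (enc (f x)) (T x)"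
  shows "timed D f T"
  unfolding timed_def computes_def
  by (rule exI[of _ "P @ [e]"], rule exI[of _ "length P"]) (use assms in auto)

lemma timed_prim:
  assumes "\<And>x. D x \<Longrightarrow> eval_within [e] [enc x] e (enc (f x)) c"
  shows "timed D f (\<lambda>_. c)"
  by (rule timed_body[where P = "[]"]) (use assms in auto)

text \<open>The additive constants of the combinators count the glue: here one variable access and
  two calls; in \<open>timed_Pair\<close> and \<open>timed_If\<close> two accesses, two calls and
  the outer \<open>ENode\<close> or \<open>EIf\<close>.\<close>

lemma timed_comp:
  assumes "timed D g Tg" "timed D' f Tf" "\<And>x. D x \<Longrightarrow> D' (g x)"
  shows "timed D (\<lambda>x. f (g x)) (\<lambda>x. Tg x + Tf (g x) + 3)"
proof -
  obtain P i where P: "computes P i D g Tg" using assms(1) unfolding timed_def by blast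
  obtain Q j where Q: "computes (P @ Q) j D' f Tf" using timed_extend[OF assms(2)] by blast
  let ?e = "ECall j [ECall i [EVar 0]]"
  note g = computes_append[OF computes_append[OF P], of Q "[?e]"]
  note f = computes_append[OF Q, of "[?e]"]
  show ?thesis
    by (rule timed_body[of _ "P @ Q" ?e], rule eval_within_mono,
        rule eval_within_computed[OF f assms(3)], assumption,
        rule eval_within_computed[OF g], assumption, rule eval_within_Var0) auto
qed

lemma timed_Pair:
  assumes "timed D f Tf" "timed D g Tg"
  shows "timed D (\<lambda>x. (f x, g x)) (\<lambda>x. Tf x + Tg x + 5)"
proof -
  obtain P i where P: "computes P i D f Tf" using assms(1) unfolding timed_def by blast
  obtain Q j where Q: "computes (P @ Q) j D g Tg" using timed_extend[OF assms(2)] by blast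
  let ?e = "ENode (ECall i [EVar 0]) (ECall j [EVar 0])"
  note f = computes_append[OF computes_append[OF P], of Q "[?e]"]
  note g = computes_append[OF Q, of "[?e]"]
  show ?thesis
    by (rule timed_body[of _ "P @ Q" ?e], unfold enc_simps, rule eval_within_mono, rule eval_within_Node,
        rule eval_within_computed[OF f], assumption, rule eval_within_Var0,
        rule eval_within_computed[OF g], assumption, rule eval_within_Var0) auto
qed

lemma enc_bool_Leaf_iff [simp]: "enc (b :: bool) = Leaf \<longleftrightarrow> \<not> b"
  by (cases b) auto

lemma timed_If:
  assumes "timed D c Tc" "timed (\<lambda>x. D x \<and> c x) f Tf" "timed (\<lambda>x. D x \<and> \<not> c x) g Tg"
  shows "timed D (\<lambda>x. if c x then f x else g x) (\<lambda>x. Tc x + (if c x then Tf x else Tg x) + 5)"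
proof -
  obtain P i where P: "computes P i D c Tc" using assms(1) unfolding timed_def by blast
  obtain Q j where Q: "computes (P @ Q) j (\<lambda>x. D x \<and> c x) f Tf" using timed_extend[OF assms(2)] by blast
  obtain R k where R: "computes ((P @ Q) @ R) k (\<lambda>x. D x \<and> \<not> c x) g Tg"
    using timed_extend[OF assms(3)] by blast
  let ?e = "EIf (ECall i [EVar 0]) (ECall j [EVar 0]) (ECall k [EVar 0])"
  note c = computes_append[OF computes_append[OF computes_append[OF P]], of Q R "[?e]"]
  note f = computes_append[OF computes_append[OF Q], of R "[?e]"]
  note g = computes_append[OF R, of "[?e]"]
  note call = eval_within_computed[OF _ _ eval_within_Var0]
  show ?thesis
  proof (rule timed_body[of _ "(P @ Q) @ R" ?e], rule eval_within_mono, rule eval_within_If)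
    fix x assume D: "D x"
    show "eval_within (((P @ Q) @ R) @ [?e]) [enc x] (ECall i [EVar 0]) (enc (c x)) (1 + Tc x + 1)"
      using c D by (rule call)
    show "eval_within (((P @ Q) @ R) @ [?e]) [enc x] (ECall j [EVar 0])
            (enc (if c x then f x else g x)) (1 + (if c x then Tf x else Tg x) + 1)" if "enc (c x) \<noteq> Leaf"
      using call[OF f, of x] D that by simp
    show "eval_within (((P @ Q) @ R) @ [?e]) [enc x] (ECall k [EVar 0])
            (enc (if c x then f x else g x)) (1 + (if c x then Tf x else Tg x) + 1)" if "enc (c x) = Leaf"
      using call[OF g, of x] D that by simp
  qed simp
qed

text \<open>Linear recursion; folds and loops are instances of it. \<open>N\<close> serves only for
  termination, while \<open>T\<close> may be any solution of the recurrence. The domain of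
  \<open>g\<close> fixes its second component to the actual recursive result, so the cost of
  \<open>g\<close> may be bounded through known properties of \<open>F\<close>. The 9 counts the
  glue of the recursive branch; the base branch needs less.\<close>

lemma timed_rec:
  fixes F :: "'a::treeable \<Rightarrow> 'b::treeable" and N :: "'a \<Rightarrow> nat"
  assumes c: "timed D c Tc"
    and h: "timed (\<lambda>x. D x \<and> c x) h Th"
    and g: "timed (\<lambda>p. D (fst p) \<and> c (fst p) \<and> snd p = F (h (fst p))) g Tg"
    and b: "timed (\<lambda>x. D x \<and> \<not> c x) b Tb"
    and closed: "\<And>x. D x \<Longrightarrow> c x \<Longrightarrow> D (h x)"
    and dec: "\<And>x. D x \<Longrightarrow> c x \<Longrightarrow> N (h x) < N x"
    and F: "\<And>x. D x \<Longrightarrow> F x = (if c x then g (x, F (h x)) else b x)"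
    and T: "\<And>x. D x \<Longrightarrow> \<not> c x \<Longrightarrow> Tc x + Tb x + 9 \<le> T x"
      "\<And>x. D x \<Longrightarrow> c x \<Longrightarrow> Tc x + Th x + Tg (x, F (h x)) + T (h x) + 9 \<le> T x"
  shows "timed D F T"
proof -
  obtain P1 i where P1: "computes P1 i D c Tc" using c unfolding timed_def by blast
  obtain P2 j where P2: "computes (P1 @ P2) j (\<lambda>x. D x \<and> c x) h Th" using timed_extend[OF h] by blast
  obtain P3 k where P3: "computes ((P1 @ P2) @ P3) k
      (\<lambda>p. D (fst p) \<and> c (fst p) \<and> snd p = F (h (fst p))) g Tg"
    using timed_extend[OF g] by blast
  obtain P4 l where P4: "computes (((P1 @ P2) @ P3) @ P4) l (\<lambda>x. D x \<and> \<not> c x) b Tb"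
    using timed_extend[OF b] by blast
  let ?P = "((P1 @ P2) @ P3) @ P4"
  \<comment> \<open>\<open>length ?P\<close> is the index of \<open>?e\<close> itself in
    \<open>?Q\<close>: this is the recursive call.\<close>
  let ?e = "EIf (ECall i [EVar 0])
      (ECall k [ENode (EVar 0) (ECall (length ?P) [ECall j [EVar 0]])]) (ECall l [EVar 0])"
  let ?Q = "?P @ [?e]"
  have c': "computes ?Q i D c Tc"
    by (rule computes_append[OF computes_append[OF computes_append[OF computes_append[OF P1]]]])
  have h': "computes ?Q j (\<lambda>x. D x \<and> c x) h Th"
    by (rule computes_append[OF computes_append[OF computes_append[OF P2]]])
  have g': "computes ?Q k (\<lambda>p. D (fst p) \<and> c (fst p) \<and> snd p = F (h (fst p))) g Tg"

    by (rule computes_append[OF computes_append[OF P3]])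
  have b': "computes ?Q l (\<lambda>x. D x \<and> \<not> c x) b Tb" by (rule computes_append[OF P4])
  have "eval_within ?Q [enc x] ?e (enc (F x)) (T x)" if "D x" for x
    using that
  proof (induction "N x" arbitrary: x rule: less_induct)
    case less
    note ec = eval_within_computed[OF c' less.prems eval_within_Var0]
    show ?case
    proof (cases "c x")
      case True
      have "eval_within ?Q [enc x] (ECall j [EVar 0]) (enc (h x)) (1 + Th x + 1)"
        using eval_within_computed[OF h' _ eval_within_Var0] less.prems True by blast
      moreover have "eval_within ?Q [enc (h x)] (?Q ! length ?P) (enc (F (h x))) (T (h x))"
        using less.hyps[OF dec closed] less.prems True by simp
      ultimately have "eval_within ?Q [enc x] (ECall (length ?P) [ECall j [EVar 0]]) (enc (F (h x)))
          ((1 + Th x + 1) + T (h x) + 1)"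
        by (rule eval_within_Call) simp
      from eval_within_Node[OF eval_within_Var0 this]
      have "eval_within ?Q [enc x] (ENode (EVar 0) (ECall (length ?P) [ECall j [EVar 0]]))
          (enc (x, F (h x))) (Th x + T (h x) + 5)"
        unfolding enc_simps by (rule eval_within_mono) simp
      from eval_within_computed[OF g' _ this]
      have "eval_within ?Q [enc x] (ECall k [ENode (EVar 0) (ECall (length ?P) [ECall j [EVar 0]])])
          (enc (F x)) (Th x + T (h x) + 5 + Tg (x, F (h x)) + 1)"
        using F less.prems True by simp
      with True have "eval_within ?Q [enc x] ?e (enc (F x))
          ((1 + Tc x + 1) + (Th x + T (h x) + 5 + Tg (x, F (h x)) + 1) + 1)"
        by (intro eval_within_If[OF ec]) auto
      then show ?thesis by (rule eval_within_mono) (use T(2)[OF less.prems True] in simp)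
    next
      case False
      with eval_within_computed[OF b' _ eval_within_Var0, of x] less.prems F
      have "eval_within ?Q [enc x] ?e (enc (F x)) ((1 + Tc x + 1) + (1 + Tb x + 1) + 1)"
        by (intro eval_within_If[OF ec]) auto
      then show ?thesis by (rule eval_within_mono) (use T(1)[OF less.prems False] in simp)
    qed
  qed
  then show ?thesis by (rule timed_body)
qed

section \<open>Polynomial bounds\<close>

lemma poly_nat_mono: "x \<le> y \<Longrightarrow> poly p x \<le> poly p (y :: nat)"
  by (induction p) (auto intro!: add_mono mult_mono)

definition poly_bounded :: "('a \<Rightarrow> bool) \<Rightarrow> ('a \<Rightarrow> nat) \<Rightarrow> ('a \<Rightarrow> nat) \<Rightarrow> bool" where
  "poly_bounded D \<mu> g \<longleftrightarrow> (\<exists>p :: nat poly. \<forall>x. D x \<longrightarrow> g x \<le> poly p (\<mu> x))"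

lemma poly_bounded_const: "poly_bounded D \<mu> (\<lambda>_. c)"
  unfolding poly_bounded_def by (rule exI[of _ "[:c:]"]) simp

lemma poly_bounded_self: "poly_bounded D \<mu> \<mu>"
  unfolding poly_bounded_def by (rule exI[of _ "[:0, 1:]"]) simp

lemma poly_bounded_add:
  "poly_bounded D \<mu> f \<Longrightarrow> poly_bounded D \<mu> g \<Longrightarrow> poly_bounded D \<mu> (\<lambda>x. f x + g x)"
  unfolding poly_bounded_def
proof (elim exE)
  fix p q :: "nat poly"
  assume "\<forall>x. D x \<longrightarrow> f x \<le> poly p (\<mu> x)" "\<forall>x. D x \<longrightarrow> g x \<le> poly q (\<mu> x)"
  then show "\<exists>p. \<forall>x. D x \<longrightarrow> f x + g x \<le> poly p (\<mu> x)"
    by (intro exI[of _ "p + q"]) (simp add: add_mono)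
qed

lemma poly_bounded_mult:
  "poly_bounded D \<mu> f \<Longrightarrow> poly_bounded D \<mu> g \<Longrightarrow> poly_bounded D \<mu> (\<lambda>x. f x * g x)"
  unfolding poly_bounded_def
proof (elim exE)
  fix p q :: "nat poly"
  assume "\<forall>x. D x \<longrightarrow> f x \<le> poly p (\<mu> x)" "\<forall>x. D x \<longrightarrow> g x \<le> poly q (\<mu> x)"
  then show "\<exists>p. \<forall>x. D x \<longrightarrow> f x * g x \<le> poly p (\<mu> x)"
    by (intro exI[of _ "p * q"]) (simp add: mult_mono)
qed

lemma poly_bounded_mono:
  "poly_bounded D \<mu> g \<Longrightarrow> (\<And>x. D' x \<Longrightarrow> D x) \<Longrightarrow> (\<And>x. D' x \<Longrightarrow> f x \<le> g x) \<Longrightarrow>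
     poly_bounded D' \<mu> f"
  unfolding poly_bounded_def by (meson le_trans)

lemma poly_bounded_comp:
  "poly_bounded D' \<mu>' f \<Longrightarrow> (\<And>x. D x \<Longrightarrow> D' (h x)) \<Longrightarrow> poly_bounded D \<mu> (\<lambda>x. \<mu>' (h x)) \<Longrightarrow>
     poly_bounded D \<mu> (\<lambda>x. f (h x))"
  unfolding poly_bounded_def
proof (elim exE)
  fix p q :: "nat poly"
  assume p: "\<forall>x. D' x \<longrightarrow> f x \<le> poly p (\<mu>' x)" and D: "\<And>x. D x \<Longrightarrow> D' (h x)"
    and q: "\<forall>x. D x \<longrightarrow> \<mu>' (h x) \<le> poly q (\<mu> x)"
  have "f (h x) \<le> poly (pcompose p q) (\<mu> x)" if "D x" for x
    using p D[OF that] poly_nat_mono[of "\<mu>' (h x)" "poly q (\<mu> x)" p] q that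
    by (auto simp: poly_pcompose intro: le_trans)
  then show "\<exists>p. \<forall>x. D x \<longrightarrow> f (h x) \<le> poly p (\<mu> x)" by blast
qed

lemma poly_bounded_poly: "poly_bounded D \<mu> g \<Longrightarrow> poly_bounded D \<mu> (\<lambda>x. poly p (g x))"
  by (rule poly_bounded_comp[of "\<lambda>_. True" "\<lambda>x. x"])
    (auto simp: poly_bounded_def)

lemma poly_bounded_if:
  "poly_bounded (\<lambda>x. D x \<and> c x) \<mu> f \<Longrightarrow> poly_bounded (\<lambda>x. D x \<and> \<not> c x) \<mu> g \<Longrightarrow>
     poly_bounded D \<mu> (\<lambda>x. if c x then f x else g x)"
proof -
  assume "poly_bounded (\<lambda>x. D x \<and> c x) \<mu> f" "poly_bounded (\<lambda>x. D x \<and> \<not> c x) \<mu> g"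
  then obtain p q where pq: "\<And>x. D x \<Longrightarrow> c x \<Longrightarrow> f x \<le> poly p (\<mu> x)" "\<And>x. D x \<Longrightarrow> \<not> c x \<Longrightarrow> g x \<le> poly q (\<mu> x)"
    unfolding poly_bounded_def by blast
  then show ?thesis
    unfolding poly_bounded_def
    by (intro exI[of _ "p + q"]) (auto simp: trans_le_add1 trans_le_add2)
qed

section \<open>Encoding size, and time polynomial in a measure\<close>

definition esize :: "'a::treeable \<Rightarrow> nat" where
  "esize x = size (enc x)"

lemma esize_simps [simp]:
  "esize () = 0" "esize (n :: nat) = n" "esize (a, b) = esize a + esize b + 1"
  "esize [] = 0" "esize (x # xs) = esize x + esize xs + 1"
  by (induction n) (simp_all add: esize_def)

lemma esize_bool: "esize (b :: bool) \<le> 1"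
  by (cases b) (simp_all add: esize_def)

lemma esize_fst: "esize (fst p) \<le> esize p" and esize_snd: "esize (snd p) \<le> esize p"
  by (cases p; simp)+

lemma esize_append [simp]: "esize (xs @ ys) = esize xs + esize ys"
  by (induction xs) auto

lemma length_le_esize: "length xs \<le> esize xs"
  by (induction xs) auto

lemma esize_list_le: "(\<And>x. x \<in> set xs \<Longrightarrow> esize x \<le> b) \<Longrightarrow> esize xs \<le> length xs * (b + 1)"
  by (induction xs) (auto, fastforce intro: add_mono)

lemma esize_filter: "esize (filter P xs) \<le> esize xs"
  by (induction xs) auto

text \<open>
  The time is measured in terms of \<open>\<mu>\<close> instead of the size of the argument, since parts of the argument
  (the trie, the stack) may be exponentially large without being traversed.
\<close>

definition ptimed :: "('a::treeable \<Rightarrow> bool) \<Rightarrow> ('a \<Rightarrow> nat) \<Rightarrow> ('a \<Rightarrow> 'b::treeable) \<Rightarrow> bool" where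
  "ptimed D \<mu> f \<longleftrightarrow> (\<exists>T. timed D f T \<and> poly_bounded D \<mu> T)"

abbreviation psize :: "('a::treeable \<Rightarrow> bool) \<Rightarrow> ('a \<Rightarrow> nat) \<Rightarrow> ('a \<Rightarrow> 'b::treeable) \<Rightarrow> bool" where
  "psize D \<mu> f \<equiv> poly_bounded D \<mu> (\<lambda>x. esize (f x))"

text \<open>Polynomial time alone does not bound the output: since cells are shared, repeatedly
  building \<open>Node x x\<close> gives a tree of exponential size in linearly many steps. The size
  bound is what makes such functions composable.\<close>

definition ptime :: "('a::treeable \<Rightarrow> 'b::treeable) \<Rightarrow> bool" where
  "ptime f \<longleftrightarrow> ptimed (\<lambda>_. True) esize f \<and> psize (\<lambda>_. True) esize f"

lemma ptimed_prim:
  assumes "\<And>x. D x \<Longrightarrow> eval_within [e] [enc x] e (enc (f x)) c"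
  shows "ptimed D \<mu> f"
  unfolding ptimed_def using timed_prim[of D, OF assms] poly_bounded_const by blast

lemma ptimed_mono:
  "ptimed D \<mu> f \<Longrightarrow> (\<And>x. D' x \<Longrightarrow> D x) \<Longrightarrow> (\<And>x. D' x \<Longrightarrow> f x = g x) \<Longrightarrow> ptimed D' \<mu> g"
proof -
  assume "ptimed D \<mu> f" and D: "\<And>x. D' x \<Longrightarrow> D x" "\<And>x. D' x \<Longrightarrow> f x = g x"
  then obtain T where T: "timed D f T" "poly_bounded D \<mu> T"
    unfolding ptimed_def by blast
  have "timed D' g T" by (rule timed_mono[OF T(1)]) (use D in auto)
  moreover have "poly_bounded D' \<mu> T" by (rule poly_bounded_mono[OF T(2)]) (use D in auto)
  ultimately show ?thesis unfolding ptimed_def by blast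
qed

lemma ptimed_comp:
  assumes "ptimed D \<mu> g" "ptimed D' \<mu>' f" "\<And>x. D x \<Longrightarrow> D' (g x)" "poly_bounded D \<mu> (\<lambda>x. \<mu>' (g x))"
  shows "ptimed D \<mu> (\<lambda>x. f (g x))"
proof -
  obtain Tg Tf where "timed D g Tg" "poly_bounded D \<mu> Tg" "timed D' f Tf" "poly_bounded D' \<mu>' Tf"
    using assms unfolding ptimed_def by blast
  note T = this
  have Tfg: "poly_bounded D \<mu> (\<lambda>x. Tf (g x))"
    by (rule poly_bounded_comp[OF T(4) assms(3,4)])
  show ?thesis
    unfolding ptimed_def
    by (intro exI conjI, rule timed_comp[OF T(1,3) assms(3)], assumption)
      (intro poly_bounded_add poly_bounded_const T Tfg)
qed

lemma ptimed_Pair: "ptimed D \<mu> f \<Longrightarrow> ptimed D \<mu> g \<Longrightarrow> ptimed D \<mu> (\<lambda>x. (f x, g x))"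
  unfolding ptimed_def
  by (elim exE conjE, intro exI conjI, erule timed_Pair, assumption)
    (intro poly_bounded_add poly_bounded_const)

lemma ptimed_If:
  assumes "ptimed D \<mu> c" "ptimed (\<lambda>x. D x \<and> c x) \<mu> f" "ptimed (\<lambda>x. D x \<and> \<not> c x) \<mu> g"
  shows "ptimed D \<mu> (\<lambda>x. if c x then f x else g x)"
proof -
  obtain Tc Tf Tg where "timed D c Tc" "timed (\<lambda>x. D x \<and> c x) f Tf" "timed (\<lambda>x. D x \<and> \<not> c x) g Tg"
    "poly_bounded D \<mu> Tc" "poly_bounded (\<lambda>x. D x \<and> c x) \<mu> Tf" "poly_bounded (\<lambda>x. D x \<and> \<not> c x) \<mu> Tg"
    using assms unfolding ptimed_def by blast
  note T = this
  show ?thesis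
    unfolding ptimed_def
    by (intro exI conjI, rule timed_If[OF T(1-3)])
      (intro poly_bounded_add poly_bounded_const poly_bounded_if T)
qed

lemma ptimed_ptime: "ptime f \<Longrightarrow> ptimed (\<lambda>_. True) esize f"
  by (simp add: ptime_def)

text \<open>The size of \<open>x\<close> itself is not restricted; only the value handed to
  \<open>f\<close> must be polynomial in \<open>\<mu>\<close>.\<close>

lemma ptimed_lift:
  "ptime f \<Longrightarrow> ptimed D \<mu> g \<Longrightarrow> psize D \<mu> g \<Longrightarrow> ptimed D \<mu> (\<lambda>x. f (g x))"
  by (rule ptimed_comp[OF _ ptimed_ptime]) auto

lemma psize_lift: "ptime f \<Longrightarrow> psize D \<mu> g \<Longrightarrow> psize D \<mu> (\<lambda>x. f (g x))"
  unfolding ptime_def by (rule poly_bounded_comp[of "\<lambda>_. True" esize]) auto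

lemma psize_Pair: "psize D \<mu> f \<Longrightarrow> psize D \<mu> g \<Longrightarrow> psize D \<mu> (\<lambda>x. (f x, g x))"
  unfolding esize_simps by (intro poly_bounded_add poly_bounded_const)

lemma psize_If:
  "psize (\<lambda>x. D x \<and> c x) \<mu> f \<Longrightarrow> psize (\<lambda>x. D x \<and> \<not> c x) \<mu> g \<Longrightarrow>
     psize D \<mu> (\<lambda>x. if c x then f x else g x)"
  by (simp add: if_distrib poly_bounded_if)

lemma ptimeI: "ptimed (\<lambda>_. True) esize f \<Longrightarrow> psize (\<lambda>_. True) esize f \<Longrightarrow> ptime f"
  by (simp add: ptime_def)

lemma ptime_comp: "ptime f \<Longrightarrow> ptime g \<Longrightarrow> ptime (\<lambda>x. f (g x))"
  using ptimed_lift[of f "\<lambda>_. True" esize g] psize_lift[of f "\<lambda>_. True" esize g]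
  by (simp add: ptime_def)

lemma eval_within_Left': "eval_within P env e v t \<Longrightarrow> left v = v' \<Longrightarrow> eval_within P env (ELeft e) v' (t + 1)"
  using eval_within_Left by blast

lemma eval_within_Right': "eval_within P env e v t \<Longrightarrow> right v = v' \<Longrightarrow> eval_within P env (ERight e) v' (t + 1)"
  using eval_within_Right by blast

section \<open>Primitive operations in constant time\<close>

primrec expr_of :: "tree \<Rightarrow> expr" where
  "expr_of Leaf = ELeaf"
| "expr_of (Node a b) = ENode (expr_of a) (expr_of b)"

lemma eval_within_expr_of: "eval_within P env (expr_of v) v (2 * size v + 1)"
proof (induction v)
  case (Node a b)
  from eval_within_Node[OF Node] show ?case
    unfolding expr_of.simps by (rule eval_within_mono) simp
qed (use eval_within_Leaf in simp)

lemma left_enc_prod: "left (enc p) = enc (fst p)" and right_enc_prod: "right (enc p) = enc (snd p)"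
  by (simp_all add: prod_enc)

lemma left_enc_list: "xs \<noteq> [] \<Longrightarrow> left (enc xs) = enc (hd xs)"
  and right_enc_list: "right (enc xs) = enc (tl xs)"
  and enc_list_Leaf_iff: "enc xs = Leaf \<longleftrightarrow> xs = []"
  by (cases xs; simp)+

lemma right_enc_nat: "right (enc (n :: nat)) = enc (n - 1)"
  and enc_nat_Leaf_iff: "enc (n :: nat) = Leaf \<longleftrightarrow> n = 0"
  by (cases n; simp)+

lemma enc_replicate: "enc (replicate n ()) = enc n"
  by (induction n) auto

lemma ptimed_id: "ptimed D \<mu> (\<lambda>x. x)"
  by (rule ptimed_prim, rule eval_within_Var0)

lemma ptimed_const: "ptimed D \<mu> (\<lambda>_. c)"
  by (rule ptimed_prim, rule eval_within_expr_of)

lemma fst_prim: "ptimed D \<mu> fst"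
  by (rule ptimed_prim, rule eval_within_Left', rule eval_within_Var0, rule left_enc_prod)

lemma snd_prim: "ptimed D \<mu> snd"
  by (rule ptimed_prim, rule eval_within_Right', rule eval_within_Var0, rule right_enc_prod)

lemma tl_prim: "ptimed D \<mu> tl"
  by (rule ptimed_prim, rule eval_within_Right', rule eval_within_Var0, rule right_enc_list)

lemma nonempty_prim: "ptimed D \<mu> (\<lambda>xs. xs \<noteq> [])"
  by (rule ptimed_prim, rule eval_within_If[OF eval_within_Var0, of _ _ _ "expr_of (Node Leaf Leaf)" _ 3 ELeaf])
      (auto simp: enc_list_Leaf_iff intro: eval_within_mono[OF eval_within_Leaf]
         eval_within_mono[OF eval_within_Node[OF eval_within_Leaf eval_within_Leaf]])

text \<open>A pair and a cons cell have the same encoding, so the program is the identity.\<close>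

lemma Cons_prim: "ptimed D \<mu> (\<lambda>p. fst p # snd p)"
  by (rule ptimed_prim[of _ "EVar 0"], subst enc_simps, subst prod_enc[symmetric], rule eval_within_Var0)

lemma Not_prim: "ptimed D \<mu> Not"
  by (rule ptimed_prim, rule eval_within_If[OF eval_within_Var0, of _ _ _ ELeaf _ 3 "expr_of (Node Leaf Leaf)"])
      (auto intro: eval_within_mono[OF eval_within_Leaf]
         eval_within_mono[OF eval_within_Node[OF eval_within_Leaf eval_within_Leaf]])

lemma Suc_prim: "ptimed D \<mu> Suc"
  by (rule ptimed_prim, subst enc_simps, rule eval_within_Node[OF eval_within_Leaf eval_within_Var0])

lemma pred_prim: "ptimed D \<mu> (\<lambda>n. n - 1 :: nat)"
  by (rule ptimed_prim, rule eval_within_Right', rule eval_within_Var0, rule right_enc_nat)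

lemma zero_prim: "ptimed D \<mu> (\<lambda>n. n = (0 :: nat))"
  by (rule ptimed_prim, rule eval_within_If[OF eval_within_Var0, of _ _ _ ELeaf _ 3 "expr_of (Node Leaf Leaf)"])
      (auto simp: enc_nat_Leaf_iff intro: eval_within_mono[OF eval_within_Leaf]
         eval_within_mono[OF eval_within_Node[OF eval_within_Leaf eval_within_Leaf]])

lemma replicate_prim: "ptimed D \<mu> (\<lambda>n. replicate n ())"
  by (rule ptimed_prim[of _ "EVar 0"], subst enc_replicate, rule eval_within_Var0)

lemma left_prim: "ptimed D \<mu> left"
  by (rule ptimed_prim, rule eval_within_Left', rule eval_within_Var0) simp

lemma right_prim: "ptimed D \<mu> right"
  by (rule ptimed_prim, rule eval_within_Right', rule eval_within_Var0) simp

lemma Node_prim: "ptimed D \<mu> (\<lambda>p. Node (fst p) (snd p))"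
  by (rule ptimed_prim[of _ "EVar 0"], unfold prod_enc tree_enc, rule eval_within_Var0)

lemma is_Node_prim: "ptimed D \<mu> (\<lambda>t. t \<noteq> Leaf)"
  by (rule ptimed_prim, rule eval_within_If[OF eval_within_Var0, of _ _ _ "expr_of (Node Leaf Leaf)" _ 3 ELeaf])
      (auto intro: eval_within_mono[OF eval_within_Leaf]
         eval_within_mono[OF eval_within_Node[OF eval_within_Leaf eval_within_Leaf]])

text \<open>\<open>hd []\<close> is an unspecified value whose encoding need not be
  \<open>left Leaf\<close>; hence the restriction on \<open>D\<close>.\<close>

lemma hd_prim: "(\<And>xs. D xs \<Longrightarrow> xs \<noteq> []) \<Longrightarrow> ptimed D \<mu> hd"
  by (rule ptimed_prim, rule eval_within_Left', rule eval_within_Var0, rule left_enc_list)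

text \<open>The measure \<open>\<lambda>_. 0\<close> expresses constant time, because a polynomial
  at 0 is a constant. The argument \<open>g x\<close> may then be arbitrarily large.\<close>

lemma ptimed_comp_const: "ptimed D \<mu> g \<Longrightarrow> ptimed D' (\<lambda>_. 0) f \<Longrightarrow> (\<And>x. D x \<Longrightarrow> D' (g x)) \<Longrightarrow> ptimed D \<mu> (\<lambda>x. f (g x))"
  by (rule ptimed_comp[of D \<mu> g D' "\<lambda>_. 0"]) (auto intro: poly_bounded_const)

lemma ptimed_fst: "ptimed D \<mu> f \<Longrightarrow> ptimed D \<mu> (\<lambda>x. fst (f x))"
  by (erule ptimed_comp_const, rule fst_prim[of "\<lambda>_. True"]) simp_all

lemma ptimed_snd: "ptimed D \<mu> f \<Longrightarrow> ptimed D \<mu> (\<lambda>x. snd (f x))"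
  by (erule ptimed_comp_const, rule snd_prim[of "\<lambda>_. True"]) simp_all

lemma ptimed_tl: "ptimed D \<mu> xs \<Longrightarrow> ptimed D \<mu> (\<lambda>x. tl (xs x))"
  by (erule ptimed_comp_const, rule tl_prim[of "\<lambda>_. True"]) simp_all

lemma ptimed_nonempty: "ptimed D \<mu> xs \<Longrightarrow> ptimed D \<mu> (\<lambda>x. xs x \<noteq> [])"
  by (erule ptimed_comp_const, rule nonempty_prim[of "\<lambda>_. True"]) simp_all

lemma ptimed_hd: "ptimed D \<mu> xs \<Longrightarrow> (\<And>x. D x \<Longrightarrow> xs x \<noteq> []) \<Longrightarrow> ptimed D \<mu> (\<lambda>x. hd (xs x))"
  by (erule ptimed_comp_const, rule hd_prim[of "\<lambda>xs. xs \<noteq> []"]) simp_all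

lemma ptimed_Not: "ptimed D \<mu> c \<Longrightarrow> ptimed D \<mu> (\<lambda>x. \<not> c x)"
  by (erule ptimed_comp_const, rule Not_prim[of "\<lambda>_. True"]) simp_all

lemma ptimed_left: "ptimed D \<mu> u \<Longrightarrow> ptimed D \<mu> (\<lambda>x. left (u x))"
  by (erule ptimed_comp_const, rule left_prim[of "\<lambda>_. True"]) simp_all

lemma ptimed_right: "ptimed D \<mu> u \<Longrightarrow> ptimed D \<mu> (\<lambda>x. right (u x))"
  by (erule ptimed_comp_const, rule right_prim[of "\<lambda>_. True"]) simp_all

lemma ptimed_is_Node: "ptimed D \<mu> u \<Longrightarrow> ptimed D \<mu> (\<lambda>x. u x \<noteq> Leaf)"
  by (erule ptimed_comp_const, rule is_Node_prim[of "\<lambda>_. True"]) simp_all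

lemmas ptimed_unary =
  ptimed_fst ptimed_snd ptimed_tl ptimed_nonempty ptimed_Not ptimed_left ptimed_right ptimed_is_Node

lemma ptimed_intros2:
  "ptimed D \<mu> f \<Longrightarrow> ptimed D \<mu> xs \<Longrightarrow> ptimed D \<mu> (\<lambda>x. f x # xs x)"
  "ptimed D \<mu> u \<Longrightarrow> ptimed D \<mu> v \<Longrightarrow> ptimed D \<mu> (\<lambda>x. Node (u x) (v x))"
  using ptimed_comp_const[OF ptimed_Pair Cons_prim[of "\<lambda>_. True"], of D \<mu> f xs]
    ptimed_comp_const[OF ptimed_Pair Node_prim[of "\<lambda>_. True"], of D \<mu> u v]
  by simp_all

lemma ptimed_conj: "ptimed D \<mu> a \<Longrightarrow> ptimed (\<lambda>x. D x \<and> a x) \<mu> b \<Longrightarrow> ptimed D \<mu> (\<lambda>x. a x \<and> b x)"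
proof -
  have eq: "(\<lambda>x. a x \<and> b x) = (\<lambda>x. if a x then b x else False)" by auto
  show "ptimed D \<mu> a \<Longrightarrow> ptimed (\<lambda>x. D x \<and> a x) \<mu> b \<Longrightarrow> ?thesis"
    unfolding eq by (intro ptimed_If ptimed_const)
qed

lemma ptimed_constD: "ptimed D (\<lambda>_. 0) f \<Longrightarrow> \<exists>K. timed D f (\<lambda>_. K)"
proof -
  assume "ptimed D (\<lambda>_. 0) f"
  then obtain T p where "timed D f T" "\<And>x. D x \<Longrightarrow> T x \<le> poly p 0"
    unfolding ptimed_def poly_bounded_def by blast
  note T = this
  have "timed D f (\<lambda>_. poly p 0)" by (rule timed_mono[OF T(1)]) (use T(2) in auto)
  then show ?thesis ..
qed

section \<open>Polynomial-time functions\<close>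

named_theorems ptime_intros

lemma ptime_id [ptime_intros]: "ptime (\<lambda>x. x)"
  by (rule ptimeI[OF ptimed_id poly_bounded_self])

lemma ptime_const [ptime_intros]: "ptime (\<lambda>_. c)"
  by (rule ptimeI[OF ptimed_const poly_bounded_const])

lemma ptime_prim: "ptimed (\<lambda>_. True) esize f \<Longrightarrow> (\<And>x. esize (f x) \<le> esize x + c) \<Longrightarrow> ptime f"
  by (rule ptimeI, assumption,
      rule poly_bounded_mono[OF poly_bounded_add[OF poly_bounded_self poly_bounded_const[of _ _ c]]]) auto

lemma ptime_fst [ptime_intros]: "ptime f \<Longrightarrow> ptime (\<lambda>x. fst (f x))"
  by (rule ptime_comp[OF ptime_prim[OF fst_prim, of 0]]) (simp add: esize_fst)

lemma ptime_snd [ptime_intros]: "ptime f \<Longrightarrow> ptime (\<lambda>x. snd (f x))"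
  by (rule ptime_comp[OF ptime_prim[OF snd_prim, of 0]]) (simp add: esize_snd)

lemma esize_tl: "esize (tl xs) \<le> esize xs"
  by (cases xs) auto

lemma ptime_tl [ptime_intros]: "ptime xs \<Longrightarrow> ptime (\<lambda>x. tl (xs x))"
  by (rule ptime_comp[OF ptime_prim[OF tl_prim, of 0]]) (simp add: esize_tl)

lemma ptime_bool: "ptimed (\<lambda>_. True) esize (f :: _ \<Rightarrow> bool) \<Longrightarrow> ptime f"
  by (rule ptime_prim[of _ 1]) (use esize_bool le_add2 le_trans in blast)+

lemma ptime_nonempty [ptime_intros]: "ptime xs \<Longrightarrow> ptime (\<lambda>x. xs x \<noteq> [])"
  by (rule ptime_comp[OF ptime_bool[OF nonempty_prim]])

lemma ptime_Not [ptime_intros]: "ptime c \<Longrightarrow> ptime (\<lambda>x. \<not> c x)"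
  by (rule ptime_comp[OF ptime_bool[OF Not_prim]])

lemma ptime_empty [ptime_intros]: "ptime xs \<Longrightarrow> ptime (\<lambda>x. xs x = [])"
  using ptime_Not[OF ptime_nonempty] by simp

lemma ptime_zero: "ptime k \<Longrightarrow> ptime (\<lambda>x. k x = (0 :: nat))"
  by (rule ptime_comp[OF ptime_bool[OF zero_prim]])

lemma ptime_Suc [ptime_intros]: "ptime k \<Longrightarrow> ptime (\<lambda>x. Suc (k x))"
  by (rule ptime_comp[OF ptime_prim[OF Suc_prim, of 1]]) simp

lemma ptime_pred: "ptime k \<Longrightarrow> ptime (\<lambda>x. k x - 1 :: nat)"
  by (rule ptime_comp[OF ptime_prim[OF pred_prim, of 0]]) simp

lemma esize_replicate_unit: "esize (replicate k ()) = k"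
  by (simp add: esize_def enc_replicate esize_simps(2)[unfolded esize_def])

lemma ptime_replicate: "ptime k \<Longrightarrow> ptime (\<lambda>x. replicate (k x) ())"
  by (rule ptime_comp[OF ptime_prim[OF replicate_prim, of 0]]) (simp add: esize_replicate_unit)

lemma ptime_Pair [ptime_intros]: "ptime f \<Longrightarrow> ptime g \<Longrightarrow> ptime (\<lambda>x. (f x, g x))"
  unfolding ptime_def using ptimed_Pair psize_Pair by blast

lemma ptime_Cons [ptime_intros]: "ptime f \<Longrightarrow> ptime xs \<Longrightarrow> ptime (\<lambda>x. f x # xs x)"
  using ptime_comp[OF ptime_prim[OF Cons_prim, of 0] ptime_Pair, of f xs] by (simp add: esize_def prod_enc)

lemma ptime_If [ptime_intros]:
  "ptime c \<Longrightarrow> ptime f \<Longrightarrow> ptime g \<Longrightarrow> ptime (\<lambda>x. if c x then f x else g x)"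
  unfolding ptime_def
  by (intro conjI ptimed_If psize_If; elim conjE)
    (auto intro: ptimed_mono[where D = "\<lambda>_. True"] poly_bounded_mono[where D = "\<lambda>_. True"])

lemma ptime_conj [ptime_intros]: "ptime a \<Longrightarrow> ptime b \<Longrightarrow> ptime (\<lambda>x. a x \<and> b x)"
proof -
  have eq: "(\<lambda>x. a x \<and> b x) = (\<lambda>x. if a x then b x else False)" by auto
  show "ptime a \<Longrightarrow> ptime b \<Longrightarrow> ?thesis" unfolding eq by (intro ptime_intros)
qed

lemma ptime_disj [ptime_intros]: "ptime a \<Longrightarrow> ptime b \<Longrightarrow> ptime (\<lambda>x. a x \<or> b x)"
  using ptime_Not[OF ptime_conj[OF ptime_Not ptime_Not]] by simp

lemma ptime_eq_bool [ptime_intros]: "ptime a \<Longrightarrow> ptime b \<Longrightarrow> ptime (\<lambda>x. a x = (b x :: bool))"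
proof -
  have eq: "(\<lambda>x. a x = b x) = (\<lambda>x. if a x then b x else \<not> b x)" by auto
  show "ptime a \<Longrightarrow> ptime b \<Longrightarrow> ?thesis" unfolding eq by (intro ptime_intros)
qed

lemma ptime_apply2:
  "ptime (\<lambda>p. f (fst p) (snd p)) \<Longrightarrow> ptime a \<Longrightarrow> ptime b \<Longrightarrow> ptime (\<lambda>x. f (a x) (b x))"
  using ptime_comp[OF _ ptime_Pair, of "\<lambda>p. f (fst p) (snd p)" a b] by simp

lemma ptime_apply3:
  "ptime (\<lambda>p. f (fst p) (fst (snd p)) (snd (snd p))) \<Longrightarrow> ptime a \<Longrightarrow> ptime b \<Longrightarrow> ptime c \<Longrightarrow>
     ptime (\<lambda>x. f (a x) (b x) (c x))"
  using ptime_comp[OF _ ptime_Pair[OF _ ptime_Pair], of "\<lambda>p. f (fst p) (fst (snd p)) (snd (snd p))" a b c]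
  by simp

lemma ptime_apply4:
  "ptime (\<lambda>p. f (fst p) (fst (snd p)) (fst (snd (snd p))) (snd (snd (snd p)))) \<Longrightarrow>
     ptime a \<Longrightarrow> ptime b \<Longrightarrow> ptime c \<Longrightarrow> ptime d \<Longrightarrow> ptime (\<lambda>x. f (a x) (b x) (c x) (d x))"
  using ptime_comp[OF _ ptime_Pair[OF _ ptime_Pair[OF _ ptime_Pair]],
      of "\<lambda>p. f (fst p) (fst (snd p)) (fst (snd (snd p))) (snd (snd (snd p)))" a b c d]
  by simp

text \<open>Every intermediate accumulator is the result of the same fold on a suffix of the list,
  so the size bound for final results covers the intermediate ones too. One polynomial therefore
  bounds each of the rounds.\<close>

lemma ptime_foldr_psize:
  fixes g :: "'c::treeable \<times> 'a::treeable \<times> 'b::treeable \<Rightarrow> 'b"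
  assumes g: "ptime g"
    and size: "psize (\<lambda>_. True) esize (\<lambda>p. foldr (\<lambda>a s. g (fst p, a, s)) (snd (snd p)) (fst (snd p)))"
  shows "ptime (\<lambda>p. foldr (\<lambda>a s. g (fst p, a, s)) (snd (snd p)) (fst (snd p)))" (is "ptime ?F")
proof (rule ptimeI[OF _ size])
  obtain Tg pg where Tg: "timed (\<lambda>_. True) g Tg" "\<And>p. Tg p \<le> poly pg (esize p)"
    using g unfolding ptime_def ptimed_def poly_bounded_def by blast
  obtain pF where pF: "\<And>p. esize (?F p) \<le> poly pF (esize p)"
    using size unfolding poly_bounded_def by blast
  define c where "c = (\<lambda>p :: 'c \<times> 'b \<times> 'a list. snd (snd p) \<noteq> [])"
  define h where "h = (\<lambda>p :: 'c \<times> 'b \<times> 'a list. (fst p, fst (snd p), tl (snd (snd p))))"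
  define k where "k = (\<lambda>q :: ('c \<times> 'b \<times> 'a list) \<times> 'b. (fst (fst q), hd (snd (snd (fst q))), snd q))"
  have "ptimed (\<lambda>_. True) (\<lambda>_. 0) c" "ptimed c (\<lambda>_. 0) h" "ptimed (\<lambda>q. c (fst q)) (\<lambda>_. 0) k"
    "ptimed (\<lambda>p. \<not> c p) (\<lambda>_. 0) (\<lambda>p. fst (snd p))"
    unfolding c_def h_def k_def by (intro ptimed_unary ptimed_hd ptimed_Pair ptimed_id; simp)+
  from this[THEN ptimed_constD] obtain Kc Kh Kk Kb where K: "timed (\<lambda>_. True) c (\<lambda>_. Kc)" "timed c h (\<lambda>_. Kh)"
    "timed (\<lambda>q. c (fst q)) k (\<lambda>_. Kk)" "timed (\<lambda>p. \<not> c p) (\<lambda>p. fst (snd p)) (\<lambda>_. Kb)"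
    by blast
  \<comment> \<open>Bounds one round uniformly: 12 is the 9 of \<open>timed_rec\<close> plus the 3
    of \<open>timed_comp\<close>, and the 2 inside the polynomial is for the two pairs that pack
    context, element and accumulator.\<close>
  define B where "B p = Kc + Kh + Kk + Kb + 12 + poly pg (esize p + poly pF (esize p) + 2)" for p :: "'c \<times> 'b \<times> 'a list"
  have esize_h: "esize (h p) \<le> esize p" for p
    by (cases p) (simp add: h_def esize_tl)
  have B_h: "B (h p) \<le> B p" for p
    unfolding B_def by (intro add_mono order_refl poly_nat_mono esize_h)
  have "timed (\<lambda>_. True) ?F (\<lambda>p. (length (snd (snd p)) + 1) * B p)"
  proof (rule timed_rec[where c = c and h = h and g = "\<lambda>q. g (k q)" and b = "\<lambda>p. fst (snd p)"
        and N = "\<lambda>p. length (snd (snd p))"])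
    show "timed (\<lambda>p. True \<and> c (fst p) \<and> snd p = ?F (h (fst p))) (\<lambda>q. g (k q)) (\<lambda>q. Kk + Tg (k q) + 3)"
      by (rule timed_mono[OF timed_comp[OF K(3) Tg(1)]]) auto
  next
    fix p assume "c p"
    then obtain x b y ys where p: "p = (x, b, y # ys)"
      unfolding c_def by (metis list.exhaust prod.collapse)
    have "Tg (k (p, ?F (h p))) \<le> poly pg (esize p + poly pF (esize p) + 2)"
    proof (rule order_trans[OF Tg(2) poly_nat_mono])
      have "esize (?F (h p)) \<le> poly pF (esize p)"
        using pF poly_nat_mono[OF esize_h] le_trans by blast
      then show "esize (k (p, ?F (h p))) \<le> esize p + poly pF (esize p) + 2"
        by (simp add: k_def p h_def)
    qed
    then have "Kc + Kh + (Kk + Tg (k (p, ?F (h p))) + 3) + 9 \<le> B p"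
      unfolding B_def by linarith
    moreover have "(length (snd (snd (h p))) + 1) * B (h p) \<le> length (snd (snd p)) * B p"
      by (rule mult_le_mono[OF _ B_h]) (simp add: h_def p)
    ultimately show "Kc + Kh + (Kk + Tg (k (p, ?F (h p))) + 3) + (length (snd (snd (h p))) + 1) * B (h p) + 9
        \<le> (length (snd (snd p)) + 1) * B p"
      by simp
    show "length (snd (snd (h p))) < length (snd (snd p))" by (simp add: h_def p)
  next
    fix p assume "\<not> c p"
    then show "Kc + Kb + 9 \<le> (length (snd (snd p)) + 1) * B p"
      by (simp add: c_def B_def)
  next
    fix p
    show "?F p = (if c p then g (k (p, ?F (h p))) else fst (snd p))"
      by (cases "snd (snd p)") (simp_all add: c_def k_def h_def)
  qed (use K in simp_all)
  moreover have "poly_bounded (\<lambda>_. True) esize (\<lambda>p. (length (snd (snd p)) + 1) * B p)"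
  proof (rule poly_bounded_mono[of _ _ "\<lambda>p. (esize p + 1) * B p"])
    show "poly_bounded (\<lambda>_. True) esize (\<lambda>p. (esize p + 1) * B p)"
      unfolding B_def
      by (intro poly_bounded_add poly_bounded_mult poly_bounded_const poly_bounded_self poly_bounded_poly)
    fix p :: "'c \<times> 'b \<times> 'a list"
    have "length (snd (snd p)) \<le> esize p"
      using length_le_esize[of "snd (snd p)"] esize_snd[of p] esize_snd[of "snd p"] by linarith
    then show "(length (snd (snd p)) + 1) * B p \<le> (esize p + 1) * B p" by simp
  qed auto
  ultimately show "ptimed (\<lambda>_. True) esize ?F" unfolding ptimed_def by blast
qed

text \<open>The growth per step may depend on the context and the element but not on the
  accumulator. This excludes doubling, under which the accumulator would become exponential.\<close>

lemma ptime_foldr: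
  assumes g: "ptime (\<lambda>p. g (fst p) (fst (snd p)) (snd (snd p)))"
    and b: "ptime b" and xs: "ptime xs"
    and size: "\<And>x a s. esize (g x a s) \<le> esize s + poly q (esize x + esize a)"
  shows "ptime (\<lambda>x. foldr (\<lambda>a s. g x a s) (xs x) (b x))"
proof -
  define g' where "g' = (\<lambda>p. g (fst p) (fst (snd p)) (snd (snd p)))"
  have "esize (foldr (g x) ys c) \<le> esize c + length ys * poly q (esize x + esize ys)" for x c ys
  proof (induction ys)
    case (Cons a ys)
    have "esize (foldr (g x) (a # ys) c) \<le> esize (foldr (g x) ys c) + poly q (esize x + esize a)"
      using size by simp
    also have "\<dots> \<le> esize c + length ys * poly q (esize x + esize ys) + poly q (esize x + esize a)"
      using Cons by simp
    also have "\<dots> \<le> esize c + length ys * poly q (esize x + esize (a # ys)) + poly q (esize x + esize (a # ys))"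
      by (intro add_mono mult_mono poly_nat_mono) auto
    finally show ?case by simp
  qed simp
  note fold = this
  have "psize (\<lambda>_. True) esize (\<lambda>p. foldr (\<lambda>a s. g' (fst p, a, s)) (snd (snd p)) (fst (snd p)))"
  proof (rule poly_bounded_mono[of _ _ "\<lambda>p. esize p + esize p * poly q (esize p)"])
    show "poly_bounded (\<lambda>_. True) esize (\<lambda>p. esize p + esize p * poly q (esize p))"
      by (intro poly_bounded_add poly_bounded_mult poly_bounded_self poly_bounded_poly)
    fix p :: "'a \<times> 'c \<times> 'b list"
    obtain x c ys where p: "p = (x, c, ys)" by (metis prod.collapse)
    have "esize c + length ys * poly q (esize x + esize ys) \<le> esize p + esize p * poly q (esize p)"
      using length_le_esize[of ys] by (intro add_mono mult_mono poly_nat_mono) (simp_all add: p)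
    with fold[of x ys c] show "esize (foldr (\<lambda>a s. g' (fst p, a, s)) (snd (snd p)) (fst (snd p)))
        \<le> esize p + esize p * poly q (esize p)"
      by (simp add: p g'_def)
  qed auto
  from ptime_foldr_psize[OF g[folded g'_def] this] b xs show ?thesis
    using ptime_comp[of "\<lambda>p. foldr (\<lambda>a s. g' (fst p, a, s)) (snd (snd p)) (fst (snd p))" "\<lambda>x. (x, b x, xs x)"]
    by (simp add: g'_def ptime_Pair ptime_id)
qed

lemma ptime_map [ptime_intros]:
  assumes "ptime (\<lambda>p. f (fst p) (snd p))" "ptime xs"
  shows "ptime (\<lambda>x. map (\<lambda>a. f x a) (xs x))"
proof -
  obtain q where q: "\<And>x a. esize (f x a) \<le> poly q (esize x + esize a + 1)"
    using assms(1) unfolding ptime_def poly_bounded_def by auto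
  have "map (f x) ys = foldr (\<lambda>a s. f x a # s) ys []" for x ys
    by (induction ys) auto
  moreover have "ptime (\<lambda>x. foldr (\<lambda>a s. f x a # s) (xs x) [])"
    using ptime_comp[OF assms(1) ptime_Pair[OF ptime_fst ptime_fst[OF ptime_snd]], OF ptime_id ptime_id]
    by (intro ptime_foldr[where q = "pcompose q [:1, 1:] + 1"] ptime_intros assms(2))
      (use q in \<open>simp_all add: poly_pcompose\<close>)
  ultimately show ?thesis by simp
qed

lemma ptime_filter [ptime_intros]:
  assumes "ptime (\<lambda>p. f (fst p) (snd p))" "ptime xs"
  shows "ptime (\<lambda>x. filter (\<lambda>a. f x a) (xs x))"
proof -
  have "filter (f x) ys = foldr (\<lambda>a s. if f x a then a # s else s) ys []" for x ys
    by (induction ys) auto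
  moreover have "ptime (\<lambda>x. foldr (\<lambda>a s. if f x a then a # s else s) (xs x) [])"
    using ptime_comp[OF assms(1) ptime_Pair[OF ptime_fst ptime_fst[OF ptime_snd]], OF ptime_id ptime_id]
    by (intro ptime_foldr[where q = "[:1, 1:]"] ptime_intros assms(2)) simp_all
  ultimately show ?thesis by simp
qed

lemma ptime_list_ex [ptime_intros]:
  assumes "ptime (\<lambda>p. f (fst p) (snd p))" "ptime xs"
  shows "ptime (\<lambda>x. list_ex (\<lambda>a. f x a) (xs x))"
proof -
  have "list_ex (f x) ys \<longleftrightarrow> filter (f x) ys \<noteq> []" for x ys
    by (induction ys) auto
  then show ?thesis by (simp only:) (intro ptime_intros assms)
qed

lemma ptime_list_all [ptime_intros]:
  assumes "ptime (\<lambda>p. f (fst p) (snd p))" "ptime xs"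
  shows "ptime (\<lambda>x. list_all (\<lambda>a. f x a) (xs x))"
proof -
  have "list_all (f x) ys \<longleftrightarrow> filter (\<lambda>y. \<not> f x y) ys = []" for x ys
    by (induction ys) auto
  then show ?thesis by (simp only:) (intro ptime_intros assms)
qed

lemma ptime_append [ptime_intros]:
  assumes "ptime xs" "ptime ys"
  shows "ptime (\<lambda>x. xs x @ ys x)"
proof -
  have "us @ vs = foldr (\<lambda>a s. a # s) us vs" for us vs :: "'b list"
    by (induction us) auto
  moreover have "ptime (\<lambda>x. foldr (\<lambda>a s. a # s) (xs x) (ys x))"
    by (intro ptime_foldr[where q = "[:1, 1:]"] ptime_intros assms) simp
  ultimately show ?thesis by simp
qed

lemma ptime_concat [ptime_intros]:
  assumes "ptime xss"
  shows "ptime (\<lambda>x. concat (xss x))"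
  unfolding concat_conv_foldr
  by (intro ptime_foldr[where q = "[:0, 1:]", of "\<lambda>_ a s. a @ s"] ptime_intros assms) simp

lemma ptime_length [ptime_intros]:
  assumes "ptime xs"
  shows "ptime (\<lambda>x. length (xs x))"
proof -
  have "length ys = foldr (\<lambda>_ s. Suc s) ys 0" for ys :: "'b list"
    by (induction ys) auto
  moreover have "ptime (\<lambda>x. foldr (\<lambda>_ s. Suc s) (xs x) 0)"
    by (intro ptime_foldr[where q = 1] ptime_intros assms) simp
  ultimately show ?thesis by simp
qed

text \<open>A unary number is also the list of that many units, so iteration is a fold over the
  counter.\<close>

lemma ptime_funpow:
  fixes g :: "'a::treeable \<Rightarrow> 'b::treeable \<Rightarrow> 'b"
  assumes "ptime (\<lambda>p. g (fst p) (snd p))" "ptime k" "ptime b"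
    and "\<And>x s. esize (g x s) \<le> esize s + poly q (esize x)"
  shows "ptime (\<lambda>x. (g x ^^ k x) (b x))"
proof -
  have "(g x ^^ n) s = foldr (\<lambda>_. g x) (replicate n ()) s" for x n s
    by (induction n) auto
  moreover have "ptime (\<lambda>x. foldr (\<lambda>_ s. g x s) (replicate (k x) ()) (b x))"
    using ptime_comp[OF assms(1) ptime_Pair[OF ptime_fst ptime_snd[OF ptime_snd]], OF ptime_id ptime_id]
    by (intro ptime_foldr[where q = q] ptime_replicate assms(2,3)) (use assms(4) in simp_all)
  ultimately show ?thesis by simp
qed

text \<open>Two numbers are equal iff both truncated differences vanish; truncated subtraction is
  the iterated predecessor.\<close>

lemma ptime_eq_nat [ptime_intros]:
  assumes "ptime a" "ptime b"
  shows "ptime (\<lambda>x. a x = (b x :: nat))"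
proof -
  have "((\<lambda>s. s - 1) ^^ n) m = m - n" for m n :: nat
    by (induction n) auto
  moreover have "ptime (\<lambda>x. ((\<lambda>s. s - 1) ^^ b x) (a x))" "ptime (\<lambda>x. ((\<lambda>s. s - 1) ^^ a x) (b x))"
    by (intro ptime_funpow[where q = 0] ptime_pred ptime_intros assms; simp)+
  ultimately have "ptime (\<lambda>x. a x - b x = 0 \<and> b x - a x = 0)"
    by (intro ptime_conj ptime_zero) simp_all
  moreover have "(a x = b x) = (a x - b x = 0 \<and> b x - a x = 0)" for x by auto
  ultimately show ?thesis by simp
qed

section \<open>Token sliding along a modular partition\<close>

definition indep :: "('a \<Rightarrow> 'a \<Rightarrow> bool) \<Rightarrow> 'a set \<Rightarrow> bool" where
  "indep adj X \<longleftrightarrow> (\<forall>u\<in>X. \<forall>v\<in>X. \<not> adj u v)"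

text \<open>The vertex set is a parameter, so that sliding inside a module is the same relation with
  a smaller \<open>W\<close> and no induced graph has to be formed.\<close>

definition slide :: "('a \<Rightarrow> 'a \<Rightarrow> bool) \<Rightarrow> 'a set \<Rightarrow> 'a set \<Rightarrow> 'a set \<Rightarrow> bool" where
  "slide adj W X Y \<longleftrightarrow> X \<subseteq> W \<and> indep adj X \<and> indep adj Y \<and>
     (\<exists>u\<in>X. \<exists>v\<in>W - X. adj u v \<and> Y = insert v (X - {u}))"

abbreviation slides :: "('a \<Rightarrow> 'a \<Rightarrow> bool) \<Rightarrow> 'a set \<Rightarrow> 'a set \<Rightarrow> 'a set \<Rightarrow> bool" where
  "slides adj W \<equiv> (slide adj W)\<^sup>*\<^sup>*"

definition module_on :: "('a \<Rightarrow> 'a \<Rightarrow> bool) \<Rightarrow> 'a set \<Rightarrow> 'a set \<Rightarrow> bool" where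
  "module_on adj W M \<longleftrightarrow> M \<subseteq> W \<and> (\<forall>x\<in>W - M. \<forall>y\<in>M. \<forall>z\<in>M. adj x y \<longrightarrow> adj x z)"

lemma module_onD: "module_on adj W M \<Longrightarrow> x \<in> W \<Longrightarrow> x \<notin> M \<Longrightarrow> y \<in> M \<Longrightarrow> z \<in> M \<Longrightarrow> adj x y \<longleftrightarrow> adj x z"
  unfolding module_on_def by blast

lemma indep_subset: "indep adj X \<Longrightarrow> Y \<subseteq> X \<Longrightarrow> indep adj Y"
  unfolding indep_def by blast

text \<open>
  The parts are indexed by representatives, so that the quotient graph is the subgraph induced by \<open>R\<close>.
\<close>

locale modular_partition =
  fixes adj :: "'a \<Rightarrow> 'a \<Rightarrow> bool" and W :: "'a set" and R :: "'a set" and D :: "'a \<Rightarrow> 'a set"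
  assumes sym: "adj u v \<Longrightarrow> adj v u"
    and irrefl: "\<not> adj u u"
    and fin: "finite R"
    and rep: "r \<in> R \<Longrightarrow> r \<in> D r"
    and cover: "(\<Union>r\<in>R. D r) = W"
    and disj: "r \<in> R \<Longrightarrow> s \<in> R \<Longrightarrow> r \<noteq> s \<Longrightarrow> D r \<inter> D s = {}"
    and module: "r \<in> R \<Longrightarrow> module_on adj W (D r)"
begin

lemma part_unique: "r \<in> R \<Longrightarrow> s \<in> R \<Longrightarrow> x \<in> D r \<Longrightarrow> x \<in> D s \<Longrightarrow> r = s"
  using disj by blast

text \<open>Two exchanges of an endpoint: \<open>y\<close> lies outside the module
  \<open>D r\<close>, so \<open>x\<close> may be replaced by \<open>r\<close>; then \<open>r\<close>
  lies outside \<open>D s\<close>, so \<open>y\<close> may be replaced by \<open>s\<close>.\<close>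

lemma adj_parts:
  assumes "r \<in> R" "s \<in> R" "r \<noteq> s" "x \<in> D r" "y \<in> D s"
  shows "adj x y \<longleftrightarrow> adj r s"
proof -
  have W: "x \<in> W" "y \<in> W" "r \<in> W" using assms cover rep by blast+
  have "y \<notin> D r" "r \<notin> D s" using assms part_unique rep by blast+
  then have "adj y x \<longleftrightarrow> adj y r" "adj r y \<longleftrightarrow> adj r s"
    using module_onD[OF module] assms W rep by blast+
  then show ?thesis using sym by blast
qed

lemma slide_sym: "slide adj W X Y \<Longrightarrow> slide adj W Y X"
  unfolding slide_def using sym irrefl by blast

lemma reach_sym: "slides adj W X Y \<Longrightarrow> slides adj W Y X"
  by (induction rule: rtranclp_induct) (auto intro: converse_rtranclp_into_rtranclp slide_sym)

definition occ :: "'a set \<Rightarrow> 'a set" where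
  "occ X = {r \<in> R. X \<inter> D r \<noteq> {}}"

text \<open>A token slide seen in the quotient; \<open>H\<close> collects the parts that a token
  must not leave because others would stay behind.\<close>

definition qstep :: "'a set \<Rightarrow> 'a set \<Rightarrow> 'a set \<Rightarrow> bool" where
  "qstep H q q' \<longleftrightarrow> (\<exists>a\<in>q - H. \<exists>b\<in>R - q. adj a b \<and> q' = insert b (q - {a}) \<and> indep adj q')"

lemma indep_occ:
  assumes "indep adj X"
  shows "indep adj (occ X)"
  unfolding indep_def
proof (intro ballI notI)
  fix r s assume rs: "r \<in> occ X" "s \<in> occ X" "adj r s"
  then obtain x y where "x \<in> X" "x \<in> D r" "y \<in> X" "y \<in> D s" unfolding occ_def by blast
  moreover have "r \<noteq> s" using rs irrefl by blast
  ultimately show False using rs assms adj_parts[of r s x y] unfolding occ_def indep_def by blast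
qed

definition heavy :: "'a set \<Rightarrow> 'a set" where
  "heavy S = {r \<in> R. \<exists>x\<in>S \<inter> D r. \<exists>y\<in>S \<inter> D r. x \<noteq> y}"

definition states :: "'a set \<Rightarrow> 'a set set" where
  "states S = {q. (qstep (heavy S))\<^sup>*\<^sup>* (occ S) q}"

definition frozen :: "'a set \<Rightarrow> 'a set" where
  "frozen S = {r \<in> R. \<forall>q\<in>states S. r \<in> q}"

lemma states_start: "occ S \<in> states S"
  unfolding states_def by simp

lemma states_step: "q \<in> states S \<Longrightarrow> qstep (heavy S) q q' \<Longrightarrow> q' \<in> states S"
  unfolding states_def by (simp add: rtranclp.rtrancl_into_rtrancl)

lemma states_induct [consumes 1, case_names start step]:
  assumes "q \<in> states S" "P (occ S)"
    "\<And>q q'. q \<in> states S \<Longrightarrow> P q \<Longrightarrow> qstep (heavy S) q q' \<Longrightarrow> P q'"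
  shows "P q"
proof -
  from assms(1) have "(qstep (heavy S))\<^sup>*\<^sup>* (occ S) q" unfolding states_def by simp
  then show ?thesis
    by (induction rule: rtranclp_induct) (use assms(2,3) in \<open>auto simp: states_def\<close>)
qed

lemma states_invar:
  assumes "q \<in> states S" "indep adj S"
  shows "q \<subseteq> R \<and> indep adj q \<and> heavy S \<subseteq> q"
  using assms(1)
proof (induction rule: states_induct)
  case start
  then show ?case using indep_occ[OF assms(2)] unfolding occ_def heavy_def by blast
next
  case (step q q')
  then show ?case unfolding qstep_def by blast
qed

lemma heavy_subset_frozen: "indep adj S \<Longrightarrow> heavy S \<subseteq> frozen S"
  using states_invar unfolding frozen_def heavy_def by blast

lemma reach_imp:
  assumes S: "S \<subseteq> W" "indep adj S" and reach: "slides adj W S T"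
  shows "T \<subseteq> W \<and> occ T \<in> states S \<and> (\<forall>r\<in>R - heavy S. \<forall>x\<in>T \<inter> D r. \<forall>y\<in>T \<inter> D r. x = y) \<and>
    (\<forall>r\<in>heavy S. \<exists>x\<in>T \<inter> D r. \<exists>y\<in>T \<inter> D r. x \<noteq> y) \<and>
    (\<forall>r\<in>frozen S. slides adj (D r) (S \<inter> D r) (T \<inter> D r))"
  using reach
proof (induction rule: rtranclp_induct)
  case base
  then show ?case using S states_start by (auto simp: heavy_def)
next
  case (step X Y)
  then obtain u v where X: "X \<subseteq> W" "indep adj X" and Y: "indep adj Y"
    and uv: "u \<in> X" "v \<in> W" "v \<notin> X" "adj u v" "Y = insert v (X - {u})"
    unfolding slide_def by blast
  then obtain r s where r: "r \<in> R" "u \<in> D r" and s: "s \<in> R" "v \<in> D s"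
    using cover by blast
  have IH_occ: "occ X \<in> states S"
    and IH_light: "\<And>t x y. t \<in> R - heavy S \<Longrightarrow> x \<in> X \<inter> D t \<Longrightarrow> y \<in> X \<inter> D t \<Longrightarrow> x = y"
    and IH_heavy: "\<And>t. t \<in> heavy S \<Longrightarrow> \<exists>x\<in>X \<inter> D t. \<exists>y\<in>X \<inter> D t. x \<noteq> y"
    and IH_frozen: "\<And>t. t \<in> frozen S \<Longrightarrow> slides adj (D t) (S \<inter> D t) (X \<inter> D t)"
    using step.IH by blast+
  have heavyR: "t \<in> R" if "t \<in> heavy S" for t using that by (simp add: heavy_def)
  have frozenR: "t \<in> R" if "t \<in> frozen S" for t using that by (simp add: frozen_def)
  have YW: "Y \<subseteq> W" using X uv by blast
  show ?case
  proof (cases "r = s")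
    case True
    have other: "Y \<inter> D t = X \<inter> D t" if "t \<in> R" "t \<noteq> r" for t
      using that uv r s True part_unique by blast
    have here: "slide adj (D r) (X \<inter> D r) (Y \<inter> D r)"
      unfolding slide_def
    proof (intro conjI bexI)
      show "indep adj (X \<inter> D r)" "indep adj (Y \<inter> D r)"
        using X Y indep_subset by blast+
    qed (use uv r s True in auto)
    have "occ Y = occ X"
      unfolding occ_def
    proof (intro Collect_cong conj_cong refl)
      fix t assume "t \<in> R"
      then show "(Y \<inter> D t \<noteq> {}) = (X \<inter> D t \<noteq> {})"
        using other[of t] uv r s True by (cases "t = r") auto
    qed
    moreover have "\<forall>x\<in>Y \<inter> D t. \<forall>y\<in>Y \<inter> D t. x = y" if "t \<in> R - heavy S" for t
    proof (cases "t = r")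
      case t: True
      have "x = u" if "x \<in> X \<inter> D r" for x
        using IH_light[of r x u] \<open>t \<in> R - heavy S\<close> t that uv(1) r(2) by blast
      then have "x = v" if "x \<in> Y \<inter> D r" for x using uv(5) that by blast
      then show ?thesis using t by metis
    next
      case False
      then have "Y \<inter> D t = X \<inter> D t" using other that by blast
      then show ?thesis using IH_light[OF that] by (simp only:) blast
    qed
    moreover have "\<exists>x\<in>Y \<inter> D t. \<exists>y\<in>Y \<inter> D t. x \<noteq> y" if t: "t \<in> heavy S" for t
    proof (cases "t = r")
      case tr: True
      then obtain x where "x \<in> X \<inter> D r" "x \<noteq> u" using IH_heavy[OF t] by metis
      then have "x \<in> Y \<inter> D t" "v \<in> Y \<inter> D t" "x \<noteq> v"
        using uv(3) s(2) True tr by (simp_all add: uv(5)) auto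
      then show ?thesis by blast
    next
      case False
      then have "Y \<inter> D t = X \<inter> D t" using other heavyR t by blast
      then show ?thesis using IH_heavy[OF t] by (simp only:)
    qed
    moreover have "slides adj (D t) (S \<inter> D t) (Y \<inter> D t)" if t: "t \<in> frozen S" for t
    proof (cases "t = r")
      case True
      then show ?thesis using here IH_frozen[OF t] by (metis rtranclp.rtrancl_into_rtrancl)
    next
      case False
      then have "Y \<inter> D t = X \<inter> D t" using other frozenR t by blast
      then show ?thesis using IH_frozen[OF t] by (simp only:)
    qed
    ultimately show ?thesis using YW IH_occ by simp
  next
    case False
    \<comment> \<open>A second token in the part that is left would be adjacent to \<open>v\<close>,
      just as \<open>u\<close> is, and both belong to \<open>Y\<close>. Dually, a token already in
      the entered part would be adjacent to \<open>u\<close> within \<open>X\<close>.\<close>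
    have Xr: "x = u" if "x \<in> X" "x \<in> D r" for x
    proof (rule ccontr)
      assume "x \<noteq> u"
      then have "x \<in> Y" "v \<in> Y" using that uv by auto
      moreover have "adj x v" using adj_parts[of r s] r s False that uv by blast
      ultimately show False using Y unfolding indep_def by blast
    qed
    have Xs: "x \<notin> D s" if "x \<in> X" for x
    proof
      assume "x \<in> D s"
      then have "adj u x" using adj_parts[of r s] r s False that uv by blast
      then show False using X uv that unfolding indep_def by blast
    qed
    have Yr: "Y \<inter> D r = {}" using Xr uv r s False part_unique by blast
    have Ys: "Y \<inter> D s = {v}" using Xs uv s by blast
    have other: "Y \<inter> D t = X \<inter> D t" if "t \<in> R" "t \<noteq> r" "t \<noteq> s" for t
      using that uv r s part_unique by blast
    have occ: "occ Y = insert s (occ X - {r})"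
    proof (rule set_eqI)
      fix t
      show "t \<in> occ Y \<longleftrightarrow> t \<in> insert s (occ X - {r})"
        using other[of t] Yr Ys r s False unfolding occ_def by (cases "t = r"; cases "t = s") auto
    qed
    have rX: "r \<in> occ X" and sX: "s \<notin> occ X" using uv r Xs unfolding occ_def by blast+
    have "r \<notin> heavy S"
    proof
      assume "r \<in> heavy S"
      from IH_heavy[OF this] Xr show False by blast
    qed
    moreover have "adj r s" using adj_parts[of r s u v] r s False uv by blast
    ultimately have "qstep (heavy S) (occ X) (occ Y)"
      unfolding qstep_def using rX sX s occ indep_occ[OF Y] by blast
    then have YQ: "occ Y \<in> states S" using IH_occ states_step by blast
    have "r \<notin> occ Y" using Yr unfolding occ_def by blast
    with YQ have rF: "r \<notin> frozen S" by (auto simp: frozen_def)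
    have sF: "s \<notin> frozen S" using sX IH_occ by (auto simp: frozen_def)
    with rF have H: "r \<notin> heavy S" "s \<notin> heavy S"
      using heavy_subset_frozen[OF S(2)] by blast+
    have "\<forall>x\<in>Y \<inter> D t. \<forall>y\<in>Y \<inter> D t. x = y" if "t \<in> R - heavy S" for t
      using other[of t] Yr Ys IH_light[OF that] that by (cases "t = r"; cases "t = s") auto
    moreover have "\<exists>x\<in>Y \<inter> D t. \<exists>y\<in>Y \<inter> D t. x \<noteq> y" if t: "t \<in> heavy S" for t
    proof -
      have "Y \<inter> D t = X \<inter> D t" using other heavyR t H by blast
      then show ?thesis using IH_heavy[OF t] by (simp only:)
    qed
    moreover have "slides adj (D t) (S \<inter> D t) (Y \<inter> D t)" if t: "t \<in> frozen S" for t
    proof -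
      have "Y \<inter> D t = X \<inter> D t" using other frozenR t rF sF by blast
      then show ?thesis using IH_frozen[OF t] by (simp only:)
    qed
    ultimately show ?thesis using YW YQ by simp
  qed
qed

text \<open>
  A configuration consists of a state \<open>q\<close> and, for every part, the tokens that it holds when occupied.
\<close>

definition config :: "'a set \<Rightarrow> ('a \<Rightarrow> 'a set) \<Rightarrow> 'a set" where
  "config q c = (\<Union>r\<in>q. c r)"

lemma config_subset: "q \<subseteq> R \<Longrightarrow> (\<And>r. r \<in> R \<Longrightarrow> c r \<subseteq> D r) \<Longrightarrow> config q c \<subseteq> W"
  unfolding config_def using cover by blast

lemma indep_config:
  assumes "q \<subseteq> R" "indep adj q" "\<And>r. r \<in> R \<Longrightarrow> c r \<subseteq> D r" "\<And>r. r \<in> R \<Longrightarrow> indep adj (c r)"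
  shows "indep adj (config q c)"
  unfolding indep_def
proof (intro ballI notI)
  fix x y assume "x \<in> config q c" "y \<in> config q c" "adj x y"
  then obtain r s where rs: "r \<in> q" "s \<in> q" "x \<in> c r" "y \<in> c s" unfolding config_def by blast
  show False
  proof (cases "r = s")
    case True
    then show ?thesis using rs assms \<open>adj x y\<close> unfolding indep_def by blast
  next
    case False
    then have "adj r s" using adj_parts[of r s x y] rs assms(1,3) \<open>adj x y\<close> by blast
    then show ?thesis using rs assms(2) unfolding indep_def by blast
  qed
qed

text \<open>The contents are prescribed for all parts, also for those empty in the current state, so
  that one choice serves every state. Singletons are required exactly where a quotient step may
  happen.\<close>

definition contents :: "'a set \<Rightarrow> ('a \<Rightarrow> 'a set) \<Rightarrow> bool" where
  "contents S c \<longleftrightarrow> (\<forall>r\<in>R. c r \<subseteq> D r \<and> indep adj (c r) \<and> (r \<notin> frozen S \<longrightarrow> (\<exists>x. c r = {x})))"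

text \<open>One quotient step lifts to one slide: the part left is missing from the new state and
  the part entered from the old one, so neither is frozen and both contents are single vertices,
  adjacent by \<open>adj_parts\<close>.\<close>

lemma reach_states:
  assumes S: "indep adj S" and c: "contents S c" and q: "q \<in> states S"
  shows "slides adj W (config (occ S) c) (config q c)"
  using q
proof (induction rule: states_induct)
  case (step q q')
  from step obtain a b where ab: "a \<in> q" "a \<notin> heavy S" "b \<in> R" "b \<notin> q" "adj a b" "q' = insert b (q - {a})"
    unfolding qstep_def by blast
  have q': "q' \<in> states S" using step states_step by blast
  note inv = states_invar[OF step.hyps(1) S] states_invar[OF q' S]
  have "a \<notin> q'" using ab by auto
  then have "a \<notin> frozen S" using q' by (auto simp: frozen_def)
  moreover have "b \<notin> frozen S" using step.hyps(1) ab(4) by (auto simp: frozen_def)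
  moreover have "a \<in> R" using inv ab by blast
  ultimately obtain x y where xy: "c a = {x}" "c b = {y}" using c ab unfolding contents_def by metis
  have cD: "\<And>r. r \<in> R \<Longrightarrow> c r \<subseteq> D r" and ci: "\<And>r. r \<in> R \<Longrightarrow> indep adj (c r)"
    using c unfolding contents_def by blast+
  have x: "x \<in> D a" and y: "y \<in> D b" using cD xy \<open>a \<in> R\<close> ab by blast+
  have yn: "y \<notin> c r" if "r \<in> q" for r
    using that y cD part_unique[of r b y] inv ab by blast
  have xn: "x \<notin> c r" if "r \<in> q" "r \<noteq> a" for r
    using that x cD part_unique[of r a x] inv ab by blast
  have "a \<noteq> b" using ab by blast
  have "slide adj W (config q c) (config q' c)"
    unfolding slide_def
  proof (intro conjI bexI)
    show "config q c \<subseteq> W" using inv cD config_subset by blast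
    show "indep adj (config q c)" "indep adj (config q' c)"
      using inv cD ci by (auto intro!: indep_config)
    show "adj x y" using adj_parts[of a b x y] ab x y \<open>a \<in> R\<close> \<open>a \<noteq> b\<close> by blast
    show "x \<in> config q c" unfolding config_def using ab xy by blast
    show "y \<in> W - config q c" unfolding config_def using y yn ab cover by blast
    show "config q' c = insert y (config q c - {x})"
      unfolding config_def
    proof (rule set_eqI)
      fix z
      show "z \<in> (\<Union>r\<in>q'. c r) \<longleftrightarrow> z \<in> insert y ((\<Union>r\<in>q. c r) - {x})"
        using ab(1) xy xn by (auto simp: ab(6))
    qed
  qed
  with step show ?case by (metis rtranclp.rtrancl_into_rtrancl)
qed simp

lemma reach_between:
  assumes "indep adj S" "contents S c" "q \<in> states S" "q' \<in> states S"
  shows "slides adj W (config q c) (config q' c)"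
  using reach_sym[OF reach_states[OF assms(1-3)]] reach_states[OF assms(1,2,4)] by simp

text \<open>A frozen part belongs to every reachable state. Any independent contents of it fit the
  tokens elsewhere, because adjacency between parts depends only on the representatives and the
  state is independent.\<close>

lemma reach_inside:
  assumes S: "indep adj S" and c: "contents S c" and q: "q \<in> states S" and r: "r \<in> frozen S"
    and reach: "slides adj (D r) (c r) Z"
  shows "slides adj W (config q c) (config q (c(r := Z)))"
  using reach
proof (induction rule: rtranclp_induct)
  case (step Y Z)
  from step(2) obtain u v where Y: "Y \<subseteq> D r" "indep adj Y" and Z: "indep adj Z"
    and uv: "u \<in> Y" "v \<in> D r" "v \<notin> Y" "adj u v" "Z = insert v (Y - {u})"
    unfolding slide_def by blast
  have rq: "r \<in> q" "r \<in> R" using r q unfolding frozen_def by blast+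
  have cD: "\<And>r. r \<in> R \<Longrightarrow> c r \<subseteq> D r" and ci: "\<And>r. r \<in> R \<Longrightarrow> indep adj (c r)"
    using c unfolding contents_def by blast+
  note inv = states_invar[OF q S]
  have uvn: "u \<notin> c s" "v \<notin> c s" if "s \<in> q" "s \<noteq> r" for s
    using that Y uv cD part_unique[of r s] inv rq by blast+
  have "slide adj W (config q (c(r := Y))) (config q (c(r := Z)))"
    unfolding slide_def
  proof (intro conjI bexI)
    show "config q (c(r := Y)) \<subseteq> W"
      using inv cD Y by (intro config_subset) auto
    show "indep adj (config q (c(r := Y)))" "indep adj (config q (c(r := Z)))"
      using inv ci Y Z uv subsetD[OF cD] by (auto intro!: indep_config simp: subset_eq split: if_splits)
    show "adj u v" by fact
    show "u \<in> config q (c(r := Y))" unfolding config_def using uv rq by auto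
    show "v \<in> W - config q (c(r := Y))" unfolding config_def using uv uvn rq cover by auto
    show "config q (c(r := Z)) = insert v (config q (c(r := Y)) - {u})"
      unfolding config_def
    proof (rule set_eqI)
      fix z
      show "z \<in> (\<Union>s\<in>q. (c(r := Z)) s) \<longleftrightarrow> z \<in> insert v ((\<Union>s\<in>q. (c(r := Y)) s) - {u})"
        using uvn rq by (auto simp: uv(5) split: if_splits)
    qed
  qed
  with step show ?case by (metis rtranclp.rtrancl_into_rtrancl)
qed simp

text \<open>The parts are exchanged one after another, by induction over the finite set
  \<open>A\<close> of parts that already have their new contents.\<close>

lemma reach_contents:
  assumes S: "indep adj S" and c: "contents S c" and c': "contents S c'" and q: "q \<in> states S"
    and reach: "\<And>r. r \<in> frozen S \<Longrightarrow> slides adj (D r) (c r) (c' r)"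
  shows "slides adj W (config q c) (config q c')"
proof -
  have "slides adj W (config q c) (config q (\<lambda>r. if r \<in> A then c' r else c r))" if "A \<subseteq> R" for A
    using finite_subset[OF that fin] that
  proof (induction A rule: finite_induct)
    case (insert r A)
    define d where "d = (\<lambda>r. if r \<in> A then c' r else c r)"
    have d: "contents S d" using c c' unfolding contents_def d_def by auto
    have d': "(\<lambda>s. if s \<in> insert r A then c' s else c s) = d(r := c' r)" by (auto simp: d_def fun_eq_iff)
    have "slides adj W (config q d) (config q (d(r := c' r)))"
    proof (cases "r \<in> frozen S")
      case True
      then show ?thesis
        using reach insert(2) by (intro reach_inside[OF S d q]) (auto simp: d_def)
    next
      case False
      then obtain q0 where q0: "q0 \<in> states S" "r \<notin> q0" using insert unfolding frozen_def by blast
      have d2: "contents S (d(r := c' r))" using d c' unfolding contents_def by auto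
      \<comment> \<open>At \<open>q0\<close> the part \<open>r\<close> is empty, so its prescribed
        contents are invisible and can be replaced without a slide.\<close>
      have "config q0 d = config q0 (d(r := c' r))" unfolding config_def using q0 by auto
      then show ?thesis using reach_between[OF S d q q0(1)] reach_between[OF S d2 q0(1) q] by simp
    qed
    then show ?case using insert unfolding d' d_def by (simp add: rtranclp_trans)
  qed simp
  from this[OF order_refl] have "slides adj W (config q c) (config q (\<lambda>r. if r \<in> R then c' r else c r))" .
  moreover have "config q (\<lambda>r. if r \<in> R then c' r else c r) = config q c'"
    unfolding config_def using states_invar[OF q S] by auto
  ultimately show ?thesis by simp
qed

lemma config_occ:
  assumes "X \<subseteq> W" "\<And>r. r \<in> occ X \<Longrightarrow> c r = X \<inter> D r"
  shows "config (occ X) c = X"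
proof
  show "config (occ X) c \<subseteq> X" unfolding config_def using assms(2) by blast
  show "X \<subseteq> config (occ X) c"
  proof
    fix x assume x: "x \<in> X"
    then obtain r where "r \<in> R" "x \<in> D r" using assms(1) cover by blast
    then have "r \<in> occ X" "x \<in> X \<inter> D r" using x unfolding occ_def by blast+
    then show "x \<in> config (occ X) c" unfolding config_def using assms(2) by blast
  qed
qed

theorem reach_iff:
  assumes S: "S \<subseteq> W" "indep adj S" and T: "T \<subseteq> W" "indep adj T"
  shows "slides adj W S T \<longleftrightarrow> occ T \<in> states S \<and>
    (\<forall>r\<in>R - frozen S. \<forall>x\<in>T \<inter> D r. \<forall>y\<in>T \<inter> D r. x = y) \<and>
    (\<forall>r\<in>frozen S. slides adj (D r) (S \<inter> D r) (T \<inter> D r))"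
    (is "?reach \<longleftrightarrow> ?conds")
proof
  assume ?reach
  from reach_imp[OF S this] heavy_subset_frozen[OF S(2)] show ?conds by blast
next
  assume conds: ?conds
  \<comment> \<open>The default \<open>{r}\<close> for an empty part is the vertex where a token
    passing through will be placed; \<open>contents\<close> demands some singleton there.\<close>
  define cont where "cont X r = (if r \<in> occ X then X \<inter> D r else {r})" for X r
  have cont: "contents S (cont X)"
    if "indep adj X" "\<forall>r\<in>R - frozen S. \<forall>x\<in>X \<inter> D r. \<forall>y\<in>X \<inter> D r. x = y" for X
    unfolding contents_def
  proof (intro ballI conjI impI)
    fix r assume r: "r \<in> R"
    show "cont X r \<subseteq> D r" using r rep by (auto simp: cont_def)
    show "indep adj (cont X r)"
      using that(1) irrefl by (auto simp: cont_def indep_def)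
    assume "r \<notin> frozen S"
    then have *: "\<forall>x\<in>X \<inter> D r. \<forall>y\<in>X \<inter> D r. x = y" using that r by blast
    show "\<exists>x. cont X r = {x}"
    proof (cases "r \<in> occ X")
      case True
      then obtain x where "x \<in> X \<inter> D r" unfolding occ_def by blast
      with * True have "cont X r = {x}" unfolding cont_def by auto
      then show ?thesis ..
    qed (simp add: cont_def)
  qed
  have cS: "contents S (cont S)"
    using heavy_subset_frozen[OF S(2)] by (intro cont S) (unfold heavy_def, blast)
  have cT: "contents S (cont T)" using conds by (intro cont T) blast
  have "S = config (occ S) (cont S)" by (rule config_occ[symmetric]) (simp_all add: S cont_def)
  moreover have "T = config (occ T) (cont T)" by (rule config_occ[symmetric]) (simp_all add: T cont_def)
  moreover have "slides adj W (config (occ S) (cont S)) (config (occ T) (cont S))"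
    using conds by (intro reach_states S cS) blast
  moreover have "slides adj W (config (occ T) (cont S)) (config (occ T) (cont T))"
  proof (rule reach_contents[OF S(2) cS cT])
    show T: "occ T \<in> states S" using conds by blast
    fix r assume r: "r \<in> frozen S"
    then have "r \<in> occ S" "r \<in> occ T" using T states_start unfolding frozen_def by blast+
    then show "slides adj (D r) (cont S r) (cont T r)"
      using conds r unfolding cont_def by auto
  qed
  ultimately show ?reach by (metis rtranclp_trans)
qed

end

section \<open>Modules and modular-width\<close>

text \<open>
  If a member of \<open>\<V>\<close> is not contained in a part, it meets all parts; if there are three parts, the union
  of all parts but one is then a module.
\<close>

lemma parts_le_modules:
  assumes sym: "\<And>u v. adj u v \<Longrightarrow> adj v u"
    and P: "partition_on W \<P>" "finite \<P>" "\<And>A. A \<in> \<P> \<Longrightarrow> module_on adj W A"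
    and prime: "\<And>\<Q> A B. \<Q> \<subseteq> \<P> \<Longrightarrow> A \<in> \<Q> \<Longrightarrow> B \<in> \<Q> \<Longrightarrow> A \<noteq> B \<Longrightarrow> module_on adj W (\<Union>\<Q>) \<Longrightarrow> \<Q> = \<P>"
    and V: "partition_on W \<V>" "finite \<V>" "\<And>M. M \<in> \<V> \<Longrightarrow> module_on adj W M \<and> M \<noteq> W"
  shows "card \<P> \<le> card \<V>"
proof (cases "\<forall>M\<in>\<V>. \<exists>A\<in>\<P>. M \<subseteq> A")
  case True
  then obtain f where f: "\<And>M. M \<in> \<V> \<Longrightarrow> f M \<in> \<P> \<and> M \<subseteq> f M" by metis
  have "A \<in> f ` \<V>" if A: "A \<in> \<P>" for A
  proof -
    have "A \<noteq> {}" using A P(1) by (auto simp: partition_on_def)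
    then obtain x where x: "x \<in> A" by blast
    then have "x \<in> W" using A P(1) by (auto simp: partition_on_def)
    then obtain M where M: "M \<in> \<V>" "x \<in> M" using V(1) by (auto simp: partition_on_def)
    then have "f M = A" using f[OF M(1)] x A P(1) by (auto simp: partition_on_def disjoint_def)
    then show ?thesis using M by blast
  qed
  then show ?thesis using surj_card_le[OF V(2), of \<P> f] by blast
next
  case False
  then obtain M where M: "M \<in> \<V>" "\<And>A. A \<in> \<P> \<Longrightarrow> \<not> M \<subseteq> A" by blast
  have UP: "\<Union>\<P> = W" and UV: "\<Union>\<V> = W" using P(1) V(1) by (auto simp: partition_on_def)
  have same: "A = B" if "A \<in> \<P>" "B \<in> \<P>" "x \<in> A" "x \<in> B" for A B x
    using that P(1) by (auto simp: partition_on_def disjoint_def)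
  have MW: "M \<subseteq> W" "M \<noteq> W" "module_on adj W M" using M V by (auto simp: module_on_def)
  have "M \<noteq> {}" using M V(1) by (auto simp: partition_on_def)
  then obtain x where "x \<in> M" by blast
  then obtain A where A: "A \<in> \<P>" "x \<in> A" using MW UP by blast
  then obtain y where y: "y \<in> M" "y \<notin> A" using M(2) by blast
  then obtain B where B: "B \<in> \<P>" "y \<in> B" using MW UP by blast
  define \<Q> where "\<Q> = {C \<in> \<P>. C \<inter> M \<noteq> {}}"
  have "\<Q> = \<P>"
  proof (rule prime)
    show "\<Q> \<subseteq> \<P>" "A \<in> \<Q>" "B \<in> \<Q>" "A \<noteq> B" using A B y \<open>x \<in> M\<close> by (auto simp: \<Q>_def)
    \<comment> \<open>Inside the part of \<open>a\<close> there is some \<open>c\<close> in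
      \<open>M\<close>. Passing from \<open>a\<close> to \<open>c\<close> uses that this part is a
      module, passing from \<open>c\<close> to \<open>m\<close> uses \<open>M\<close>, which
      \<open>z\<close> avoids because \<open>M\<close> is covered by the parts in
      \<open>\<Q>\<close>.\<close>
    have eq: "adj z a \<longleftrightarrow> adj z m" if zam: "z \<in> W" "z \<notin> \<Union>\<Q>" "a \<in> \<Union>\<Q>" "m \<in> M" for z a m
    proof -
      obtain C c where C: "C \<in> \<P>" "a \<in> C" "c \<in> C" "c \<in> M" using zam(3) unfolding \<Q>_def by blast
      then have "z \<notin> C" using zam unfolding \<Q>_def by blast
      then have "adj z a \<longleftrightarrow> adj z c" using module_onD[OF P(3)] C zam by blast
      moreover have "z \<notin> M" using zam UP unfolding \<Q>_def by blast
      then have "adj z c \<longleftrightarrow> adj z m" using module_onD[OF MW(3)] C zam by blast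
      ultimately show ?thesis by simp
    qed
    show "module_on adj W (\<Union>\<Q>)"
      unfolding module_on_def
    proof (intro conjI ballI impI)
      show "\<Union>\<Q> \<subseteq> W" using UP by (auto simp: \<Q>_def)
      fix w a b assume "w \<in> W - \<Union>\<Q>" "a \<in> \<Union>\<Q>" "b \<in> \<Union>\<Q>" "adj w a"
      then show "adj w b" using eq[of w a x] eq[of w b x] \<open>x \<in> M\<close> by simp
    qed
  qed
  then have meets: "C \<inter> M \<noteq> {}" if "C \<in> \<P>" for C using that unfolding \<Q>_def by blast
  have "card \<P> \<le> 2"
  proof (rule ccontr)
    assume "\<not> card \<P> \<le> 2"
    then have three: "card \<P> \<ge> 3" by simp
    obtain z where z: "z \<in> W" "z \<notin> M" using MW by blast
    then obtain C where C: "C \<in> \<P>" "z \<in> C" using UP by blast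
    have "card (\<P> - {C}) \<ge> 2" using three C P(2) by simp
    then obtain E F where EF: "E \<in> \<P> - {C}" "F \<in> \<P> - {C}" "E \<noteq> F"
      by (metis card_le_Suc0_iff_eq finite_Diff P(2) not_less_eq_eq numeral_2_eq_2)
    \<comment> \<open>Three exchanges: \<open>a\<close> to \<open>k\<close> within the part
      \<open>K\<close>, \<open>w\<close> to \<open>z\<close> within \<open>C\<close>, and
      \<open>k\<close> to \<open>m\<close> within \<open>M\<close>, which \<open>z\<close> avoids.
      Hence all of \<open>C\<close> sees all other parts alike.\<close>
    have eq: "adj w a \<longleftrightarrow> adj z m" if wam: "w \<in> C" "a \<in> \<Union>(\<P> - {C})" "m \<in> M" "m \<notin> C" for w a m
    proof -
      obtain K where K: "K \<in> \<P>" "K \<noteq> C" "a \<in> K" using wam by blast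
      then obtain k where k: "k \<in> K" "k \<in> M" using meets by blast
      have W: "w \<in> W" "k \<in> W" using wam C K k UP by blast+
      have "w \<notin> K" "k \<notin> C" using same K C k wam by blast+
      then have "adj w a \<longleftrightarrow> adj w k" using module_onD[OF P(3)] K k W by blast
      also have "\<dots> \<longleftrightarrow> adj k w" using sym by blast
      also have "\<dots> \<longleftrightarrow> adj k z" using module_onD[OF P(3)] C wam W \<open>k \<notin> C\<close> by blast
      also have "\<dots> \<longleftrightarrow> adj z k" using sym by blast
      also have "\<dots> \<longleftrightarrow> adj z m" using module_onD[OF MW(3)] z k wam by blast
      finally show ?thesis .
    qed
    obtain m where m: "m \<in> M" "m \<notin> C" using EF meets same C by blast
    have WC: "W - \<Union>(\<P> - {C}) \<subseteq> C" using UP by blast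
    have "module_on adj W (\<Union>(\<P> - {C}))"
      unfolding module_on_def
    proof (intro conjI ballI impI)
      show "\<Union>(\<P> - {C}) \<subseteq> W" using UP by auto
      fix w a b assume "w \<in> W - \<Union>(\<P> - {C})" "a \<in> \<Union>(\<P> - {C})" "b \<in> \<Union>(\<P> - {C})" "adj w a"
      then show "adj w b" using eq[of w a m] eq[of w b m] m WC by blast
    qed
    then have "\<P> - {C} = \<P>" using prime[of "\<P> - {C}" E F] EF by blast
    then show False using C by blast
  qed
  moreover have "2 \<le> card \<V>"
  proof -
    obtain z where z: "z \<in> W" "z \<notin> M" using MW by blast
    then obtain N where "N \<in> \<V>" "z \<in> N" using UV by blast
    then have "N \<noteq> M" "N \<in> \<V>" using z by auto
    then have "card {N, M} \<le> card \<V>" using V(2) M by (intro card_mono) auto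
    then show ?thesis using \<open>N \<noteq> M\<close> by simp
  qed
  ultimately show ?thesis by simp
qed

lemma induced_adj: "u \<in> M \<Longrightarrow> v \<in> M \<Longrightarrow> u \<rightarrow>\<^bsub>G \<restriction> M\<^esub> v \<longleftrightarrow> u \<rightarrow>\<^bsub>G\<^esub> v"
  by (auto simp: arcs_ends_def arc_to_ends_def)

text \<open>Descend in the decomposition as long as \<open>W\<close> lies inside a single module. At
  the node where it no longer does, the traces of the modules on \<open>W\<close> are proper. At a
  leaf of at most \<open>k\<close> vertices the singletons serve; they are proper because
  \<open>W\<close> has two elements.\<close>

lemma mw_le_modules:
  assumes "mw_le k G" "W \<subseteq> verts G" "2 \<le> card W"
  shows "\<exists>\<V>. partition_on W \<V> \<and> finite \<V> \<and> card \<V> \<le> k \<and>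
    (\<forall>M\<in>\<V>. module_on (dominates G) W M \<and> M \<noteq> W)"
  using assms
proof (induction arbitrary: W rule: mw_le.induct)
  case (small G)
  have fin: "finite W" using small finite_subset by blast
  show ?case
  proof (intro exI conjI ballI)
    show "partition_on W ((\<lambda>x. {x}) ` W)" by (auto simp: partition_on_def disjoint_def)
    show "finite ((\<lambda>x. {x}) ` W)" using fin by simp
    have "card ((\<lambda>x. {x}) ` W) = card W" by (rule card_image) simp
    also have "\<dots> \<le> k" using small card_mono le_trans by blast
    finally show "card ((\<lambda>x. {x}) ` W) \<le> k" .
    show "module_on (dominates G) W M" if "M \<in> (\<lambda>x. {x}) ` W" for M
      using that unfolding module_on_def by auto
    show "M \<noteq> W" if "M \<in> (\<lambda>x. {x}) ` W" for M
      using that small(4) by auto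
  qed
next
  case (split G \<V>)
  have U: "\<Union>\<V> = verts G" using split(1) by (auto simp: partition_on_def)
  show ?case
  proof (cases "\<exists>M\<in>\<V>. W \<subseteq> M")
    case True
    then obtain M where M: "M \<in> \<V>" "W \<subseteq> M" by blast
    have eq: "module_on (dominates (G \<restriction> M)) W N \<longleftrightarrow> module_on (dominates G) W N" for N
      unfolding module_on_def
    proof (intro conj_cong refl ball_cong)
      fix x y z assume "N \<subseteq> W" "x \<in> W - N" "y \<in> N" "z \<in> N"
      then have "x \<in> M" "y \<in> M" "z \<in> M" using M by auto
      then show "(x \<rightarrow>\<^bsub>G \<restriction> M\<^esub> y \<longrightarrow> x \<rightarrow>\<^bsub>G \<restriction> M\<^esub> z) = (x \<rightarrow>\<^bsub>G\<^esub> y \<longrightarrow> x \<rightarrow>\<^bsub>G\<^esub> z)"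
        by (simp only: induced_adj)
    qed
    have "\<exists>\<V>. partition_on W \<V> \<and> finite \<V> \<and> card \<V> \<le> k \<and>
        (\<forall>N\<in>\<V>. module_on (dominates (G \<restriction> M)) W N \<and> N \<noteq> W)"
      using split.IH[OF M(1)] M(2) split.prems(2) by simp
    then show ?thesis by (simp only: eq)
  next
    case False
    define \<N> where "\<N> = (\<lambda>M. W \<inter> M) ` \<V> - {{}}"
    show ?thesis
    proof (intro exI conjI ballI)
      show "partition_on W \<N>"
        unfolding partition_on_def
      proof (intro conjI)
        have "x \<in> \<Union>\<N>" if x: "x \<in> W" for x
        proof -
          obtain M where "M \<in> \<V>" "x \<in> M" using U split.prems(1) x by blast
          then have "W \<inter> M \<in> \<N>" "x \<in> W \<inter> M" unfolding \<N>_def using x by auto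
          then show ?thesis by blast
        qed
        then show "\<Union>\<N> = W" unfolding \<N>_def by auto
        show "{} \<notin> \<N>" unfolding \<N>_def by simp
        have disj: "M \<inter> M' = {}" if "M \<in> \<V>" "M' \<in> \<V>" "M \<noteq> M'" for M M'
          using that split(1) by (auto simp: partition_on_def disjoint_def)
        show "disjoint \<N>"
          unfolding disjoint_def
        proof (intro ballI impI)
          fix A B assume "A \<in> \<N>" "B \<in> \<N>" "A \<noteq> B"
          then obtain M M' where "M \<in> \<V>" "M' \<in> \<V>" "A = W \<inter> M" "B = W \<inter> M'" "M \<noteq> M'"
            unfolding \<N>_def by blast
          then show "A \<inter> B = {}" using disj[of M M'] by blast
        qed
      qed
      show fin: "finite \<N>" unfolding \<N>_def using split(2) by blast
      have "card \<N> \<le> card ((\<lambda>M. W \<inter> M) ` \<V>)"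
        unfolding \<N>_def by (rule card_mono) (use split(2) in auto)
      also have "\<dots> \<le> card \<V>" by (rule card_image_le[OF split(2)])
      finally show "card \<N> \<le> k" using split(3) by simp
      fix N assume "N \<in> \<N>"
      then obtain M where M: "M \<in> \<V>" "N = W \<inter> M" unfolding \<N>_def by blast
      then show "N \<noteq> W" using False by blast
      show "module_on (dominates G) W N"
        unfolding module_on_def
      proof (intro conjI ballI impI)
        fix x y z assume "x \<in> W - N" "y \<in> N" "z \<in> N" "x \<rightarrow>\<^bsub>G\<^esub> y"
        then show "x \<rightarrow>\<^bsub>G\<^esub> z"
          using split(4)[OF M(1)] split.prems(1) M(2) unfolding graph_module_def by blast
      qed (use M in blast)
    qed
  qed
qed

section \<open>The algorithm\<close>

lemma ptime_nth_default [ptime_intros]: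
  assumes "ptime xs" "ptime i"
  shows "ptime (\<lambda>x. nth_default d (xs x) (i x))"
proof -
  have "nth_default d xs i = foldr (\<lambda>a _. a) ((tl ^^ i) xs) d" for xs :: "'b list" and i
  proof -
    have "(tl ^^ i) xs = drop i xs"
      by (induction i arbitrary: xs) (simp_all add: drop_Suc tl_drop)
    then show ?thesis
      by (cases "drop i xs") (auto simp: nth_default_def hd_drop_conv_nth[symmetric])
  qed
  moreover have "ptime (\<lambda>x. foldr (\<lambda>a _. a) ((tl ^^ i x) (xs x)) d)"
    by (intro ptime_foldr[where q = "[:0, 1:]"] ptime_funpow[where q = 0] ptime_intros assms)
      (simp_all add: esize_tl)
  ultimately show ?thesis by simp
qed

section \<open>Module closures and greedy merging of parts\<close>

definition madj :: "bool list list \<Rightarrow> nat \<Rightarrow> nat \<Rightarrow> bool" where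
  "madj m u v = nth_default False (nth_default [] m u) v"

lemma ptime_madj [ptime_intros]:
  "ptime m \<Longrightarrow> ptime u \<Longrightarrow> ptime v \<Longrightarrow> ptime (\<lambda>x. madj (m x) (u x) (v x))"
  unfolding madj_def by (intro ptime_intros)

definition memb :: "nat \<Rightarrow> nat list \<Rightarrow> bool" where
  "memb x xs \<longleftrightarrow> list_ex (\<lambda>y. y = x) xs"

lemma memb_iff [simp]: "memb x xs \<longleftrightarrow> x \<in> set xs"
  by (auto simp: memb_def list_ex_iff)

lemma ptime_memb [ptime_intros]: "ptime x \<Longrightarrow> ptime xs \<Longrightarrow> ptime (\<lambda>y. memb (x y) (xs y))"
  unfolding memb_def by (intro ptime_intros) (erule ptime_comp, intro ptime_intros)

text \<open>Adds the splitters of \<open>M\<close>, the vertices adjacent to some but not all of it.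
  A module containing \<open>M\<close> must contain the splitters outside \<open>M\<close>, so
  iterating yields the least module. Filtering \<open>W\<close>, instead of extending
  \<open>M\<close>, bounds the size of the result by that of \<open>W\<close>.\<close>

definition closure_step :: "bool list list \<Rightarrow> nat list \<Rightarrow> nat list \<Rightarrow> nat list" where
  "closure_step m W M = filter (\<lambda>x. memb x M \<or>
     (list_ex (\<lambda>y. madj m x y) M \<and> \<not> list_all (\<lambda>y. madj m x y) M)) W"

lemma ptime_closure_step [ptime_intros]:
  "ptime m \<Longrightarrow> ptime W \<Longrightarrow> ptime M \<Longrightarrow> ptime (\<lambda>x. closure_step (m x) (W x) (M x))"
  by (rule ptime_apply3[where f = closure_step]) (unfold closure_step_def, intro ptime_intros)

text \<open>Every round before the fixpoint adds an element of \<open>W\<close>, so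
  \<open>length W\<close> rounds suffice.\<close>

definition closure :: "bool list list \<Rightarrow> nat list \<Rightarrow> nat list \<Rightarrow> nat list" where
  "closure m W M = (closure_step m W ^^ length W) M"

lemma ptime_closure [ptime_intros]:
  "ptime m \<Longrightarrow> ptime W \<Longrightarrow> ptime M \<Longrightarrow> ptime (\<lambda>x. closure (m x) (W x) (M x))"
proof (rule ptime_apply3[where f = closure])
  have "ptime (\<lambda>p. ((\<lambda>s. closure_step (fst p) (fst (snd p)) s) ^^ length (fst (snd p))) (snd (snd p)))"
  proof (rule ptime_funpow[where q = "[:0, 1:]"])
    fix p :: "bool list list \<times> nat list \<times> nat list" and s
    have "esize (closure_step (fst p) (fst (snd p)) s) \<le> esize (fst (snd p))"
      unfolding closure_step_def by (rule esize_filter)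
    also have "\<dots> \<le> esize p" using esize_fst esize_snd le_trans by blast
    finally show "esize (closure_step (fst p) (fst (snd p)) s) \<le> esize s + poly [:0, 1:] (esize p)"
      by simp
  qed (intro ptime_intros)+
  then show "ptime (\<lambda>p. closure (fst p) (fst (snd p)) (snd (snd p)))"
    by (simp add: closure_def)
qed

text \<open>
  The representative is the first element; the value \<open>0\<close> for the empty part is never used.
\<close>

definition rep :: "nat list \<Rightarrow> nat" where
  "rep D = foldr (\<lambda>a _. a) D 0"

lemma rep_hd: "D \<noteq> [] \<Longrightarrow> rep D = hd D"
  by (cases D) (simp_all add: rep_def)

lemma ptime_rep [ptime_intros]: "ptime D \<Longrightarrow> ptime (\<lambda>x. rep (D x))"
  unfolding rep_def by (intro ptime_foldr[where q = "[:0, 1:]"] ptime_intros) simp_all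

text \<open>Applied to representatives only: a module of the quotient corresponds to a union of
  parts that is a module.\<close>

definition proper_closures :: "bool list list \<Rightarrow> nat list \<Rightarrow> nat list list" where
  "proper_closures m R = filter (\<lambda>C. \<not> list_all (\<lambda>x. memb x C) R)
     (concat (map (\<lambda>a. map (\<lambda>b. closure m R [a, b]) (filter (\<lambda>b. b \<noteq> a) R)) R))"

lemma ptime_proper_closures [ptime_intros]:
  "ptime m \<Longrightarrow> ptime R \<Longrightarrow> ptime (\<lambda>x. proper_closures (m x) (R x))"
  by (rule ptime_apply2[where f = proper_closures]) (unfold proper_closures_def, intro ptime_intros)

definition merge_by :: "nat list \<Rightarrow> nat list list \<Rightarrow> nat list list" where
  "merge_by C P = concat (filter (\<lambda>D. memb (rep D) C) P) # filter (\<lambda>D. \<not> memb (rep D) C) P"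

text \<open>The fold ignores its accumulator, so it is a case distinction: merge by the first proper
  closure, or keep \<open>P\<close> if there is none.\<close>

definition merge :: "bool list list \<Rightarrow> nat list list \<Rightarrow> nat list list" where
  "merge m P = foldr (\<lambda>C _. merge_by C P) (proper_closures m (map rep P)) P"

lemma merge_eq:
  "merge m P = (case proper_closures m (map rep P) of [] \<Rightarrow> P | C # _ \<Rightarrow> merge_by C P)"
  by (simp add: merge_def split: list.split)

lemma ptime_merge_by [ptime_intros]: "ptime C \<Longrightarrow> ptime P \<Longrightarrow> ptime (\<lambda>x. merge_by (C x) (P x))"
  by (rule ptime_apply2[where f = merge_by]) (unfold merge_by_def, intro ptime_intros)

lemma esize_concat: "esize (concat xss) \<le> esize xss"
  by (induction xss) auto

text \<open>Merging only regroups the entries; the 1 is the new outer cell. Growth by a constant per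
  round is what \<open>ptime_funpow\<close> asks for.\<close>

lemma esize_merge_by: "esize (merge_by C P) \<le> esize P + 1"
proof -
  have "esize (filter f P) + esize (filter (\<lambda>D. \<not> f D) P) = esize P" for f
    by (induction P) auto
  then show ?thesis
    unfolding merge_by_def esize_simps
    using esize_concat[of "filter (\<lambda>D. memb (rep D) C) P"] by (metis add_le_mono1)
qed

lemma esize_merge: "esize (merge m P) \<le> esize P + 1"
  by (auto simp: merge_eq esize_merge_by simp del: One_nat_def split: list.split)

lemma ptime_merge [ptime_intros]: "ptime m \<Longrightarrow> ptime P \<Longrightarrow> ptime (\<lambda>x. merge (m x) (P x))"
proof (rule ptime_apply2[where f = merge])
  show "ptime (\<lambda>p. merge (fst p) (snd p))"
    unfolding merge_def
  proof (rule ptime_foldr[where q = "[:1, 1:]" and g = "\<lambda>p C _. merge_by C (snd p)"])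
    fix p :: "bool list list \<times> nat list list" and C :: "nat list" and s :: "nat list list"
    show "esize (merge_by C (snd p)) \<le> esize s + poly [:1, 1:] (esize p + esize C)"
      using esize_merge_by[of C "snd p"] esize_snd[of p] by simp
  qed (intro ptime_intros)+
qed

definition parts :: "bool list list \<Rightarrow> nat list \<Rightarrow> nat list list" where
  "parts m W = (merge m ^^ length W) (map (\<lambda>x. [x]) W)"

lemma ptime_parts [ptime_intros]: "ptime m \<Longrightarrow> ptime W \<Longrightarrow> ptime (\<lambda>x. parts (m x) (W x))"
proof (rule ptime_apply2[where f = parts])
  have "ptime (\<lambda>p. ((\<lambda>s. merge (fst p) s) ^^ length (snd p)) (map (\<lambda>x. [x]) (snd p)))"
    by (rule ptime_funpow[where q = 1]) (use esize_merge in \<open>simp_all add: ptime_intros\<close>)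
  then show "ptime (\<lambda>p. parts (fst p) (snd p))" by (simp add: parts_def)
qed

section \<open>States of the quotient and the trie that stores them\<close>

definition occupied :: "nat list list \<Rightarrow> nat list \<Rightarrow> nat list" where
  "occupied P X = map rep (filter (\<lambda>D. list_ex (\<lambda>x. memb x X) D) P)"

definition at_most_one :: "nat list \<Rightarrow> nat list \<Rightarrow> bool" where
  "at_most_one D X \<longleftrightarrow> tl (filter (\<lambda>x. memb x X) D) = []"

definition light :: "nat list list \<Rightarrow> nat list \<Rightarrow> nat list" where
  "light P X = map rep (filter (\<lambda>D. at_most_one D X) P)"

lemma ptime_occupied [ptime_intros]: "ptime P \<Longrightarrow> ptime X \<Longrightarrow> ptime (\<lambda>x. occupied (P x) (X x))"
  by (rule ptime_apply2[where f = occupied]) (unfold occupied_def, intro ptime_intros)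

lemma ptime_at_most_one [ptime_intros]: "ptime P \<Longrightarrow> ptime X \<Longrightarrow> ptime (\<lambda>x. at_most_one (P x) (X x))"
  by (rule ptime_apply2[where f = at_most_one]) (unfold at_most_one_def, intro ptime_intros)

lemma ptime_light [ptime_intros]: "ptime P \<Longrightarrow> ptime X \<Longrightarrow> ptime (\<lambda>x. light (P x) (X x))"
  by (rule ptime_apply2[where f = light]) (unfold light_def, intro ptime_intros)

text \<open>
  In \<open>succs m R L q\<close>, the light parts \<open>L\<close> are those whose token may leave.
\<close>

definition succs :: "bool list list \<Rightarrow> nat list \<Rightarrow> nat list \<Rightarrow> nat list \<Rightarrow> nat list list" where
  "succs m R L q = concat (map (\<lambda>a. map (\<lambda>b. filter (\<lambda>r. r = b \<or> (memb r q \<and> r \<noteq> a)) R)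
     (filter (\<lambda>b. \<not> memb b q \<and> madj m a b \<and> list_all (\<lambda>c. c = a \<or> \<not> madj m b c) q) R))
     (filter (\<lambda>a. memb a L) q))"

lemma ptime_succs:
  "ptime (\<lambda>p. succs (fst p) (fst (snd p)) (fst (snd (snd p))) (snd (snd (snd p))))"
  unfolding succs_def by (intro ptime_intros)

text \<open>Canonical form of a state: independent of the order of the list \<open>q\<close>, and of
  the same length for all states, as the trie requires.\<close>

definition key :: "nat list \<Rightarrow> nat list \<Rightarrow> bool list" where
  "key R q = map (\<lambda>r. memb r q) R"

lemma ptime_key [ptime_intros]: "ptime R \<Longrightarrow> ptime q \<Longrightarrow> ptime (\<lambda>x. key (R x) (q x))"
  by (rule ptime_apply2[where f = key]) (unfold key_def, intro ptime_intros)

text \<open>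
  The leaves at depth \<open>length bs\<close> mark the stored keys; missing branches read as \<open>Leaf\<close>, since
  \<open>left Leaf = right Leaf = Leaf\<close>.
\<close>

fun trie_mem :: "bool list \<Rightarrow> tree \<Rightarrow> bool" where
  "trie_mem [] t = (t \<noteq> Leaf)"
| "trie_mem (b # bs) t = trie_mem bs (if b then left t else right t)"

fun trie_ins :: "bool list \<Rightarrow> tree \<Rightarrow> tree" where
  "trie_ins [] t = Node Leaf Leaf"
| "trie_ins (b # bs) t =
     (if b then Node (trie_ins bs (left t)) (right t) else Node (left t) (trie_ins bs (right t)))"

lemma trie_mem_ins: "length cs = length bs \<Longrightarrow> trie_mem cs (trie_ins bs t) \<longleftrightarrow> cs = bs \<or> trie_mem cs t"
  by (induction cs bs arbitrary: t rule: list_induct2) auto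

lemma trie_mem_Leaf: "\<not> trie_mem bs Leaf"
  by (induction bs) auto

text \<open>The measure is the recursion depth \<open>N\<close>, with constant cost per level. This
  is why access to the trie and pushing on the stack do not pay for the exponential size of these
  structures.\<close>

lemma ptimed_linrec:
  fixes F :: "'a::treeable \<Rightarrow> 'b::treeable" and N :: "'a \<Rightarrow> nat"
  assumes "ptimed (\<lambda>_. True) (\<lambda>_. 0) c" "ptimed c (\<lambda>_. 0) h"
    "ptimed (\<lambda>p. c (fst p)) (\<lambda>_. 0) g" "ptimed (\<lambda>x. \<not> c x) (\<lambda>_. 0) b"
    and dec: "\<And>x. c x \<Longrightarrow> N (h x) < N x"
    and F: "\<And>x. F x = (if c x then g (x, F (h x)) else b x)"
  shows "ptimed (\<lambda>_. True) N F"
proof -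
  from assms(1-4)[THEN ptimed_constD] obtain Kc Kh Kg Kb where
    K: "timed (\<lambda>_. True) c (\<lambda>_. Kc)" "timed c h (\<lambda>_. Kh)"
    "timed (\<lambda>p. c (fst p)) g (\<lambda>_. Kg)" "timed (\<lambda>x. \<not> c x) b (\<lambda>_. Kb)"
    by blast
  define K where "K = Kc + Kh + Kg + Kb + 9"
  have "timed (\<lambda>_. True) F (\<lambda>x. (N x + 1) * K)"
  proof (rule timed_rec[where N = N])
    show "timed (\<lambda>p. True \<and> c (fst p) \<and> snd p = F (h (fst p))) g (\<lambda>_. Kg)"
      by (rule timed_mono[OF K(3)]) auto
    show "F x = (if c x then g (x, F (h x)) else b x)" for x by (rule F)
  next
    fix x assume "c x"
    from dec[OF this] have "(N (h x) + 1) * K \<le> N x * K" by (intro mult_le_mono1) simp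
    then show "Kc + Kh + Kg + (N (h x) + 1) * K + 9 \<le> (N x + 1) * K"
      by (simp add: K_def)
  next
    fix x
    have "Kc + Kb + 9 \<le> K" by (simp add: K_def)
    also have "\<dots> \<le> (N x + 1) * K" by simp
    finally show "Kc + Kb + 9 \<le> (N x + 1) * K" .
  qed (use K dec in simp_all)
  then show ?thesis
    unfolding ptimed_def
    by (intro exI conjI, assumption)
      (intro poly_bounded_mult poly_bounded_add poly_bounded_self poly_bounded_const)
qed

lemma ptimed_trie_mem: "ptimed (\<lambda>_. True) (\<lambda>p. length (fst p)) (\<lambda>p. trie_mem (fst p) (snd p))"
proof (rule ptimed_linrec[where c = "\<lambda>p. fst p \<noteq> []" and g = snd and b = "\<lambda>p. snd p \<noteq> Leaf"
      and h = "\<lambda>p. (tl (fst p), if hd (fst p) then left (snd p) else right (snd p))"])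
  fix p :: "bool list \<times> tree"
  show "trie_mem (fst p) (snd p) = (if fst p \<noteq> [] then snd (p, trie_mem
      (fst (tl (fst p), if hd (fst p) then left (snd p) else right (snd p)))
      (snd (tl (fst p), if hd (fst p) then left (snd p) else right (snd p)))) else snd p \<noteq> Leaf)"
    by (cases "fst p") auto
  show "length (fst (tl (fst p), if hd (fst p) then left (snd p) else right (snd p))) < length (fst p)" if "fst p \<noteq> []"
    using that by simp
qed ((intro ptimed_unary ptimed_hd ptimed_Pair ptimed_If ptimed_id; auto)+)

lemma ptimed_trie_ins: "ptimed (\<lambda>_. True) (\<lambda>p. length (fst p)) (\<lambda>p. trie_ins (fst p) (snd p))"
proof (rule ptimed_linrec[where c = "\<lambda>p. fst p \<noteq> []"
      and g = "\<lambda>r. if hd (fst (fst r)) then Node (snd r) (right (snd (fst r))) else Node (left (snd (fst r))) (snd r)"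
      and b = "\<lambda>_. Node Leaf Leaf"
      and h = "\<lambda>p. (tl (fst p), if hd (fst p) then left (snd p) else right (snd p))"])
  fix p :: "bool list \<times> tree"
  let ?h = "(tl (fst p), if hd (fst p) then left (snd p) else right (snd p))"
  let ?r = "(p, trie_ins (fst ?h) (snd ?h))"
  show "trie_ins (fst p) (snd p) = (if fst p \<noteq> [] then
      if hd (fst (fst ?r)) then Node (snd ?r) (right (snd (fst ?r))) else Node (left (snd (fst ?r))) (snd ?r)
      else Node Leaf Leaf)"
    by (cases "fst p") auto
  show "length (fst (tl (fst p), if hd (fst p) then left (snd p) else right (snd p))) < length (fst p)" if "fst p \<noteq> []"
    using that by simp
qed ((intro ptimed_unary ptimed_intros2 ptimed_const ptimed_hd ptimed_Pair ptimed_If ptimed_id; auto)+)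

text \<open>The second list is shared, not copied, so pushing successors on a long stack costs only
  their number.\<close>

lemma ptimed_append: "ptimed (\<lambda>_. True) (\<lambda>p. length (fst p)) (\<lambda>p. fst p @ snd p)"
proof (rule ptimed_linrec[where c = "\<lambda>p. fst p \<noteq> []" and g = "\<lambda>r. hd (fst (fst r)) # snd r"
      and b = snd and h = "\<lambda>p. (tl (fst p), snd p)"])
  fix p :: "'a list \<times> 'a list"
  show "fst p @ snd p = (if fst p \<noteq> [] then
      hd (fst (fst (p, fst (tl (fst p), snd p) @ snd (tl (fst p), snd p)))) # snd (p, fst (tl (fst p), snd p) @ snd (tl (fst p), snd p)) else snd p)"
    by (cases "fst p") auto
  show "length (fst (tl (fst p), snd p)) < length (fst p)" if "fst p \<noteq> []"
    using that by simp
qed ((intro ptimed_unary ptimed_intros2 ptimed_hd ptimed_Pair ptimed_id; auto)+)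

text \<open>A loop is the recursion whose combining function is \<open>snd\<close>. The factor
  \<open>f\<close> keeps an exponential cost per round apart from the polynomial part; it is 1 for
  the search and a power of 2 for the outer loop.\<close>

lemma timed_while:
  fixes N :: "'a::treeable \<Rightarrow> nat"
  assumes c: "ptimed D \<mu> c" and s: "timed (\<lambda>x. D x \<and> c x) s (\<lambda>x. f x * poly p (\<mu> x))"
    and closed: "\<And>x. D x \<Longrightarrow> c x \<Longrightarrow> D (s x)" "\<And>x. D x \<Longrightarrow> c x \<Longrightarrow> \<mu> (s x) \<le> \<mu> x"
    and f: "\<And>x. D x \<Longrightarrow> c x \<Longrightarrow> f (s x) \<le> f x" "\<And>x. D x \<Longrightarrow> 1 \<le> f x"
    and dec: "\<And>x. D x \<Longrightarrow> c x \<Longrightarrow> N (s x) < N x"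
  shows "\<exists>p. timed D (while c s) (\<lambda>x. (N x + 1) * (f x * poly p (\<mu> x)))"
proof -
  obtain Tc pc where c: "timed D c Tc" "\<And>x. D x \<Longrightarrow> Tc x \<le> poly pc (\<mu> x)"
    using c unfolding ptimed_def poly_bounded_def by blast
  obtain Ks Ki :: nat where K: "timed (\<lambda>_. True) (snd :: 'a \<times> 'a \<Rightarrow> 'a) (\<lambda>_. Ks)" "timed (\<lambda>_. True) (\<lambda>x :: 'a. x) (\<lambda>_. Ki)"
    using ptimed_constD[OF snd_prim] ptimed_constD[OF ptimed_id] by metis
  let ?p = "pc + p + [:Ks + Ki + 9:]"
  have "timed D (while c s) (\<lambda>x. (N x + 1) * (f x * poly ?p (\<mu> x)))"
  proof (rule timed_rec[where g = snd and b = "\<lambda>x. x" and N = N])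
    show "while c s x = (if c x then snd (x, while c s (s x)) else x)" for x
      by (simp add: while_unfold)
    show "timed (\<lambda>p. D (fst p) \<and> c (fst p) \<and> snd p = while c s (s (fst p))) snd (\<lambda>_. Ks)"
      by (rule timed_mono[OF K(1)]) auto
    show "timed (\<lambda>x. D x \<and> \<not> c x) (\<lambda>x. x) (\<lambda>_. Ki)"
      by (rule timed_mono[OF K(2)]) auto
  next
    fix x assume D: "D x"
    have le: "poly pc (\<mu> x) + f x * poly p (\<mu> x) + Ks + Ki + 9 \<le> f x * poly ?p (\<mu> x)"
      using mult_le_mono1[OF f(2)[OF D], of "poly pc (\<mu> x) + Ks + Ki + 9"] by (simp add: algebra_simps)
    show "Tc x + Ki + 9 \<le> (N x + 1) * (f x * poly ?p (\<mu> x))"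
    proof -
      have "Tc x + Ki + 9 \<le> f x * poly ?p (\<mu> x)" using le c(2)[OF D] by linarith
      then show ?thesis by (simp add: trans_le_add1)
    qed
    assume cx: "c x"
    have "(N (s x) + 1) * (f (s x) * poly ?p (\<mu> (s x))) \<le> N x * (f x * poly ?p (\<mu> x))"
      using dec[OF D cx] by (intro mult_le_mono poly_nat_mono closed(2) f(1) D cx) simp
    moreover have "(N x + 1) * (f x * poly ?p (\<mu> x)) = N x * (f x * poly ?p (\<mu> x)) + f x * poly ?p (\<mu> x)"
      by simp
    ultimately show "Tc x + f x * poly p (\<mu> x) + Ks + (N (s x) + 1) * (f (s x) * poly ?p (\<mu> (s x))) + 9
        \<le> (N x + 1) * (f x * poly ?p (\<mu> x))"
      using le c(2)[OF D] by linarith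
  qed (use c s closed dec in simp_all)
  then show ?thesis ..
qed

lemma ptimedD: "ptimed D \<mu> f \<Longrightarrow> \<exists>p. timed D f (\<lambda>x. poly p (\<mu> x))"
proof -
  assume "ptimed D \<mu> f"
  then obtain T p where "timed D f T" "\<And>x. D x \<Longrightarrow> T x \<le> poly p (\<mu> x)"
    unfolding ptimed_def poly_bounded_def by blast
  note T = this
  have "timed D f (\<lambda>x. poly p (\<mu> x))" by (rule timed_mono[OF T(1)]) (use T(2) in auto)
  then show ?thesis ..
qed

section \<open>Searching the states\<close>

text \<open>
  A search state holds the quotient (matrix, representatives, light parts), the stack, the visited
  states and the intersection of the visited states.
\<close>

type_synonym search_state =
  "(bool list list \<times> nat list \<times> nat list) \<times> nat list list \<times> tree \<times> nat list"

text \<open>States are marked when popped, not when pushed, so the stack may hold duplicates; these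
  are discarded by the first branch.\<close>

definition search_step :: "search_state \<Rightarrow> search_state" where
  "search_step x = (let c = fst x; R = fst (snd c); st = fst (snd x); vis = fst (snd (snd x));
       F = snd (snd (snd x)); q = hd st; k = key R q
     in if trie_mem k vis then (c, (tl st, (vis, F)))
        else (c, (succs (fst c) R (snd (snd c)) q @ tl st,
               (trie_ins k vis, filter (\<lambda>r. memb r q) F))))"

definition search :: "search_state \<Rightarrow> search_state" where
  "search = while (\<lambda>x. fst (snd x) \<noteq> []) search_step"

text \<open>Stacked states and the intersection arise by selecting entries of \<open>R\<close>, so
  each is no larger than \<open>R\<close>, however long the stack and however large the
  trie.\<close>

definition search_dom :: "search_state \<Rightarrow> bool" where
  "search_dom x \<longleftrightarrow> (\<forall>q\<in>set (fst (snd x)). esize q \<le> esize (fst (snd (fst x))) \<and>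
       length q \<le> length (fst (snd (fst x)))) \<and>
     esize (snd (snd (snd x))) \<le> esize (fst (snd (fst x)))"

text \<open>
  A potential: each new key pays for its at most \<open>r * r\<close> successors on the stack.
\<close>

definition search_fuel :: "search_state \<Rightarrow> nat" where
  "search_fuel x = (let r = length (fst (snd (fst x))) in length (fst (snd x)) +
     (2 ^ r - card {k. length k = r \<and> trie_mem k (fst (snd (snd x)))}) * (r * r + 1))"

lemma length_succs: "length (succs m R L q) \<le> length q * length R"
proof -
  have "length (concat (map f xs)) \<le> length xs * b" if "\<And>a. length (f a) \<le> b"
    for f :: "nat \<Rightarrow> nat list list" and xs b
    using that by (induction xs) (auto simp: add_mono)
  then have "length (succs m R L q) \<le> length (filter (\<lambda>a. memb a L) q) * length R"
    unfolding succs_def by simp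
  also have "\<dots> \<le> length q * length R" by simp
  finally show ?thesis .
qed

lemma succs_filter: "q' \<in> set (succs m R L q) \<Longrightarrow> \<exists>f. q' = filter f R"
  unfolding succs_def by auto

lemma search_step_dom:
  assumes "search_dom x" "fst (snd x) \<noteq> []"
  shows "search_dom (search_step x)" "fst (search_step x) = fst x"
proof -
  obtain m R L st vis F where x: "x = ((m, R, L), (st, (vis, F)))" by (metis prod.collapse)
  have tl: "q \<in> set st" if "q \<in> set (tl st)" for q using that by (cases st) auto
  have "esize q' \<le> esize R \<and> length q' \<le> length R" if "q' \<in> set (succs m R L q)" for q q'
    using succs_filter[OF that] esize_filter by auto
  moreover have "esize (filter f F) \<le> esize R" for f
    using assms(1) esize_filter[of f F] le_trans unfolding search_dom_def x by auto
  ultimately show "search_dom (search_step x)"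
    using assms(1) tl unfolding search_dom_def search_step_def x by (auto simp: Let_def)
  show "fst (search_step x) = fst x" unfolding search_step_def Let_def by simp
qed

lemma finite_keys: "finite {k :: bool list. length k = r \<and> P k}"
  and card_keys: "card {k :: bool list. length k = r \<and> P k} \<le> 2 ^ r"
proof -
  have fin: "finite {k :: bool list. length k = r}"
    using finite_lists_length_eq[of "UNIV :: bool set" r] by simp
  then show "finite {k :: bool list. length k = r \<and> P k}" by (rule rev_finite_subset) auto
  have "card {k :: bool list. length k = r \<and> P k} \<le> card {k :: bool list. length k = r}"
    by (rule card_mono[OF fin]) auto
  also have "\<dots> = 2 ^ r"
    using card_lists_length_eq[of "UNIV :: bool set" r] by simp
  finally show "card {k :: bool list. length k = r \<and> P k} \<le> 2 ^ r" .
qed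

lemma search_fuel_step:
  assumes dom: "search_dom x" and ne: "fst (snd x) \<noteq> []"
  shows "search_fuel (search_step x) < search_fuel x"
proof -
  obtain m R L st vis F where x: "x = ((m, R, L), (st, (vis, F)))" by (metis prod.collapse)
  obtain q st' where st: "st = q # st'" using ne x by (cases st) auto
  define r where "r = length R"
  define K where "K t = {k. length k = r \<and> trie_mem k t}" for t
  define k where "k = key R q"
  have lk: "length k = r" by (simp add: k_def key_def r_def)
  show ?thesis
  proof (cases "trie_mem k vis")
    case True
    then show ?thesis by (simp add: search_fuel_def search_step_def x st k_def Let_def)
  next
    case False
    have Kins: "K (trie_ins k vis) = insert k (K vis)"
      using trie_mem_ins[of _ k vis] lk by (auto simp: K_def)
    have "card (K (trie_ins k vis)) = card (K vis) + 1"
      unfolding Kins using False finite_keys by (subst card_insert_disjoint) (auto simp: K_def)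
    moreover have "card (K (trie_ins k vis)) \<le> 2 ^ r" unfolding K_def by (rule card_keys)
    ultimately have d: "2 ^ r - card (K vis) = Suc (2 ^ r - card (K (trie_ins k vis)))" by simp
    have "length (succs m R L q) \<le> length q * length R" by (rule length_succs)
    also have "\<dots> \<le> r * r" using dom unfolding search_dom_def x st r_def by simp
    finally have succs: "length (succs m R L q) \<le> r * r" .
    have "search_fuel x = Suc (length st') + (2 ^ r - card (K vis)) * (r * r + 1)"
      by (simp add: search_fuel_def x st K_def r_def Let_def)
    moreover have "search_fuel (search_step x) = length (succs m R L q) + length st' +
        (2 ^ r - card (K (trie_ins k vis))) * (r * r + 1)"
      using False by (simp add: search_fuel_def search_step_def x st K_def r_def k_def Let_def)
    ultimately show ?thesis unfolding d using succs by simp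
  qed
qed

lemma ptimed_small:
  assumes "ptime f" "ptimed D \<mu> g" "\<And>x. D x \<Longrightarrow> esize (g x) \<le> poly q (\<mu> x)"
  shows "ptimed D \<mu> (\<lambda>x. f (g x))"
  by (rule ptimed_lift[OF assms(1,2)]) (use assms(3) in \<open>auto simp: poly_bounded_def\<close>)

text \<open>The measure is the size of the quotient alone. The top of the stack, its key, its
  successors and the intersection are polynomial in it; the trie is followed along one key, and the
  rest of the stack is passed on unread.\<close>

lemma ptimed_search_step:
  "ptimed (\<lambda>x. search_dom x \<and> fst (snd x) \<noteq> []) (\<lambda>x. esize (fst x)) search_step"
proof -
  let ?D = "\<lambda>x :: search_state. search_dom x \<and> fst (snd x) \<noteq> []" and ?\<mu> = "\<lambda>x :: search_state. esize (fst x)"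
  note intros = ptimed_unary ptimed_hd ptimed_Pair ptimed_id
  have hd_le: "esize (hd (fst (snd x))) \<le> esize (fst x)" "length (hd (fst (snd x))) \<le> length (fst (snd (fst x)))"
    and F_le: "esize (snd (snd (snd x))) \<le> esize (fst x)" if "?D x" for x
  proof -
    have "hd (fst (snd x)) \<in> set (fst (snd x))" using that by simp
    moreover have R: "esize (fst (snd (fst x))) \<le> esize (fst x)"
      using esize_fst[of "snd (fst x)"] esize_snd[of "fst x"] by simp
    ultimately show "esize (hd (fst (snd x))) \<le> esize (fst x)"
      "length (hd (fst (snd x))) \<le> length (fst (snd (fst x)))"
      using that unfolding search_dom_def by (auto intro: le_trans)
    show "esize (snd (snd (snd x))) \<le> esize (fst x)"
      using that R unfolding search_dom_def by simp
  qed
  have cq: "ptimed ?D ?\<mu> (\<lambda>x. (fst x, hd (fst (snd x))))" by (intro intros) simp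
  have cq_le: "esize (fst x, hd (fst (snd x))) \<le> poly [:1, 2:] (?\<mu> x)" if "?D x" for x
    using hd_le[OF that] by simp
  have key: "ptimed ?D ?\<mu> (\<lambda>x. key (fst (snd (fst x))) (hd (fst (snd x))))"
    using ptimed_small[OF _ cq cq_le, of "\<lambda>p. key (fst (snd (fst p))) (snd p)"]
    by (simp add: ptime_intros)
  have succs: "ptimed ?D ?\<mu> (\<lambda>x. succs (fst (fst x)) (fst (snd (fst x))) (snd (snd (fst x))) (hd (fst (snd x))))"
    using ptimed_small[OF _ cq cq_le, of "\<lambda>p. succs (fst (fst p)) (fst (snd (fst p))) (snd (snd (fst p))) (snd p)"]
      ptime_apply4[OF ptime_succs, of "\<lambda>p. fst (fst p)" "\<lambda>p. fst (snd (fst p))" "\<lambda>p. snd (snd (fst p))" "\<lambda>p. snd p"]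
    by (simp add: ptime_intros)
  have filter: "ptimed ?D ?\<mu> (\<lambda>x. filter (\<lambda>r. memb r (hd (fst (snd x)))) (snd (snd (snd x))))"
  proof -
    have f: "ptime (\<lambda>p. filter (\<lambda>r. memb r (fst p)) (snd p))" by (intro ptime_intros)
    have g: "ptimed ?D ?\<mu> (\<lambda>x. (hd (fst (snd x)), snd (snd (snd x))))" by (intro intros) simp
    have "esize (hd (fst (snd x)), snd (snd (snd x))) \<le> poly [:1, 2:] (?\<mu> x)" if "?D x" for x
      using hd_le(1)[OF that] F_le[OF that] by simp
    from ptimed_small[OF f g this] show ?thesis by (simp only: fst_conv snd_conv simp_thms)
  qed
  have key_len: "poly_bounded ?D ?\<mu> (\<lambda>x. length (key (fst (snd (fst x))) (hd (fst (snd x)))))"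
  proof (rule poly_bounded_mono[where D = "\<lambda>_. True", OF poly_bounded_self])
    fix x :: search_state
    have "length (fst (snd (fst x))) \<le> esize (fst x)"
      using length_le_esize[of "fst (snd (fst x))"] esize_fst[of "snd (fst x)"] esize_snd[of "fst x"] by simp
    then show "length (key (fst (snd (fst x))) (hd (fst (snd x)))) \<le> ?\<mu> x" by (simp add: key_def)
  qed simp
  have mem: "ptimed ?D ?\<mu> (\<lambda>x. trie_mem (key (fst (snd (fst x))) (hd (fst (snd x)))) (fst (snd (snd x))))"
    using ptimed_comp[OF ptimed_Pair[OF key] ptimed_trie_mem, of "\<lambda>x. fst (snd (snd x))"] key_len
    by (simp add: intros)
  have ins: "ptimed ?D ?\<mu> (\<lambda>x. trie_ins (key (fst (snd (fst x))) (hd (fst (snd x)))) (fst (snd (snd x))))"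
    using ptimed_comp[OF ptimed_Pair[OF key] ptimed_trie_ins, of "\<lambda>x. fst (snd (snd x))"] key_len
    by (simp add: intros)
  have succs_len: "poly_bounded ?D ?\<mu> (\<lambda>x. length (succs (fst (fst x)) (fst (snd (fst x))) (snd (snd (fst x))) (hd (fst (snd x)))))"
  proof (rule poly_bounded_mono[where D = ?D, OF poly_bounded_mult[OF poly_bounded_self poly_bounded_self]])
    fix x :: search_state assume D: "?D x"
    have "length (fst (snd (fst x))) \<le> esize (fst x)"
      using length_le_esize[of "fst (snd (fst x))"] esize_fst[of "snd (fst x)"] esize_snd[of "fst x"] by simp
    then show "length (succs (fst (fst x)) (fst (snd (fst x))) (snd (snd (fst x))) (hd (fst (snd x)))) \<le> ?\<mu> x * ?\<mu> x"
      using hd_le(2)[OF D] by (intro le_trans[OF length_succs] mult_le_mono) auto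
  qed
  have app: "ptimed ?D ?\<mu> (\<lambda>x. succs (fst (fst x)) (fst (snd (fst x))) (snd (snd (fst x))) (hd (fst (snd x)))
      @ tl (fst (snd x)))"
    using ptimed_comp[OF ptimed_Pair[OF succs] ptimed_append, of "\<lambda>x. tl (fst (snd x))"] succs_len
    by (simp add: intros)
  show ?thesis
    unfolding search_step_def Let_def
    by (intro ptimed_If mem ptimed_Pair intros; (rule ptimed_mono[OF app] ptimed_mono[OF ins] ptimed_mono[OF filter])?)
      auto
qed

lemma timed_search:
  "\<exists>p. timed search_dom search (\<lambda>x. (search_fuel x + 1) * poly p (esize (fst x)))"
proof -
  obtain p where p: "timed (\<lambda>x. search_dom x \<and> fst (snd x) \<noteq> []) search_step (\<lambda>x. poly p (esize (fst x)))"
    using ptimedD[OF ptimed_search_step] by blast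
  have "\<exists>p. timed search_dom (while (\<lambda>x. fst (snd x) \<noteq> []) search_step)
      (\<lambda>x. (search_fuel x + 1) * (1 * poly p (esize (fst x))))"
    by (rule timed_while[where p = p])
      (use p search_step_dom search_fuel_step in
        \<open>simp_all add: ptimed_unary ptimed_id del: One_nat_def\<close>)
  then show ?thesis unfolding search_def by simp
qed

text \<open>As \<open>q\<close> is independent, the new state is independent iff \<open>b\<close>
  has no neighbour in \<open>q\<close> apart from \<open>a\<close>, which is what the program
  tests.\<close>

lemma succs_qstep:
  assumes mp: "modular_partition (madj m) W (set R) D"
    and q: "set q \<subseteq> set R" "indep (madj m) (set q)" and L: "set L = set R - H"
  shows "set ` set (succs m R L q) = {Q'. modular_partition.qstep (madj m) (set R) H (set q) Q'}"
    (is "?l = ?r")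
proof -
  interpret modular_partition "madj m" W "set R" D by (rule mp)
  have succs: "?l = {insert b (set q - {a}) | a b. a \<in> set q \<and> a \<in> set L \<and> b \<in> set R \<and> b \<notin> set q \<and>
      madj m a b \<and> (\<forall>c\<in>set q. c = a \<or> \<not> madj m b c)}" (is "_ = ?s")
  proof
    show "?l \<subseteq> ?s"
    proof
      fix Q assume "Q \<in> ?l"
      then obtain a b where ab: "a \<in> set q \<and> a \<in> set L \<and> b \<in> set R \<and> b \<notin> set q \<and>
          madj m a b \<and> (\<forall>c\<in>set q. c = a \<or> \<not> madj m b c)"
        "Q = set (filter (\<lambda>r. r = b \<or> (memb r q \<and> r \<noteq> a)) R)"
        unfolding succs_def by (auto simp: list_all_iff)
      moreover have "set (filter (\<lambda>r. r = b \<or> (memb r q \<and> r \<noteq> a)) R) = insert b (set q - {a})"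
        using q ab by auto
      ultimately show "Q \<in> ?s" by blast
    qed
    show "?s \<subseteq> ?l"
    proof
      fix Q assume "Q \<in> ?s"
      then obtain a b where ab: "a \<in> set q \<and> a \<in> set L \<and> b \<in> set R \<and> b \<notin> set q \<and>
          madj m a b \<and> (\<forall>c\<in>set q. c = a \<or> \<not> madj m b c)" "Q = insert b (set q - {a})"
        by blast
      then have "Q = set (filter (\<lambda>r. r = b \<or> (memb r q \<and> r \<noteq> a)) R)" using q by auto
      moreover have "filter (\<lambda>r. r = b \<or> (memb r q \<and> r \<noteq> a)) R \<in> set (succs m R L q)"
        unfolding succs_def using ab by (auto simp: list_all_iff)
      ultimately show "Q \<in> ?l" by blast
    qed
  qed
  have ind: "indep (madj m) (insert b (set q - {a})) \<longleftrightarrow> (\<forall>c\<in>set q. c = a \<or> \<not> madj m b c)" for a b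
    using q(2) sym irrefl unfolding indep_def by blast
  have "Q \<in> ?s \<longleftrightarrow> qstep H (set q) Q" for Q
  proof
    assume "Q \<in> ?s"
    then obtain a b where "a \<in> set q" "a \<in> set L" "b \<in> set R" "b \<notin> set q" "madj m a b"
        "\<forall>c\<in>set q. c = a \<or> \<not> madj m b c" "Q = insert b (set q - {a})"
      by blast
    then show "qstep H (set q) Q" unfolding qstep_def using ind[of b a] L by blast
  next
    assume "qstep H (set q) Q"
    then obtain a b where ab: "a \<in> set q" "a \<notin> H" "b \<in> set R" "b \<notin> set q" "madj m a b"
        "Q = insert b (set q - {a})" "indep (madj m) Q"
      unfolding qstep_def by blast
    moreover have "a \<in> set L" using ab q L by blast
    ultimately show "Q \<in> ?s" using ind[of b a] by blast
  qed
  then show ?thesis unfolding succs by blast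
qed

lemma key_eq_iff: "Q \<subseteq> set R \<Longrightarrow> set q \<subseteq> set R \<Longrightarrow> map (\<lambda>r. r \<in> Q) R = key R q \<longleftrightarrow> Q = set q"
  unfolding key_def by auto

text \<open>The invariant of graph search: visited and stacked states are reachable, the start is
  among them, and successors of visited states are visited or stacked. With an empty stack the
  visited states are closed under steps. \<open>F\<close> starts as \<open>R\<close>, the
  intersection of no states within \<open>R\<close>.\<close>

lemma search_correct:
  assumes mp: "modular_partition (madj m) W (set R) D" and S: "indep (madj m) S"
    and L: "set L = set R - modular_partition.heavy (set R) D S"
    and q0: "set q0 = modular_partition.occ (set R) D S" "length q0 \<le> length R" "esize q0 \<le> esize R"
    and res: "search ((m, R, L), ([q0], (Leaf, R))) = (c, (st, (vis, F)))"
  shows "set q \<subseteq> set R \<Longrightarrow> trie_mem (key R q) vis \<longleftrightarrow> set q \<in> modular_partition.states (madj m) (set R) D S"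
    and "set F = modular_partition.frozen (madj m) (set R) D S"
proof -
  interpret modular_partition "madj m" W "set R" D by (rule mp)
  define V where "V vis = {Q. Q \<subseteq> set R \<and> trie_mem (map (\<lambda>r. r \<in> Q) R) vis}" for vis
  define I where "I x \<longleftrightarrow> search_dom x \<and> (case x of (c, (st, (vis, F))) \<Rightarrow>
      c = (m, R, L) \<and> set ` set st \<subseteq> states S \<and> V vis \<subseteq> states S \<and> occ S \<in> V vis \<union> set ` set st \<and>
      (\<forall>Q\<in>V vis. \<forall>Q'. qstep (heavy S) Q Q' \<longrightarrow> Q' \<in> V vis \<union> set ` set st) \<and>
      set F = {r \<in> set R. \<forall>Q\<in>V vis. r \<in> Q})" for x
  have "I (while (\<lambda>x. fst (snd x) \<noteq> []) search_step ((m, R, L), ([q0], (Leaf, R)))) \<and>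
      \<not> fst (snd (while (\<lambda>x. fst (snd x) \<noteq> []) search_step ((m, R, L), ([q0], (Leaf, R))))) \<noteq> []"
  proof (rule while_rule[where P = I and Q = "\<lambda>x. I x \<and> \<not> fst (snd x) \<noteq> []" and r = "measure search_fuel"])
    show "I ((m, R, L), ([q0], (Leaf, R)))"
      using q0 states_start[of S] by (auto simp: I_def V_def trie_mem_Leaf search_dom_def)
  next
    fix x assume x: "I x" "fst (snd x) \<noteq> []"
    then have dom: "search_dom x" "fst (snd x) \<noteq> []" unfolding I_def by auto
    then show "(search_step x, x) \<in> measure search_fuel" using search_fuel_step by simp
    obtain q st vis F where xs: "x = ((m, R, L), (q # st, (vis, F)))"
    proof -
      obtain c st' vis F where xx: "x = (c, (st', (vis, F)))" by (metis prod.collapse)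
      then have "c = (m, R, L)" "st' \<noteq> []" using x by (auto simp: I_def)
      then show thesis using that xx by (cases st') auto
    qed
    from x have I: "set q \<in> states S" "set ` set st \<subseteq> states S" "V vis \<subseteq> states S"
        "occ S \<in> V vis \<union> set ` set (q # st)"
        "\<And>Q Q'. Q \<in> V vis \<Longrightarrow> qstep (heavy S) Q Q' \<Longrightarrow> Q' \<in> V vis \<union> set ` set (q # st)"
        "set F = {r \<in> set R. \<forall>Q\<in>V vis. r \<in> Q}"
      unfolding I_def xs by auto
    note q = states_invar[OF I(1) S]
    have dom': "search_dom (search_step x)" using search_step_dom dom by blast
    show "I (search_step x)"
    proof (cases "trie_mem (key R q) vis")
      case True
      then have step: "search_step x = ((m, R, L), (st, (vis, F)))"
        by (simp add: search_step_def xs Let_def)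
      have "set q \<in> V vis" using True q by (auto simp: V_def key_def)
      then have "insert (set q) (V vis) = V vis" by blast
      then have eq: "V vis \<union> set ` set (q # st) = V vis \<union> set ` set st" by auto
      show ?thesis using dom' I(2,3,6) I(4,5)[unfolded eq] unfolding step I_def by simp
    next
      case False
      let ?s = "succs m R L q"
      have step: "search_step x = ((m, R, L), (?s @ st, (trie_ins (key R q) vis, filter (\<lambda>r. memb r q) F)))"
        using False by (simp add: search_step_def xs Let_def)
      have V': "V (trie_ins (key R q) vis) = insert (set q) (V vis)"
      proof -
        have "trie_mem (map (\<lambda>r. r \<in> Q) R) (trie_ins (key R q) vis) \<longleftrightarrow>
            Q = set q \<or> trie_mem (map (\<lambda>r. r \<in> Q) R) vis" if "Q \<subseteq> set R" for Q
          using trie_mem_ins[of "map (\<lambda>r. r \<in> Q) R" "key R q" vis] key_eq_iff[of Q R q] that q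
          by (simp add: key_def)
        then show ?thesis using q unfolding V_def by blast
      qed
      have succs: "set ` set ?s = {Q'. qstep (heavy S) (set q) Q'}"
        using succs_qstep[OF mp _ _ L] q by blast
      have states: "Q' \<in> states S" if "Q' \<in> set ` set ?s" for Q'
        using that states_step[OF I(1)] unfolding succs by blast
      have "set ` set (?s @ st) \<subseteq> states S"
        using states I(2) by (auto simp del: set_map)
      moreover have "occ S \<in> insert (set q) (V vis) \<union> set ` set (?s @ st)"
        using I(4) by auto
      moreover have "Q' \<in> insert (set q) (V vis) \<union> set ` set (?s @ st)"
        if "Q \<in> insert (set q) (V vis)" "qstep (heavy S) Q Q'" for Q Q'
      proof (cases "Q = set q")
        case True
        then have "Q' \<in> set ` set ?s" using that succs by blast
        then show ?thesis by auto
      next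
        case False
        then show ?thesis using I(5)[of Q Q'] that by auto
      qed
      moreover have "set (filter (\<lambda>r. memb r q) F) = {r \<in> set R. \<forall>Q\<in>insert (set q) (V vis). r \<in> Q}"
        using I(6) by auto
      moreover have "insert (set q) (V vis) \<subseteq> states S" using I by blast
      ultimately show ?thesis using dom' unfolding step I_def by (simp add: V')
    qed
  qed (auto simp: wf_measure)
  then have "I (c, (st, (vis, F))) \<and> \<not> fst (snd (c, (st, (vis, F)))) \<noteq> []"
    unfolding res[unfolded search_def] .
  then have "I (c, (st, (vis, F)))" "st = []" by auto
  then have V: "V vis \<subseteq> states S" "occ S \<in> V vis"
      "\<And>Q Q'. Q \<in> V vis \<Longrightarrow> qstep (heavy S) Q Q' \<Longrightarrow> Q' \<in> V vis"
      "set F = {r \<in> set R. \<forall>Q\<in>V vis. r \<in> Q}"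
    unfolding I_def by auto
  have "Q \<in> V vis" if "Q \<in> states S" for Q
    using that by (induction rule: states_induct) (use V in blast)+
  then have V_states: "V vis = states S" using V by blast
  show "set F = frozen S" using V by (simp add: frozen_def V_states)
  show "trie_mem (key R q) vis \<longleftrightarrow> set q \<in> states S" if "set q \<subseteq> set R" for q
    using that unfolding V_states[symmetric] V_def key_def by simp
qed

section \<open>Computing a modular partition\<close>

definition modular_list :: "bool list list \<Rightarrow> nat set \<Rightarrow> nat list list \<Rightarrow> bool" where
  "modular_list m W P \<longleftrightarrow> [] \<notin> set P \<and> distinct (concat P) \<and> set (concat P) = W \<and>
     (\<forall>D\<in>set P. module_on (madj m) W (set D))"

definition part_of :: "nat list list \<Rightarrow> nat \<Rightarrow> nat set" where
  "part_of P r = {x. \<exists>D\<in>set P. rep D = r \<and> x \<in> set D}"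

lemma rep_in: "D \<noteq> [] \<Longrightarrow> rep D \<in> set D"
  by (simp add: rep_hd)

lemma modular_listD:
  assumes "modular_list m W P"
  shows "distinct P" "distinct (map rep P)" "D \<in> set P \<Longrightarrow> rep D \<in> set D"
    "D \<in> set P \<Longrightarrow> distinct D" "D \<in> set P \<Longrightarrow> set D \<subseteq> W"
    "D \<in> set P \<Longrightarrow> E \<in> set P \<Longrightarrow> x \<in> set D \<Longrightarrow> x \<in> set E \<Longrightarrow> D = E"
    "D \<in> set P \<Longrightarrow> part_of P (rep D) = set D"
proof -
  note m = assms[unfolded modular_list_def]
  have "removeAll [] P = P" using m by (simp add: removeAll_id)
  then have d: "distinct P" "\<And>D. D \<in> set P \<Longrightarrow> distinct D"
    "\<And>D E. D \<in> set P \<Longrightarrow> E \<in> set P \<Longrightarrow> D \<noteq> E \<Longrightarrow> set D \<inter> set E = {}"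
    using m unfolding distinct_concat_iff by auto
  show "distinct P" by fact
  show same: "D = E" if "D \<in> set P" "E \<in> set P" "x \<in> set D" "x \<in> set E" for D E x
    using d(3) that by blast
  have r: "rep D \<in> set D" if "D \<in> set P" for D using that m rep_in by metis
  have inj: "D = E" if "D \<in> set P" "E \<in> set P" "rep D = rep E" for D E
    using same[OF that(1,2), of "rep D"] r that by metis
  then show "distinct (map rep P)" using d(1) by (simp add: distinct_map inj_on_def)
  show "part_of P (rep D) = set D" if "D \<in> set P"
    unfolding part_of_def using inj that by blast
  show "rep D \<in> set D" "distinct D" "set D \<subseteq> W" if "D \<in> set P"
    using r d(2) m that by auto
qed

lemma modular_list_partition:
  assumes sym: "\<And>u v. madj m u v \<Longrightarrow> madj m v u" and irrefl: "\<And>u. \<not> madj m u u"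
    and P: "modular_list m W P"
  shows "modular_partition (madj m) W (set (map rep P)) (part_of P)"
proof
  note P' = modular_listD[OF P]
  fix r s assume r: "r \<in> set (map rep P)"
  then obtain D where D: "D \<in> set P" "r = rep D" by auto
  show "r \<in> part_of P r" "module_on (madj m) W (part_of P r)"
    using P' D P unfolding modular_list_def by auto
  assume "s \<in> set (map rep P)" "r \<noteq> s"
  then obtain E where E: "E \<in> set P" "s = rep E" by auto
  with D \<open>r \<noteq> s\<close> have "D \<noteq> E" by auto
  with P'(6)[OF D(1) E(1)] show "part_of P r \<inter> part_of P s = {}"
    using P'(7)[OF D(1)] P'(7)[OF E(1)] D E by auto
next
  have "(\<Union>r\<in>set (map rep P). part_of P r) = (\<Union>D\<in>set P. set D)"
    using modular_listD(7)[OF P] by auto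
  also have "\<dots> = W" using P unfolding modular_list_def by auto
  finally show "(\<Union>r\<in>set (map rep P). part_of P r) = W" .
qed (use sym irrefl in auto)

text \<open>As long as no fixpoint is reached, each application adds an element, so after
  \<open>n\<close> rounds there is a fixpoint or a set of at least \<open>n\<close> elements. In the
  latter case with \<open>n\<close> at least \<open>card W\<close> the set is all of
  \<open>W\<close>, which cannot grow.\<close>

lemma funpow_fixpoint:
  fixes f :: "'a set \<Rightarrow> 'a set"
  assumes f: "\<And>X. X \<subseteq> W \<Longrightarrow> X \<subseteq> f X \<and> f X \<subseteq> W" and fin: "finite W" and X: "X \<subseteq> W"
  shows "(f ^^ n) X \<subseteq> W" "X \<subseteq> (f ^^ n) X" "card W \<le> n \<Longrightarrow> f ((f ^^ n) X) = (f ^^ n) X"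
proof -
  have sub: "(f ^^ n) X \<subseteq> W" for n
    by (induction n) (use f X in auto)
  have fn: "(f ^^ n) X \<subseteq> f ((f ^^ n) X)" for n using f sub by blast
  show "(f ^^ n) X \<subseteq> W" by (rule sub)
  show "X \<subseteq> (f ^^ n) X" by (induction n) (use fn in auto)
  have grow: "n \<le> card ((f ^^ n) X) \<or> f ((f ^^ n) X) = (f ^^ n) X" for n
  proof (induction n)
    case (Suc n)
    show ?case
    proof (cases "f ((f ^^ n) X) = (f ^^ n) X")
      case False
      then have "(f ^^ n) X \<subset> (f ^^ Suc n) X" using fn[of n] by auto
      then have "card ((f ^^ n) X) < card ((f ^^ Suc n) X)"
        using finite_subset[OF sub fin] by (rule psubset_card_mono[rotated])
      then show ?thesis using Suc False by linarith
    qed simp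
  qed simp
  assume "card W \<le> n"
  then show "f ((f ^^ n) X) = (f ^^ n) X"
  proof (cases "f ((f ^^ n) X) = (f ^^ n) X")
    case False
    with grow[of n] \<open>card W \<le> n\<close> have "card W \<le> card ((f ^^ n) X)" by linarith
    with sub[of n] have "(f ^^ n) X = W" using fin by (metis card_seteq)
    then show ?thesis using fn[of n] f[of W] by auto
  qed
qed

lemma closure_correct:
  assumes M: "set M \<subseteq> set W"
  shows "set M \<subseteq> set (closure m W M)" "set (closure m W M) \<subseteq> set W"
    "module_on (madj m) (set W) (set (closure m W M))"
    "module_on (madj m) (set W) N \<Longrightarrow> set M \<subseteq> N \<Longrightarrow> set (closure m W M) \<subseteq> N"
proof -
  define f where "f X = {x \<in> set W. x \<in> X \<or> ((\<exists>y\<in>X. madj m x y) \<and> \<not> (\<forall>y\<in>X. madj m x y))}" for X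
  have step: "set (closure_step m W X) = f (set X)" for X
    by (auto simp: closure_step_def f_def list_ex_iff list_all_iff)
  have "set ((closure_step m W ^^ n) M) = (f ^^ n) (set M)" for n
    by (induction n) (simp_all add: step)
  then have C: "set (closure m W M) = (f ^^ length W) (set M)" by (simp add: closure_def)
  have f: "X \<subseteq> f X \<and> f X \<subseteq> set W" if "X \<subseteq> set W" for X
    using that by (auto simp: f_def)
  note fp = funpow_fixpoint[of "set W" f, OF f finite_set M]
  show "set M \<subseteq> set (closure m W M)" "set (closure m W M) \<subseteq> set W"
    unfolding C using fp by auto
  have "f (set (closure m W M)) = set (closure m W M)"
    unfolding C using fp(3) by (simp add: card_length)
  then show "module_on (madj m) (set W) (set (closure m W M))"
    unfolding module_on_def f_def by blast
  show "set (closure m W M) \<subseteq> N" if N: "module_on (madj m) (set W) N" "set M \<subseteq> N"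
  proof -
    have fN: "f X \<subseteq> N" if "X \<subseteq> N" for X
      using N(1) that unfolding module_on_def f_def by blast
    have "(f ^^ n) (set M) \<subseteq> N" for n
      by (induction n) (use N(2) fN in auto)
    then show ?thesis unfolding C .
  qed
qed

lemma set_concat_map_filter:
  "y \<in> set (concat (map (\<lambda>a. map (f a) (filter (P a) R)) R)) \<longleftrightarrow>
     (\<exists>a\<in>set R. \<exists>b\<in>set R. P a b \<and> y = f a b)"
  by auto

lemma proper_closures_iff:
  "C \<in> set (proper_closures m R) \<longleftrightarrow>
     (\<exists>a\<in>set R. \<exists>b\<in>set R. b \<noteq> a \<and> C = closure m R [a, b]) \<and> \<not> set R \<subseteq> set C"
  unfolding proper_closures_def set_filter mem_Collect_eq list_all_iff memb_iff set_concat_map_filter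
  by (simp only: subset_eq)

text \<open>A module of the quotient lifts: vertices in different parts are adjacent iff their
  representatives are, so the union of the parts represented in \<open>C\<close> is a module of
  \<open>W\<close>. \<open>C\<close> contains two representatives, hence the number of parts drops;
  it misses one, hence at least two parts remain.\<close>

lemma merge_by_modular:
  assumes sym: "\<And>u v. madj m u v \<Longrightarrow> madj m v u" and irrefl: "\<And>u. \<not> madj m u u"
    and P: "modular_list m W P" and C: "C \<in> set (proper_closures m (map rep P))"
  shows "modular_list m W (merge_by C P)" "length (merge_by C P) < length P" "2 \<le> length (merge_by C P)"
proof -
  interpret modular_partition "madj m" W "set (map rep P)" "part_of P"
    using sym irrefl P by (rule modular_list_partition)
  note P' = modular_listD[OF P]
  obtain a b where ab: "a \<in> set (map rep P)" "b \<in> set (map rep P)" "b \<noteq> a" "C = closure m (map rep P) [a, b]"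
      "\<not> set (map rep P) \<subseteq> set C"
    using C unfolding proper_closures_iff by (elim conjE bexE)
  have cl: "{a, b} \<subseteq> set C" "set C \<subseteq> set (map rep P)" "module_on (madj m) (set (map rep P)) (set C)"
    using closure_correct(1-3)[of "[a, b]" "map rep P" m] ab by auto
  let ?in = "filter (\<lambda>D. memb (rep D) C) P" and ?out = "filter (\<lambda>D. \<not> memb (rep D) C) P"
  have len: "length ?in + length ?out = length P" by (rule sum_length_filter_compl)
  obtain A B E where ABE: "A \<in> set P" "B \<in> set P" "E \<in> set P" "a = rep A" "b = rep B" "rep E \<notin> set C"
    using ab by auto
  have "card {A, B} \<le> card (set ?in)" by (rule card_mono) (use ABE cl in auto)
  moreover have "A \<noteq> B" using ABE ab by metis
  then have "card {A, B} = 2" by simp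
  ultimately have "2 \<le> length ?in" using card_length[of ?in] by linarith
  moreover have "E \<in> set ?out" using ABE by simp
  then have "0 < length ?out" by (rule length_pos_if_in_set)
  moreover have "length (merge_by C P) = Suc (length ?out)" by (simp add: merge_by_def)
  ultimately show "length (merge_by C P) < length P" "2 \<le> length (merge_by C P)"
    using len by linarith+
  have U: "set (concat ?in) \<subseteq> W" using P'(5) by auto
  have "module_on (madj m) W (set (concat ?in))"
    unfolding module_on_def
  proof (intro conjI U ballI impI)
    fix x y z assume x: "x \<in> W - set (concat ?in)" and yz: "y \<in> set (concat ?in)" "z \<in> set (concat ?in)"
      and xy: "madj m x y"
    obtain Y Z where Y: "Y \<in> set P" "rep Y \<in> set C" "y \<in> set Y" and Z: "Z \<in> set P" "rep Z \<in> set C" "z \<in> set Z"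
      using yz by auto
    obtain X where X: "X \<in> set P" "x \<in> set X" using x P unfolding modular_list_def by auto
    then have XC: "rep X \<notin> set C" using x by auto
    have "madj m x e \<longleftrightarrow> madj m (rep X) (rep E)" if E: "E \<in> set P" "rep E \<in> set C" "e \<in> set E" for E e
    proof (rule adj_parts)
      show "rep X \<noteq> rep E" using E XC by auto
      show "x \<in> part_of P (rep X)" "e \<in> part_of P (rep E)" using P'(7) X E by simp_all
    qed (use X E in auto)
    then have "madj m x y \<longleftrightarrow> madj m (rep X) (rep Y)" "madj m x z \<longleftrightarrow> madj m (rep X) (rep Z)"
      using Y Z by blast+
    moreover have "madj m (rep X) (rep Y) \<longleftrightarrow> madj m (rep X) (rep Z)"
      by (rule module_onD[OF cl(3)]) (use X XC Y Z in auto)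
    ultimately show "madj m x z" using xy by simp
  qed
  moreover have "concat ?in \<noteq> []"
    using P'(3)[OF ABE(1)] ABE cl by auto
  moreover have "mset (concat (concat ?in # ?out)) = mset (concat P)"
    by (induction P) auto
  then have "distinct (concat (concat ?in # ?out)) = distinct (concat P)"
      "set (concat (concat ?in # ?out)) = set (concat P)"
    by (metis mset_eq_imp_distinct_iff, metis mset_eq_setD)
  ultimately show "modular_list m W (merge_by C P)"
    using P unfolding modular_list_def merge_by_def by auto
qed

lemma parts_correct:
  assumes sym: "\<And>u v. madj m u v \<Longrightarrow> madj m v u" and irrefl: "\<And>u. \<not> madj m u u"
    and W: "distinct W"
  shows "modular_list m (set W) (parts m W)" "2 \<le> length W \<Longrightarrow> 2 \<le> length (parts m W)"
    "proper_closures m (map rep (parts m W)) = []"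
proof -
  define Q where "Q n = (merge m ^^ n) (map (\<lambda>x. [x]) W)" for n
  have QS: "Q (Suc n) = (case proper_closures m (map rep (Q n)) of [] \<Rightarrow> Q n | C # _ \<Rightarrow> merge_by C (Q n))" for n
    unfolding Q_def by (simp add: merge_eq)
  \<comment> \<open>The last conjunct counts progress: unless merging has become impossible, each of
    the \<open>n\<close> rounds has removed a part.\<close>
  have inv: "modular_list m (set W) (Q n) \<and> (2 \<le> length W \<longrightarrow> 2 \<le> length (Q n)) \<and>
      (proper_closures m (map rep (Q n)) = [] \<or> length (Q n) + n \<le> length W)" for n
  proof (induction n)
    case 0
    have "concat (map (\<lambda>x. [x]) W) = W" by (induction W) auto
    then show ?case using W by (auto simp: Q_def modular_list_def module_on_def)
  next
    case (Suc n)
    show ?case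
    proof (cases "proper_closures m (map rep (Q n))")
      case Nil
      then show ?thesis using Suc by (simp add: QS)
    next
      case (Cons C Cs)
      then have C: "C \<in> set (proper_closures m (map rep (Q n)))" by simp
      have "Q (Suc n) = merge_by C (Q n)" using Cons by (simp add: QS)
      moreover have P: "modular_list m (set W) (Q n)" using Suc by simp
      have "modular_list m (set W) (merge_by C (Q n))" "length (merge_by C (Q n)) < length (Q n)"
          "2 \<le> length (merge_by C (Q n))"
        by (rule merge_by_modular[OF _ _ P C]; (rule irrefl | erule sym))+
      ultimately show ?thesis using Suc Cons by auto
    qed
  qed
  have Q: "parts m W = Q (length W)" by (simp add: parts_def Q_def)
  show "modular_list m (set W) (parts m W)" "2 \<le> length W \<Longrightarrow> 2 \<le> length (parts m W)"
    using inv unfolding Q by auto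
  show "proper_closures m (map rep (parts m W)) = []"
  proof (rule ccontr)
    assume *: "proper_closures m (map rep (parts m W)) \<noteq> []"
    \<comment> \<open>If merging were still possible after \<open>length W\<close> rounds, no part
      would be left, but without representatives there are no closures.\<close>
    then have "Q (length W) = []" using inv[of "length W"] unfolding Q by auto
    then show False using * unfolding Q by (simp add: proper_closures_def)
  qed
qed

text \<open>If a module were a union of at least two but not all parts, its trace on the
  representatives would be a module of the quotient containing two representatives, and hence their
  closure. That closure would be proper, which the final partition excludes.\<close>

lemma length_parts_le:
  assumes sym: "\<And>u v. madj m u v \<Longrightarrow> madj m v u" and irrefl: "\<And>u. \<not> madj m u u"
    and W: "distinct W"
    and V: "partition_on (set W) \<V>" "finite \<V>" "\<And>M. M \<in> \<V> \<Longrightarrow> module_on (madj m) (set W) M \<and> M \<noteq> set W"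
  shows "length (parts m W) \<le> card \<V>"
proof -
  let ?P = "parts m W" and ?\<P> = "set ` set (parts m W)"
  have P: "modular_list m (set W) ?P" and Pc: "proper_closures m (map rep ?P) = []"
    by (rule parts_correct[OF _ _ W]; (rule irrefl | erule sym))+
  note P' = modular_listD[OF P]
  have inj: "inj_on set (set ?P)"
  proof (rule inj_onI)
    fix D E assume "D \<in> set ?P" "E \<in> set ?P" "set D = set E"
    then show "D = E" using P'(6)[of D E "rep D"] P'(3) by auto
  qed
  have "length ?P = card ?\<P>"
    using distinct_card[OF P'(1)] card_image[OF inj] by simp
  also have "\<dots> \<le> card \<V>"
  proof (rule parts_le_modules[OF _ _ _ _ _ V])
    show "partition_on (set W) ?\<P>"
      unfolding partition_on_def disjoint_def
    proof (intro conjI ballI impI)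
      show "\<Union>?\<P> = set W" "{} \<notin> ?\<P>" using P unfolding modular_list_def by auto
      fix A B assume "A \<in> ?\<P>" "B \<in> ?\<P>" "A \<noteq> B"
      then show "A \<inter> B = {}" using P'(6) by auto
    qed
    show "module_on (madj m) (set W) A" if "A \<in> ?\<P>" for A
      using that P unfolding modular_list_def by auto
    fix \<Q> A B assume Q: "\<Q> \<subseteq> ?\<P>" "A \<in> \<Q>" "B \<in> \<Q>" "A \<noteq> B" "module_on (madj m) (set W) (\<Union>\<Q>)"
    let ?R = "map rep ?P"
    obtain D E where DE: "D \<in> set ?P" "E \<in> set ?P" "A = set D" "B = set E" using Q by blast
    then have "D \<noteq> E" using Q by auto
    then have ne: "rep D \<noteq> rep E" using P'(6)[OF DE(1,2), of "rep D"] P'(3) DE by metis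
    have RW: "set ?R \<subseteq> set W" using P'(3,5) by fastforce
    have mem: "rep X \<in> \<Union>\<Q> \<longleftrightarrow> set X \<in> \<Q>" if X: "X \<in> set ?P" for X
    proof
      assume "rep X \<in> \<Union>\<Q>"
      then obtain Y where Y: "Y \<in> set ?P" "set Y \<in> \<Q>" "rep X \<in> set Y" using Q(1) by blast
      then have "X = Y" using P'(6)[OF X Y(1), of "rep X"] P'(3)[OF X] by simp
      then show "set X \<in> \<Q>" using Y by simp
    qed (use P'(3)[OF X] in blast)
    have "module_on (madj m) (set ?R) (\<Union>\<Q> \<inter> set ?R)"
      using Q(5) RW unfolding module_on_def by blast
    moreover have "set [rep D, rep E] \<subseteq> \<Union>\<Q> \<inter> set ?R" using mem DE Q by auto
    ultimately have "set (closure m ?R [rep D, rep E]) \<subseteq> \<Union>\<Q> \<inter> set ?R"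
      using DE by (intro closure_correct(4)) auto
    moreover have "set ?R \<subseteq> set (closure m ?R [rep D, rep E])"
    proof (rule ccontr)
      assume "\<not> set ?R \<subseteq> set (closure m ?R [rep D, rep E])"
      then have "closure m ?R [rep D, rep E] \<in> set (proper_closures m ?R)"
        unfolding proper_closures_iff
        by (intro conjI bexI[of _ "rep D"] bexI[of _ "rep E"]) (use DE ne in auto)
      then show False using Pc by simp
    qed
    ultimately have "set ?R \<subseteq> \<Union>\<Q>" by blast
    then show "\<Q> = ?\<P>" using mem Q(1) by auto
  qed (use sym in simp_all)
  finally show ?thesis .
qed

section \<open>Correctness of one round\<close>

text \<open>Symmetry and irreflexivity can be asked of all numbers, since indices outside the matrix
  are isolated by the default value in \<open>madj\<close>.\<close>

definition graph_matrix :: "bool list list \<Rightarrow> bool" where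
  "graph_matrix m \<longleftrightarrow> (\<forall>u v. madj m u v \<longrightarrow> madj m v u) \<and> (\<forall>u. \<not> madj m u u)"

text \<open>What the time bound uses of modular-width: a statement about all induced subgraphs at
  once, so that it passes to every vertex set of the recursion.\<close>

definition splittable :: "nat \<Rightarrow> bool list list \<Rightarrow> bool" where
  "splittable k m \<longleftrightarrow> (\<forall>W \<subseteq> {..<length m}. 2 \<le> card W \<longrightarrow> (\<exists>\<V>. partition_on W \<V> \<and> finite \<V> \<and>
     card \<V> \<le> k \<and> (\<forall>M\<in>\<V>. module_on (madj m) W M \<and> M \<noteq> W)))"

text \<open>
  The time bounds refer to the data of the program, hence to this number, which is at most \<open>mw G\<close>.
\<close>

definition width :: "bool list list \<Rightarrow> nat" where
  "width m = (LEAST k. splittable k m)"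

abbreviation reach :: "bool list list \<Rightarrow> nat list \<Rightarrow> nat list \<Rightarrow> nat list \<Rightarrow> bool" where
  "reach m S T W \<equiv> slides (madj m) (set W) (set S \<inter> set W) (set T \<inter> set W)"

type_synonym instance_data = "bool list list \<times> nat list \<times> nat list"

definition search_start :: "instance_data \<times> nat list \<Rightarrow> search_state" where
  "search_start x = (let m = fst (fst x); P = parts m (snd x); R = map rep P in
     ((m, (R, light P (fst (snd (fst x))))), ([occupied P (fst (snd (fst x)))], (Leaf, R))))"

definition finish :: "(instance_data \<times> nat list) \<times> (tree \<times> nat list) \<Rightarrow> bool \<times> nat list list" where
  "finish y = (let P = parts (fst (fst (fst y))) (snd (fst y)); T = snd (snd (fst (fst y))) in
     (trie_mem (key (map rep P) (occupied P T)) (fst (snd y)) \<and>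
        list_all (\<lambda>D. memb (rep D) (snd (snd y)) \<or> at_most_one D T) P,
      filter (\<lambda>D. memb (rep D) (snd (snd y))) P))"

text \<open>
  The result says whether the local conditions hold, and which vertex sets are left to be solved.
\<close>

definition process :: "instance_data \<times> nat list \<Rightarrow> bool \<times> nat list list" where
  "process x = (if tl (snd x) \<noteq> [] then finish (x, snd (snd (search (search_start x))))
     else (list_all (\<lambda>u. memb u (fst (snd (fst x))) = memb u (snd (snd (fst x)))) (snd x), []))"

lemma tl_Nil_iff: "distinct xs \<Longrightarrow> tl xs = [] \<longleftrightarrow> (\<forall>x\<in>set xs. \<forall>y\<in>set xs. x = y)"
  by (cases xs; cases "tl xs") auto

lemma at_most_one_iff:
  "distinct D \<Longrightarrow> at_most_one D X \<longleftrightarrow> (\<forall>x\<in>set X \<inter> set D. \<forall>y\<in>set X \<inter> set D. x = y)"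
  unfolding at_most_one_def by (subst tl_Nil_iff) auto

text \<open>Used with \<open>b = length W - 1\<close>, as all parts are proper. For a partition of
  an n-element set the bound is then at most (n - 1) n + n = n^2, just below the n^2 + 1 charged for
  the set itself.\<close>

lemma sum_list_squares:
  assumes "\<And>D. D \<in> set P \<Longrightarrow> length D \<le> b"
  shows "sum_list (map (\<lambda>D. length D ^ 2 + 1) P) \<le> b * sum_list (map length P) + length P"
  using assms
proof (induction P)
  case (Cons D P)
  have "length D ^ 2 \<le> b * length D"
    unfolding power2_eq_square by (rule mult_le_mono1) (simp add: Cons.prems)
  moreover have "sum_list (map (\<lambda>D. length D ^ 2 + 1) P) \<le> b * sum_list (map length P) + length P"
    using Cons by simp
  ultimately show ?case by (simp add: distrib_left)
qed simp

text \<open>With at most one vertex there is no edge and no slide, so reachability is equality of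
  the traces.\<close>

lemma process_small:
  assumes m: "graph_matrix m" and W: "tl W = []"
  shows "reach m S T W \<longleftrightarrow> fst (process ((m, S, T), W))" "snd (process ((m, S, T), W)) = []"
proof -
  show "snd (process ((m, S, T), W)) = []" using W by (simp add: process_def)
  have "\<not> slide (madj m) (set W) X Y" for X Y
  proof
    assume "slide (madj m) (set W) X Y"
    then obtain u v where "u \<in> set W" "v \<in> set W" "madj m u v" unfolding slide_def by blast
    moreover from this have "u = v" using W by (cases W) auto
    ultimately show False using m unfolding graph_matrix_def by blast
  qed
  then have "slides (madj m) (set W) X Y \<longleftrightarrow> X = Y" for X Y
    by (metis rtranclp.rtrancl_refl converse_rtranclpE)
  then show "reach m S T W \<longleftrightarrow> fst (process ((m, S, T), W))"
    using W by (auto simp: process_def list_all_iff)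
qed

lemma esize_map_filter: "esize (map f (filter g xs)) \<le> esize (map f xs)"
  by (induction xs) auto

lemma process_large:
  assumes m: "graph_matrix m" and W: "distinct W" "tl W \<noteq> []"
    and S: "indep (madj m) (set S)" and T: "indep (madj m) (set T)"
  shows "reach m S T W \<longleftrightarrow> fst (process ((m, S, T), W)) \<and>
      (\<forall>D\<in>set (snd (process ((m, S, T), W))). reach m S T D)"
    and "D \<in> set (snd (process ((m, S, T), W))) \<Longrightarrow> distinct D \<and> set D \<subseteq> set W"
    and "sum_list (map (\<lambda>D. length D ^ 2 + 1) (snd (process ((m, S, T), W)))) < length W ^ 2 + 1"
proof -
  have sym: "madj m u v \<Longrightarrow> madj m v u" and irrefl: "\<not> madj m u u" for u v
    using m unfolding graph_matrix_def by blast+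
  define P where "P = parts m W"
  define R where "R = map rep P"
  have len: "2 \<le> length W" using W(2) by (cases W; cases "tl W") auto
  have P: "modular_list m (set W) P" and P2: "2 \<le> length P"
    unfolding P_def using len by (auto intro!: parts_correct irrefl W) (erule sym)+
  note P' = modular_listD[OF P]
  have mp: "modular_partition (madj m) (set W) (set R) (part_of P)"
    unfolding R_def by (rule modular_list_partition[OF _ _ P]; (rule irrefl | erule sym))
  interpret modular_partition "madj m" "set W" "set R" "part_of P" by (rule mp)
  define SW where "SW = set S \<inter> set W"
  define TW where "TW = set T \<inter> set W"
  have SW: "SW \<subseteq> set W" "indep (madj m) SW" and TW: "TW \<subseteq> set W" "indep (madj m) TW"
    unfolding SW_def TW_def using S T indep_subset by blast+
  have part: "set X \<inter> set W \<inter> part_of P (rep D) = set X \<inter> set D" if "D \<in> set P" for X D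
    using P'(5,7)[OF that] by blast
  have occ: "set (occupied P X) = occ (set X \<inter> set W)" for X
    unfolding occ_def unfolding R_def occupied_def using part by (fastforce simp: list_ex_iff)
  have one: "at_most_one D X \<longleftrightarrow>
      (\<forall>x\<in>set X \<inter> set W \<inter> part_of P (rep D). \<forall>y\<in>set X \<inter> set W \<inter> part_of P (rep D). x = y)"
    if "D \<in> set P" for D X
    using at_most_one_iff[OF P'(4)[OF that], of X] unfolding part[OF that] .
  have repD: "D = E" if "D \<in> set P" "E \<in> set P" "rep D = rep E" for D E
    using P'(6)[OF that(1,2), of "rep D"] P'(3) that by metis
  have L: "set (light P S) = set R - heavy SW"
  proof (rule set_eqI)
    fix r
    show "r \<in> set (light P S) \<longleftrightarrow> r \<in> set R - heavy SW"
    proof (cases "r \<in> set R")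
      case True
      then obtain D where D: "D \<in> set P" "r = rep D" unfolding R_def by auto
      then have "r \<in> set (light P S) \<longleftrightarrow> at_most_one D S"
        using repD unfolding light_def by auto
      then show ?thesis
        using one[OF D(1), of S] True D unfolding heavy_def SW_def by auto
    next
      case False
      then show ?thesis unfolding light_def R_def by auto
    qed
  qed
  obtain c st vis F where res: "search ((m, R, light P S), ([occupied P S], (Leaf, R))) = (c, (st, (vis, F)))"
    by (metis prod.collapse)
  have q0: "set (occupied P S) = occ SW" "length (occupied P S) \<le> length R" "esize (occupied P S) \<le> esize R"
    unfolding SW_def occ by (simp_all add: occupied_def R_def esize_map_filter)
  note vis = search_correct(1)[OF mp SW(2) L q0 res] and F = search_correct(2)[OF mp SW(2) L q0 res]
  have proc: "process ((m, S, T), W) = (trie_mem (key R (occupied P T)) vis \<and>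
      (\<forall>D\<in>set P. rep D \<in> set F \<or> at_most_one D T), filter (\<lambda>D. rep D \<in> set F) P)"
    using W(2) res by (simp add: process_def search_start_def finish_def Let_def P_def R_def list_all_iff)
  have "reach m S T W \<longleftrightarrow> occ TW \<in> states SW \<and>
      (\<forall>r\<in>set R - frozen SW. \<forall>x\<in>TW \<inter> part_of P r. \<forall>y\<in>TW \<inter> part_of P r. x = y) \<and>
      (\<forall>r\<in>frozen SW. slides (madj m) (part_of P r) (SW \<inter> part_of P r) (TW \<inter> part_of P r))"
    using reach_iff[OF SW TW] unfolding SW_def TW_def .
  moreover have "set (occupied P T) \<subseteq> set R" by (auto simp: occupied_def R_def)
  then have "trie_mem (key R (occupied P T)) vis \<longleftrightarrow> occ TW \<in> states SW"
    unfolding TW_def occ[symmetric] by (rule vis)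
  moreover have "(\<forall>D\<in>set P. rep D \<in> set F \<or> at_most_one D T) \<longleftrightarrow>
      (\<forall>r\<in>set R - frozen SW. \<forall>x\<in>TW \<inter> part_of P r. \<forall>y\<in>TW \<inter> part_of P r. x = y)"
  proof -
    have "(\<forall>r\<in>set R - frozen SW. Q r) \<longleftrightarrow> (\<forall>D\<in>set P. rep D \<notin> frozen SW \<longrightarrow> Q (rep D))" for Q
      by (auto simp: R_def)
    moreover have "(rep D \<in> frozen SW \<or> at_most_one D T) \<longleftrightarrow> (rep D \<notin> frozen SW \<longrightarrow>
        (\<forall>x\<in>TW \<inter> part_of P (rep D). \<forall>y\<in>TW \<inter> part_of P (rep D). x = y))" if "D \<in> set P" for D
      unfolding one[OF that] TW_def by blast
    ultimately show ?thesis unfolding F by simp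
  qed
  moreover have "(\<forall>D\<in>set (filter (\<lambda>D. rep D \<in> set F) P). reach m S T D) \<longleftrightarrow>
      (\<forall>r\<in>frozen SW. slides (madj m) (part_of P r) (SW \<inter> part_of P r) (TW \<inter> part_of P r))"
  proof -
    have fz: "r \<in> rep ` set P" if "r \<in> frozen SW" for r
      using that unfolding frozen_def unfolding R_def by simp
    have "(\<forall>r\<in>frozen SW. Q r) \<longleftrightarrow> (\<forall>D\<in>set (filter (\<lambda>D. rep D \<in> set F) P). Q (rep D))" for Q
      unfolding F set_filter using fz by fast
    moreover have "reach m S T D \<longleftrightarrow> slides (madj m) (part_of P (rep D))
        (SW \<inter> part_of P (rep D)) (TW \<inter> part_of P (rep D))" if "D \<in> set P" for D
      unfolding SW_def TW_def unfolding part[OF that] unfolding P'(7)[OF that] ..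
    ultimately show ?thesis by simp
  qed
  ultimately show "reach m S T W \<longleftrightarrow> fst (process ((m, S, T), W)) \<and>
      (\<forall>D\<in>set (snd (process ((m, S, T), W))). reach m S T D)"
    unfolding proc by auto
  show "distinct D \<and> set D \<subseteq> set W" if "D \<in> set (snd (process ((m, S, T), W)))"
    using that P'(4,5) unfolding proc by auto
  have sumlen: "sum_list (map length P) = length W"
  proof -
    have "sum_list (map length P) = length (concat P)" by (simp add: length_concat)
    also have "\<dots> = card (set W)" using P distinct_card[of "concat P"] unfolding modular_list_def by simp
    also have "\<dots> = length W" using W(1) distinct_card by blast
    finally show ?thesis .
  qed
  \<comment> \<open>At least two nonempty parts exist, so each part misses the representative of
    another one.\<close>
  have lenD: "length D \<le> length W - 1" if D: "D \<in> set P" for D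
  proof -
    have "card (set P) \<noteq> card {D}" using distinct_card[OF P'(1)] P2 by simp
    then have "set P \<noteq> {D}" by metis
    then obtain E where E: "E \<in> set P" "E \<noteq> D"
      using D by (metis subset_singletonD subsetI singletonI empty_iff)
    have "rep E \<notin> set D"
    proof
      assume "rep E \<in> set D"
      from P'(6)[OF D E(1) this P'(3)[OF E(1)]] E(2) show False by simp
    qed
    moreover have "rep E \<in> set W" using P'(3,5)[OF E(1)] by auto
    ultimately have "set D \<subset> set W" using P'(5)[OF D] by blast
    then have "card (set D) < card (set W)" by (intro psubset_card_mono) auto
    then show ?thesis using distinct_card[OF W(1)] distinct_card[OF P'(4)[OF D]] by simp
  qed
  have lenP: "length P \<le> length W"
  proof -
    have "length xss \<le> sum_list (map length xss)" if "[] \<notin> set xss" for xss :: "nat list list"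
      using that
    proof (induction xss)
      case (Cons xs xss)
      then obtain y ys where "xs = y # ys" by (cases xs) auto
      with Cons show ?case by simp
    qed simp
    then show ?thesis using P sumlen unfolding modular_list_def by metis
  qed
  have "sum_list (map f (filter g P)) \<le> sum_list (map f P)" for f :: "nat list \<Rightarrow> nat" and g
    by (induction P) auto
  then have "sum_list (map (\<lambda>D. length D ^ 2 + 1) (snd (process ((m, S, T), W)))) \<le>
      sum_list (map (\<lambda>D. length D ^ 2 + 1) P)"
    unfolding proc by simp
  also have "\<dots> \<le> (length W - 1) * sum_list (map length P) + length P"
    by (rule sum_list_squares[OF lenD])
  also have "\<dots> \<le> (length W - 1) * length W + length W" using lenP sumlen by simp
  also have "\<dots> = length W ^ 2"
    using len by (cases "length W") (auto simp: power2_eq_square)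
  finally show "sum_list (map (\<lambda>D. length D ^ 2 + 1) (snd (process ((m, S, T), W)))) < length W ^ 2 + 1"
    by simp
qed

lemma process_correct:
  assumes m: "graph_matrix m" and W: "distinct W"
    and ST: "indep (madj m) (set S)" "indep (madj m) (set T)"
  shows "reach m S T W \<longleftrightarrow> fst (process ((m, S, T), W)) \<and>
      (\<forall>D\<in>set (snd (process ((m, S, T), W))). reach m S T D)"
    and "D \<in> set (snd (process ((m, S, T), W))) \<Longrightarrow> distinct D \<and> set D \<subseteq> set W"
    and "sum_list (map (\<lambda>D. length D ^ 2 + 1) (snd (process ((m, S, T), W)))) < length W ^ 2 + 1"
  using process_small[OF m] process_large[OF m W _ ST] by (cases "tl W = []"; simp)+

section \<open>Running time\<close>

text \<open>The exponential factor is kept apart with its own exponent \<open>\<phi>\<close>, so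
  that combining with polynomial-time code leaves the exponent unchanged.\<close>

definition xtimed :: "('a::treeable \<Rightarrow> bool) \<Rightarrow> ('a \<Rightarrow> nat) \<Rightarrow> ('a \<Rightarrow> nat) \<Rightarrow> ('a \<Rightarrow> 'b::treeable) \<Rightarrow> bool" where
  "xtimed D \<phi> \<mu> f \<longleftrightarrow> (\<exists>p. timed D f (\<lambda>x. 2 ^ \<phi> x * poly p (\<mu> x)))"

lemma xtimedI:
  assumes "timed D f T" "poly_bounded D \<mu> g" "\<And>x. D x \<Longrightarrow> T x \<le> 2 ^ \<phi> x * g x"
  shows "xtimed D \<phi> \<mu> f"
proof -
  obtain p where p: "\<And>x. D x \<Longrightarrow> g x \<le> poly p (\<mu> x)"
    using assms(2) unfolding poly_bounded_def by blast
  have "timed D f (\<lambda>x. 2 ^ \<phi> x * poly p (\<mu> x))"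
    by (rule timed_mono[OF assms(1)]) (use p assms(3) le_trans mult_le_mono2 in blast)+
  then show ?thesis unfolding xtimed_def by blast
qed

lemma xtimed_mono:
  "xtimed D \<phi> \<mu> f \<Longrightarrow> (\<And>x. D' x \<Longrightarrow> D x) \<Longrightarrow> xtimed D' \<phi> \<mu> f"
  unfolding xtimed_def by (elim exE, rule exI, erule timed_mono) auto

lemma le_two_power_mult: "(n :: nat) \<le> 2 ^ k * n"
  by simp

lemma xtimed_ptimed: "ptimed D \<mu> f \<Longrightarrow> xtimed D \<phi> \<mu> f"
  unfolding ptimed_def by (elim exE conjE, rule xtimedI, assumption+) (rule le_two_power_mult)

lemma xtimed_post:
  assumes g: "xtimed D \<phi> \<mu> g" and f: "ptimed D' \<mu>' f" "\<And>x. D x \<Longrightarrow> D' (g x)" "poly_bounded D \<mu> (\<lambda>x. \<mu>' (g x))"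
  shows "xtimed D \<phi> \<mu> (\<lambda>x. f (g x))"
proof -
  obtain p where g: "timed D g (\<lambda>x. 2 ^ \<phi> x * poly p (\<mu> x))" using g unfolding xtimed_def by blast
  obtain T where T: "timed D' f T" "poly_bounded D' \<mu>' T" using f unfolding ptimed_def by blast
  have B: "poly_bounded D \<mu> (\<lambda>x. poly p (\<mu> x) + T (g x) + 3)"
    by (intro poly_bounded_add poly_bounded_const poly_bounded_poly poly_bounded_self
        poly_bounded_comp[OF T(2) f(2,3)])
  have "timed D (\<lambda>x. f (g x)) (\<lambda>x. 2 ^ \<phi> x * poly p (\<mu> x) + T (g x) + 3)"
    by (rule timed_comp[OF g T(1)]) (rule f(2))
  then show ?thesis
  proof (rule xtimedI[OF _ B])
    fix x
    show "2 ^ \<phi> x * poly p (\<mu> x) + T (g x) + 3 \<le> 2 ^ \<phi> x * (poly p (\<mu> x) + T (g x) + 3)"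
      using le_two_power_mult[of "T (g x) + 3" "\<phi> x"] by (simp add: distrib_left)
  qed
qed

lemma xtimed_pre:
  assumes g: "ptimed D \<mu> g" and f: "xtimed D' \<phi>' \<mu>' f" "\<And>x. D x \<Longrightarrow> D' (g x)"
    and \<phi>: "\<And>x. D x \<Longrightarrow> \<phi>' (g x) \<le> \<phi> x" and \<mu>: "poly_bounded D \<mu> (\<lambda>x. \<mu>' (g x))"
  shows "xtimed D \<phi> \<mu> (\<lambda>x. f (g x))"
proof -
  obtain p where f': "timed D' f (\<lambda>x. 2 ^ \<phi>' x * poly p (\<mu>' x))" using f unfolding xtimed_def by blast
  obtain T where T: "timed D g T" "poly_bounded D \<mu> T" using g unfolding ptimed_def by blast
  have B: "poly_bounded D \<mu> (\<lambda>x. T x + poly p (\<mu>' (g x)) + 3)"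
    by (intro poly_bounded_add poly_bounded_const poly_bounded_poly \<mu> T)
  have "timed D (\<lambda>x. f (g x)) (\<lambda>x. T x + 2 ^ \<phi>' (g x) * poly p (\<mu>' (g x)) + 3)"
    by (rule timed_comp[OF T(1) f']) (rule f(2))
  then show ?thesis
  proof (rule xtimedI[OF _ B])
    fix x assume "D x"
    then have "2 ^ \<phi>' (g x) * poly p (\<mu>' (g x)) \<le> 2 ^ \<phi> x * poly p (\<mu>' (g x))"
      using \<phi> by (intro mult_le_mono1 power_increasing) auto
    then show "T x + 2 ^ \<phi>' (g x) * poly p (\<mu>' (g x)) + 3 \<le> 2 ^ \<phi> x * (T x + poly p (\<mu>' (g x)) + 3)"
      unfolding distrib_left using le_two_power_mult[of "T x" "\<phi> x"] le_two_power_mult[of 3 "\<phi> x"] by linarith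
  qed
qed

lemma xtimed_Pair:
  assumes "xtimed D \<phi> \<mu> f" "xtimed D \<phi> \<mu> g"
  shows "xtimed D \<phi> \<mu> (\<lambda>x. (f x, g x))"
proof -
  obtain p q where "timed D f (\<lambda>x. 2 ^ \<phi> x * poly p (\<mu> x))" "timed D g (\<lambda>x. 2 ^ \<phi> x * poly q (\<mu> x))"
    using assms unfolding xtimed_def by blast
  note fg = this
  have "poly_bounded D \<mu> (\<lambda>x. poly p (\<mu> x) + poly q (\<mu> x) + 5)"
    by (intro poly_bounded_add poly_bounded_const poly_bounded_poly poly_bounded_self)
  then show ?thesis
    by (rule xtimedI[OF timed_Pair[OF fg]]) (simp add: distrib_left)
qed

lemma xtimed_If:
  assumes "ptimed D \<mu> c" "xtimed (\<lambda>x. D x \<and> c x) \<phi> \<mu> f" "xtimed (\<lambda>x. D x \<and> \<not> c x) \<phi> \<mu> g"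
  shows "xtimed D \<phi> \<mu> (\<lambda>x. if c x then f x else g x)"
proof -
  obtain p q where fg: "timed (\<lambda>x. D x \<and> c x) f (\<lambda>x. 2 ^ \<phi> x * poly p (\<mu> x))"
    "timed (\<lambda>x. D x \<and> \<not> c x) g (\<lambda>x. 2 ^ \<phi> x * poly q (\<mu> x))"
    using assms unfolding xtimed_def by blast
  obtain T where T: "timed D c T" "poly_bounded D \<mu> T" using assms(1) unfolding ptimed_def by blast
  have "poly_bounded D \<mu> (\<lambda>x. T x + poly p (\<mu> x) + poly q (\<mu> x) + 5)"
    by (intro poly_bounded_add poly_bounded_const poly_bounded_poly poly_bounded_self T)
  then show ?thesis
  proof (rule xtimedI[OF timed_If[OF T(1) fg]])
    fix x
    show "T x + (if c x then 2 ^ \<phi> x * poly p (\<mu> x) else 2 ^ \<phi> x * poly q (\<mu> x)) + 5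
        \<le> 2 ^ \<phi> x * (T x + poly p (\<mu> x) + poly q (\<mu> x) + 5)"
      using le_two_power_mult[of "T x + 5" "\<phi> x"] by (simp add: distrib_left)
  qed
qed

lemma ptime_search_start: "ptime search_start"
  unfolding search_start_def[abs_def] Let_def by (intro ptime_intros)

lemma search_result: "search_dom x \<Longrightarrow> search_dom (search x) \<and> fst (search x) = fst x"
  unfolding search_def
  by (rule while_rule[where P = "\<lambda>y. search_dom y \<and> fst y = fst x" and r = "measure search_fuel"])
    (use search_step_dom search_fuel_step in auto)

lemma search_start_dom: "search_dom (search_start x)"
  by (simp add: search_dom_def search_start_def Let_def occupied_def esize_map_filter)

definition process_dom :: "instance_data \<times> nat list \<Rightarrow> bool" where
  "process_dom x \<longleftrightarrow> graph_matrix (fst (fst x)) \<and> splittable (width (fst (fst x))) (fst (fst x)) \<and>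
     distinct (snd x) \<and> set (snd x) \<subseteq> {..<length (fst (fst x))}"

lemma length_parts_width:
  assumes "process_dom x" "tl (snd x) \<noteq> []"
  shows "length (parts (fst (fst x)) (snd x)) \<le> width (fst (fst x))"
proof -
  let ?m = "fst (fst x)" and ?W = "snd x"
  have m: "graph_matrix ?m" and W: "distinct ?W" and sub: "set ?W \<subseteq> {..<length ?m}"
    and split: "splittable (width ?m) ?m"
    using assms(1) unfolding process_dom_def by blast+
  have "2 \<le> length ?W" using assms(2) by (cases ?W; cases "tl ?W") auto
  then have "2 \<le> card (set ?W)" using distinct_card[OF W] by simp
  then obtain \<V> where V: "partition_on (set ?W) \<V>" "finite \<V>" "card \<V> \<le> width ?m"
    "\<forall>M\<in>\<V>. module_on (madj ?m) (set ?W) M \<and> M \<noteq> set ?W"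
    using split sub unfolding splittable_def by blast
  have "length (parts ?m ?W) \<le> card \<V>"
    by (rule length_parts_le[OF _ _ W V(1,2)]) (use m V(4) in \<open>auto simp: graph_matrix_def\<close>)
  with V(3) show ?thesis by simp
qed

lemma search_fuel_start:
  "search_fuel (search_start x) = 1 + 2 ^ length (parts (fst (fst x)) (snd x)) *
     (length (parts (fst (fst x)) (snd x)) * length (parts (fst (fst x)) (snd x)) + 1)"
  by (simp add: search_fuel_def search_start_def Let_def trie_mem_Leaf)

text \<open>With r parts the initial potential is 1 + 2^r (r^2 + 1): one stacked state and no stored
  key. As r is at most \<open>width\<close>, the number of rounds is a power of 2 times a
  polynomial, and each round is polynomial in the quotient.\<close>

lemma xtimed_search:
  "xtimed (\<lambda>x. process_dom x \<and> tl (snd x) \<noteq> []) (\<lambda>x. width (fst (fst x))) esize (\<lambda>x. search (search_start x))"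
proof -
  let ?r = "\<lambda>x :: instance_data \<times> nat list. length (parts (fst (fst x)) (snd x))"
  obtain p where p: "timed search_dom search (\<lambda>x. (search_fuel x + 1) * poly p (esize (fst x)))"
    using timed_search by blast
  obtain T where T: "timed (\<lambda>_. True) search_start T" "poly_bounded (\<lambda>_. True) esize T"
    using ptime_search_start unfolding ptime_def ptimed_def by blast
  let ?D = "\<lambda>x. process_dom x \<and> tl (snd x) \<noteq> []"
  have T': "timed ?D search_start T" by (rule timed_mono[OF T(1)]) auto
  have size: "poly_bounded ?D esize (\<lambda>x. esize (fst (search_start x)))"
  proof (rule poly_bounded_mono[where D = "\<lambda>_. True"])
    show "poly_bounded (\<lambda>_. True) esize (\<lambda>x. esize (search_start x))"
      using ptime_search_start unfolding ptime_def by blast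
  qed (simp_all add: esize_fst)
  have r: "poly_bounded ?D esize ?r"
  proof (rule poly_bounded_mono[OF size])
    fix x
    show "?r x \<le> esize (fst (search_start x))"
      using length_le_esize[of "map rep (parts (fst (fst x)) (snd x))"]
      by (simp add: search_start_def Let_def)
  qed
  have "poly_bounded ?D esize (\<lambda>x. T x + (2 + (?r x * ?r x + 1)) * poly p (esize (fst (search_start x))) + 3)"
    by (intro poly_bounded_add poly_bounded_mult poly_bounded_const r poly_bounded_poly size
        poly_bounded_mono[OF T(2)]) auto
  then show ?thesis
  proof (rule xtimedI[OF timed_comp[OF T' p search_start_dom]])
    fix x assume D: "?D x"
    let ?k = "width (fst (fst x))" and ?q = "poly p (esize (fst (search_start x)))"
    have "(2 :: nat) ^ ?r x \<le> 2 ^ ?k" using length_parts_width D by (intro power_increasing) auto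
    then have "search_fuel (search_start x) + 1 \<le> 2 + 2 ^ ?k * (?r x * ?r x + 1)"
      unfolding search_fuel_start using mult_le_mono1[of "2 ^ ?r x" "2 ^ ?k" "?r x * ?r x + 1"] by linarith
    also have "\<dots> \<le> 2 ^ ?k * (2 + (?r x * ?r x + 1))"
      unfolding distrib_left using le_two_power_mult[of 2 ?k] by linarith
    finally have "(search_fuel (search_start x) + 1) * ?q \<le> 2 ^ ?k * (2 + (?r x * ?r x + 1)) * ?q"
      by (rule mult_le_mono1)
    then have "(T x + 3) + (search_fuel (search_start x) + 1) * ?q \<le>
        2 ^ ?k * (T x + 3) + 2 ^ ?k * (2 + (?r x * ?r x + 1)) * ?q"
      by (rule add_mono[OF le_two_power_mult])
    also have "\<dots> = 2 ^ ?k * (T x + (2 + (?r x * ?r x + 1)) * ?q + 3)"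
      by (simp add: algebra_simps)
    finally show "T x + (search_fuel (search_start x) + 1) * ?q + 3 \<le>
        2 ^ ?k * (T x + (2 + (?r x * ?r x + 1)) * ?q + 3)"
      by linarith
  qed
qed

text \<open>The measure leaves out the trie, which is consulted for a single key.\<close>

lemma ptimed_finish: "ptimed (\<lambda>_. True) (\<lambda>y. esize (fst y) + esize (snd (snd y))) finish"
proof -
  let ?\<mu> = "\<lambda>y :: (instance_data \<times> nat list) \<times> (tree \<times> nat list). esize (fst y) + esize (snd (snd y))"
  let ?key = "\<lambda>x :: instance_data \<times> nat list. let P = parts (fst (fst x)) (snd x) in
      key (map rep P) (occupied P (snd (snd (fst x))))"
  have key: "ptime ?key" unfolding Let_def by (intro ptime_intros)
  have proj: "ptimed (\<lambda>_. True) ?\<mu> (\<lambda>y. (fst y, snd (snd y)))"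
    by (intro ptimed_unary ptimed_Pair ptimed_id)
  have proj_le: "esize (fst y, snd (snd y)) \<le> poly [:1, 1:] (?\<mu> y)"
    for y :: "(instance_data \<times> nat list) \<times> (tree \<times> nat list)" by simp
  have k: "ptimed (\<lambda>_. True) ?\<mu> (\<lambda>y. ?key (fst y))"
    by (rule ptimed_small[OF key _ , where q = "[:0, 1:]"]) (simp_all add: ptimed_unary ptimed_id)
  have "poly_bounded (\<lambda>_. True) esize (\<lambda>x. esize (?key x))"
    using key unfolding ptime_def by blast
  then have "poly_bounded (\<lambda>_. True) ?\<mu> (\<lambda>y. esize (?key (fst y)))"
    by (rule poly_bounded_comp) (rule TrueI, rule poly_bounded_mono[OF poly_bounded_self], simp_all)
  then have len: "poly_bounded (\<lambda>_. True) ?\<mu> (\<lambda>y. length (?key (fst y)))"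
    by (rule poly_bounded_mono) (simp_all add: length_le_esize)
  have mem: "ptimed (\<lambda>_. True) ?\<mu> (\<lambda>y. trie_mem (?key (fst y)) (fst (snd y)))"
    using ptimed_comp[OF ptimed_Pair[OF k] ptimed_trie_mem, of "\<lambda>y. fst (snd y)"] len
    by (simp add: ptimed_unary ptimed_id)
  have all: "ptime (\<lambda>z. list_all (\<lambda>D. memb (rep D) (snd z) \<or> at_most_one D (snd (snd (fst (fst z)))))
      (parts (fst (fst (fst z))) (snd (fst z))))" by (intro ptime_intros)
  have filt: "ptime (\<lambda>z. filter (\<lambda>D. memb (rep D) (snd z)) (parts (fst (fst (fst z))) (snd (fst z))))"
    for z :: "(instance_data \<times> nat list) \<times> nat list" by (intro ptime_intros)
  show ?thesis
    unfolding finish_def[abs_def] Let_def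
    using mem ptimed_small[OF all proj proj_le] ptimed_small[OF filt proj proj_le]
    by (intro ptimed_Pair ptimed_conj) (auto simp: Let_def simp del: memb_iff intro: ptimed_mono)
qed

lemma xtimed_process: "xtimed process_dom (\<lambda>x. width (fst (fst x))) esize process"
proof -
  let ?\<phi> = "\<lambda>x :: instance_data \<times> nat list. width (fst (fst x))"
  let ?D = "\<lambda>x. process_dom x \<and> tl (snd x) \<noteq> []"
  have snd_snd: "ptimed (\<lambda>_. True) (\<lambda>_. 0) (\<lambda>y :: search_state. snd (snd y))"
    by (intro ptimed_unary ptimed_id)
  have "xtimed ?D ?\<phi> esize (\<lambda>x. (x, snd (snd (search (search_start x)))))"
    by (intro xtimed_Pair xtimed_ptimed[OF ptimed_id] xtimed_post[OF xtimed_search snd_snd]) (auto intro: poly_bounded_const)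
  then have large: "xtimed ?D ?\<phi> esize (\<lambda>x. finish (x, snd (snd (search (search_start x)))))"
  proof (rule xtimed_post[OF _ ptimed_finish])
    have size: "poly_bounded (\<lambda>_. True) esize (\<lambda>x. esize (search_start x))"
      using ptime_search_start unfolding ptime_def by blast
    have "poly_bounded (\<lambda>_. True) esize (\<lambda>x. esize x + esize (search_start x))"
      by (intro poly_bounded_add poly_bounded_self size)
    then show "poly_bounded ?D esize (\<lambda>x. esize (fst (x, snd (snd (search (search_start x))))) +
        esize (snd (snd (x, snd (snd (search (search_start x)))))))"
    proof (rule poly_bounded_mono)
      fix x
      have "esize (snd (snd (snd (search (search_start x))))) \<le> esize (fst (snd (fst (search_start x))))"
        using search_result[OF search_start_dom, of x] unfolding search_dom_def by metis
      also have "\<dots> \<le> esize (search_start x)"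
        using esize_fst[of "snd (fst (search_start x))"] esize_snd[of "fst (search_start x)"]
          esize_fst[of "search_start x"] by linarith
      finally show "esize (fst (x, snd (snd (search (search_start x))))) +
          esize (snd (snd (x, snd (snd (search (search_start x)))))) \<le> esize x + esize (search_start x)"
        by simp
    qed simp
  qed simp
  have small': "ptime (\<lambda>x :: instance_data \<times> nat list. (list_all (\<lambda>u. memb u (fst (snd (fst x))) =
      memb u (snd (snd (fst x)))) (snd x), [] :: nat list list))"
    by (intro ptime_intros)
  have small: "xtimed (\<lambda>x. process_dom x \<and> \<not> tl (snd x) \<noteq> []) ?\<phi> esize (\<lambda>x. (list_all (\<lambda>u. memb u (fst (snd (fst x))) =
      memb u (snd (snd (fst x)))) (snd x), [] :: nat list list))"
    by (rule xtimed_mono[OF xtimed_ptimed[OF ptimed_ptime[OF small']]]) (rule TrueI)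
  show ?thesis
    unfolding process_def[abs_def] by (rule xtimed_If[OF _ large small]) (intro ptimed_unary ptimed_id)
qed

section \<open>The work list of remaining vertex sets\<close>

type_synonym main_state = "instance_data \<times> nat list list \<times> bool"

definition main_cond :: "main_state \<Rightarrow> bool" where
  "main_cond y \<longleftrightarrow> snd (snd y) \<and> fst (snd y) \<noteq> []"

text \<open>The flag is overwritten instead of conjoined: the loop stops at the first failure, so
  the previous flag was \<open>True\<close>.\<close>

definition main_post :: "main_state \<times> bool \<times> nat list list \<Rightarrow> main_state" where
  "main_post z = (fst (fst z), (snd (snd z) @ tl (fst (snd (fst z))), fst (snd z)))"

definition main_step :: "main_state \<Rightarrow> main_state" where
  "main_step y = main_post (y, process (fst y, hd (fst (snd y))))"

text \<open>
  The sum of \<open>length W ^ 2 + 1\<close> decreases when \<open>W\<close> is replaced by parts of it, which are proper and disjoint.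
\<close>

definition main_fuel :: "main_state \<Rightarrow> nat" where
  "main_fuel y = sum_list (map (\<lambda>W. length W ^ 2 + 1) (fst (snd y)))"

text \<open>The bound on the potential limits both the number of rounds and the number of sets that
  one round can add to the work list.\<close>

definition main_dom :: "main_state \<Rightarrow> bool" where
  "main_dom y \<longleftrightarrow> (let m = fst (fst y) in graph_matrix m \<and> splittable (width m) m \<and>
     indep (madj m) (set (fst (snd (fst y)))) \<and> indep (madj m) (set (snd (snd (fst y)))) \<and>
     (\<forall>W\<in>set (fst (snd y)). distinct W \<and> set W \<subseteq> {..<length m}) \<and> main_fuel y \<le> length m ^ 2 + 1)"

lemma main_step_eq:
  "main_step ((m, (S, T)), (W # wl, ok)) =
     ((m, (S, T)), (snd (process ((m, (S, T)), W)) @ wl, fst (process ((m, (S, T)), W))))"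
  by (simp add: main_step_def main_post_def)

lemma main_step_props:
  assumes dom: "main_dom y" and c: "main_cond y"
  shows "main_dom (main_step y)" "main_fuel (main_step y) < main_fuel y" "fst (main_step y) = fst y"
proof -
  obtain m S T W wl where y: "y = ((m, (S, T)), (W # wl, True))"
    using c unfolding main_cond_def by (metis list.exhaust prod.collapse)
  note d = dom[unfolded main_dom_def Let_def y, simplified]
  have W: "distinct W" and m: "graph_matrix m" and ST: "indep (madj m) (set S)" "indep (madj m) (set T)"
    using d by auto
  note pc = process_correct[OF m W ST]
  show fuel: "main_fuel (main_step y) < main_fuel y"
    using pc(3) unfolding y main_step_eq by (simp add: main_fuel_def)
  show fst: "fst (main_step y) = fst y" unfolding y main_step_eq by simp
  have "\<forall>D\<in>set (fst (snd (main_step y))). distinct D \<and> set D \<subseteq> {..<length m}"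
    using pc(2) d unfolding y main_step_eq by (auto dest: subsetD)
  moreover have "main_fuel (main_step y) \<le> length m ^ 2 + 1"
    using fuel dom unfolding y main_dom_def Let_def by simp
  ultimately show "main_dom (main_step y)"
    using dom unfolding main_dom_def Let_def fst by (simp add: y)
qed

lemma poly_bounded_list:
  assumes "\<And>y. D y \<Longrightarrow> length (xs y) \<le> \<mu> y \<and> (\<forall>i\<in>set (xs y). (i :: nat) \<le> \<mu> y)"
  shows "psize D \<mu> xs"
proof (rule poly_bounded_mono[where D = D])
  show "poly_bounded D \<mu> (\<lambda>y. \<mu> y * (\<mu> y + 1))"
    by (intro poly_bounded_add poly_bounded_mult poly_bounded_const poly_bounded_self)
  fix y assume y: "D y"
  have "esize (xs y) \<le> length (xs y) * (\<mu> y + 1)"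
    by (rule esize_list_le) (use assms[OF y] in simp)
  moreover have "length (xs y) \<le> \<mu> y" using assms[OF y] by simp
  ultimately show "esize (xs y) \<le> \<mu> y * (\<mu> y + 1)"
    using mult_le_mono1 le_trans by blast
qed

lemma ptimed_main_post: "ptimed (\<lambda>_. True) (\<lambda>z. length (snd (snd z))) main_post"
proof -
  have "ptimed (\<lambda>_. True) (\<lambda>z. length (snd (snd z))) (\<lambda>z :: main_state \<times> bool \<times> nat list list.
      fst (snd (snd z), tl (fst (snd (fst z)))) @ snd (snd (snd z), tl (fst (snd (fst z)))))"
    by (rule ptimed_comp[OF _ ptimed_append]) (simp_all add: ptimed_Pair ptimed_unary ptimed_id poly_bounded_self)
  then show ?thesis
    unfolding main_post_def[abs_def] by (intro ptimed_Pair ptimed_unary ptimed_id) simp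
qed

text \<open>The measure covers the instance only. The current vertex set is polynomial in it, being
  a distinct list of indices; the number of returned sets is bounded by the potential of the next
  state.\<close>

lemma xtimed_main_step:
  "xtimed (\<lambda>y. main_dom y \<and> main_cond y) (\<lambda>y. width (fst (fst y))) (\<lambda>y. esize (fst y)) main_step"
proof -
  let ?D = "\<lambda>y. main_dom y \<and> main_cond y"
  let ?\<mu> = "\<lambda>y :: main_state. esize (fst y)" and ?\<phi> = "\<lambda>y :: main_state. width (fst (fst y))"
  let ?g = "\<lambda>y :: main_state. (fst y, hd (fst (snd y)))"
  have hd: "hd (fst (snd y)) \<in> set (fst (snd y))" if "?D y" for y
    using that by (simp add: main_cond_def)
  then have W: "process_dom (?g y)" "distinct (hd (fst (snd y)))"
      "set (hd (fst (snd y))) \<subseteq> {..<length (fst (fst y))}" if "?D y" for y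
    using that unfolding main_dom_def process_dom_def Let_def by auto
  have n: "length (fst (fst y)) \<le> ?\<mu> y" for y
    using length_le_esize[of "fst (fst y)"] esize_fst[of "fst y"] by simp
  have lW: "length (hd (fst (snd y))) \<le> length (fst (fst y))" if "?D y" for y
    using card_mono[OF _ W(3)[OF that]] distinct_card[OF W(2)[OF that]] by simp
  have "psize ?D ?\<mu> (\<lambda>y. hd (fst (snd y)))"
  proof (rule poly_bounded_list, intro conjI ballI)
    fix y i assume D: "?D y"
    show "length (hd (fst (snd y))) \<le> ?\<mu> y" using lW[OF D] n[of y] by linarith
    assume "i \<in> set (hd (fst (snd y)))"
    then have "i < length (fst (fst y))" using W(3)[OF D] by auto
    then show "i \<le> ?\<mu> y" using n[of y] by linarith
  qed
  then have size: "poly_bounded ?D ?\<mu> (\<lambda>y. esize (?g y))"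
    unfolding esize_simps by (intro poly_bounded_add poly_bounded_self poly_bounded_const)
  have "ptimed ?D ?\<mu> ?g"
    by (intro ptimed_Pair ptimed_unary ptimed_hd ptimed_id) (simp add: main_cond_def)
  then have "xtimed ?D ?\<phi> ?\<mu> (\<lambda>y. process (?g y))"
    by (rule xtimed_pre[OF _ xtimed_process]) (use W(1) size in auto)
  then have "xtimed ?D ?\<phi> ?\<mu> (\<lambda>y. (y, process (?g y)))"
    by (intro xtimed_Pair xtimed_ptimed[OF ptimed_id])
  then have "xtimed ?D ?\<phi> ?\<mu> (\<lambda>y. main_post (y, process (?g y)))"
  proof (rule xtimed_post[OF _ ptimed_main_post])
    show "poly_bounded ?D ?\<mu> (\<lambda>y. length (snd (snd (y, process (?g y)))))"
    proof (rule poly_bounded_mono[where D = ?D])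
      show "poly_bounded ?D ?\<mu> (\<lambda>y. ?\<mu> y * ?\<mu> y + 1)"
        by (intro poly_bounded_add poly_bounded_mult poly_bounded_const poly_bounded_self)
      fix y assume D: "?D y"
      let ?r = "snd (process (?g y))"
      have "length r \<le> sum_list (map (\<lambda>W. length W ^ 2 + 1) r)" for r :: "nat list list"
        by (induction r) auto
      then have "length ?r \<le> sum_list (map (\<lambda>W. length W ^ 2 + 1) ?r)" .
      also have "\<dots> \<le> length (fst (fst y)) ^ 2 + 1"
        using main_step_props(1)[of y] D
        unfolding main_dom_def Let_def main_fuel_def main_step_def main_post_def by simp
      also have "\<dots> \<le> ?\<mu> y * ?\<mu> y + 1"
        using mult_le_mono[OF n[of y] n[of y]] by (simp add: power2_eq_square)
      finally show "length (snd (snd (y, process (?g y)))) \<le> ?\<mu> y * ?\<mu> y + 1" by simp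
    qed
  qed simp
  then show ?thesis unfolding main_step_def[abs_def] .
qed

lemma xtimed_main_loop:
  "xtimed main_dom (\<lambda>y. width (fst (fst y))) (\<lambda>y. esize (fst y)) (while main_cond main_step)"
proof -
  obtain p where p: "timed (\<lambda>y. main_dom y \<and> main_cond y) main_step
      (\<lambda>y. 2 ^ width (fst (fst y)) * poly p (esize (fst y)))"
    using xtimed_main_step unfolding xtimed_def by blast
  have c: "ptimed main_dom (\<lambda>y. esize (fst y)) main_cond"
    unfolding main_cond_def[abs_def] by (intro ptimed_conj ptimed_unary ptimed_id)
  have "\<exists>p. timed main_dom (while main_cond main_step)
      (\<lambda>y. (main_fuel y + 1) * (2 ^ width (fst (fst y)) * poly p (esize (fst y))))"
    by (rule timed_while[OF c p]) (simp_all add: main_step_props)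
  then obtain q where q: "timed main_dom (while main_cond main_step)
      (\<lambda>y. (main_fuel y + 1) * (2 ^ width (fst (fst y)) * poly q (esize (fst y))))" ..
  show ?thesis
  proof (rule xtimedI[OF q])
    let ?\<mu> = "\<lambda>y :: main_state. esize (fst y)"
    show "poly_bounded main_dom ?\<mu> (\<lambda>y. (?\<mu> y * ?\<mu> y + 2) * poly q (?\<mu> y))"
      by (intro poly_bounded_add poly_bounded_mult poly_bounded_const poly_bounded_self poly_bounded_poly)
    fix y :: main_state assume "main_dom y"
    then have "main_fuel y \<le> length (fst (fst y)) ^ 2 + 1" unfolding main_dom_def Let_def by blast
    moreover have n: "length (fst (fst y)) \<le> ?\<mu> y"
      using length_le_esize[of "fst (fst y)"] esize_fst[of "fst y"] by simp
    ultimately have "main_fuel y + 1 \<le> ?\<mu> y * ?\<mu> y + 2"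
      using mult_le_mono[OF n n] by (simp add: power2_eq_square)
    from mult_le_mono1[OF this, of "2 ^ width (fst (fst y)) * poly q (?\<mu> y)"]
    show "(main_fuel y + 1) * (2 ^ width (fst (fst y)) * poly q (?\<mu> y)) \<le>
        2 ^ width (fst (fst y)) * ((?\<mu> y * ?\<mu> y + 2) * poly q (?\<mu> y))"
      by (simp only: mult.left_commute)
  qed
qed

text \<open>Invariant: the original question is equivalent to the flag together with all questions
  on the work list. It is decided when the list is empty or the flag fails.\<close>

lemma main_loop_correct:
  assumes "main_dom ((m, (S, T)), ([W], True))"
  shows "snd (snd (while main_cond main_step ((m, (S, T)), ([W], True)))) \<longleftrightarrow> reach m S T W"
proof -
  define I where "I y \<longleftrightarrow> main_dom y \<and> fst y = (m, (S, T)) \<and>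
      (reach m S T W \<longleftrightarrow> snd (snd y) \<and> (\<forall>D\<in>set (fst (snd y)). reach m S T D))" for y
  show ?thesis
  proof (rule while_rule[where P = I and r = "measure main_fuel"])
    show "I ((m, (S, T)), ([W], True))" using assms by (simp add: I_def)
  next
    fix y assume y: "I y" "main_cond y"
    then have dom: "main_dom y" unfolding I_def by blast
    show "(main_step y, y) \<in> measure main_fuel" using main_step_props(2)[OF dom y(2)] by simp
    obtain V wl where yy: "y = ((m, (S, T)), (V # wl, True))"
      using y unfolding main_cond_def I_def by (metis list.exhaust prod.collapse)
    have "graph_matrix m" "distinct V" "indep (madj m) (set S)" "indep (madj m) (set T)"
      using dom unfolding main_dom_def yy Let_def by auto
    from process_correct(1)[OF this]
    have "(reach m S T V \<and> (\<forall>D\<in>set wl. reach m S T D)) \<longleftrightarrow> fst (process ((m, (S, T)), V)) \<and>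
        (\<forall>D\<in>set (snd (process ((m, (S, T)), V)) @ wl). reach m S T D)"
      by (simp add: ball_Un conj_assoc)
    then show "I (main_step y)"
      using y(1) main_step_props(1)[OF dom y(2)] unfolding I_def yy main_step_eq by simp
  next
    fix y assume "I y" "\<not> main_cond y"
    then show "snd (snd y) \<longleftrightarrow> reach m S T W"
      unfolding I_def main_cond_def by auto
  qed simp
qed

section \<open>Preparing the input and running the program\<close>

definition indices :: "bool list list \<Rightarrow> nat list" where
  "indices m = foldr (\<lambda>_ s. length s # s) m []"

lemma set_indices: "set (indices m) = {..<length m}" "length (indices m) = length m" "distinct (indices m)"
proof -
  have *: "length (indices m) = length m \<and> set (indices m) = {..<length m} \<and> distinct (indices m)"
  proof (induction m)
    case (Cons a m)
    have "indices (a # m) = length (indices m) # indices m" by (simp add: indices_def)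
    with Cons show ?case by (simp add: lessThan_Suc)
  qed (simp add: indices_def)
  then show "set (indices m) = {..<length m}" "length (indices m) = length m" "distinct (indices m)"
    by auto
qed

text \<open>The entry added in each round grows with the accumulator, so \<open>ptime_foldr\<close>
  does not apply; the quadratic size of the result is established directly.\<close>

lemma ptime_indices [ptime_intros]:
  assumes "ptime m"
  shows "ptime (\<lambda>x. indices (m x))"
proof -
  let ?g = "\<lambda>p :: unit \<times> bool list \<times> nat list. length (snd (snd p)) # snd (snd p)"
  let ?F = "\<lambda>p :: unit \<times> nat list \<times> bool list list. foldr (\<lambda>a s. ?g (fst p, a, s)) (snd (snd p)) (fst (snd p))"
  have size: "length (foldr (\<lambda>a s. ?g (c, a, s)) ys b) = length b + length ys \<and>
      esize (foldr (\<lambda>a s. ?g (c, a, s)) ys b) \<le> esize b + length ys * (length b + length ys + 1)" for c ys b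
  proof (induction ys)
    case (Cons y ys)
    have "length ys * (length b + length ys + 1) \<le> length ys * (length b + length (y # ys) + 1)"
      by (rule mult_le_mono2) simp
    with Cons show ?case by simp
  qed simp
  have "ptime ?F"
  proof (rule ptime_foldr_psize)
    show "ptime ?g" by (intro ptime_intros)
    show "psize (\<lambda>_. True) esize ?F"
    proof (rule poly_bounded_mono[where D = "\<lambda>_. True"])
      show "poly_bounded (\<lambda>_. True) esize (\<lambda>p :: unit \<times> nat list \<times> bool list list. esize p + esize p * (esize p + 1))"
        by (intro poly_bounded_add poly_bounded_mult poly_bounded_const poly_bounded_self)
      fix p :: "unit \<times> nat list \<times> bool list list"
      obtain b ys where p: "p = ((), (b, ys))" by (metis prod.collapse unit_eq)
      have "length b \<le> esize b" "length ys \<le> esize ys" by (rule length_le_esize)+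
      then have "length ys * (length b + length ys + 1) \<le> esize p * (esize p + 1)"
        by (intro mult_le_mono) (simp_all add: p)
      then show "esize (?F p) \<le> esize p + esize p * (esize p + 1)"
        using size[of "()" ys b] by (simp add: p)
    qed simp
  qed
  from ptime_comp[OF this ptime_Pair[OF ptime_const[of "()"] ptime_Pair[OF ptime_const[of "[]"] assms]]]
  show ?thesis by (simp add: indices_def)
qed

text \<open>A heterogeneous list as nested pairs: the final unit is encoded as \<open>Leaf\<close>,
  which makes the encoding coincide with that of a three-element list.\<close>

type_synonym raw_instance = "bool list list \<times> bool list \<times> bool list \<times> unit"

definition main_init :: "raw_instance \<Rightarrow> main_state" where
  "main_init x = (let m = fst x; V = indices m in
     ((m, (filter (\<lambda>i. nth_default False (fst (snd x)) i) V,
           filter (\<lambda>i. nth_default False (fst (snd (snd x))) i) V)), ([V], True)))"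

definition decide :: "raw_instance \<Rightarrow> bool" where
  "decide x = snd (snd (while main_cond main_step (main_init x)))"

lemma ptime_main_init: "ptime main_init"
  unfolding main_init_def[abs_def] Let_def by (intro ptime_intros)

lemma xtimed_decide: "xtimed (\<lambda>x. main_dom (main_init x)) (\<lambda>x. width (fst x)) esize decide"
proof -
  let ?D = "\<lambda>x. main_dom (main_init x)"
  have "ptimed ?D esize main_init"
    using ptimed_mono[OF ptimed_ptime[OF ptime_main_init], of ?D] by simp
  then have "xtimed ?D (\<lambda>x. width (fst x)) esize (\<lambda>x. while main_cond main_step (main_init x))"
  proof (rule xtimed_pre[OF _ xtimed_main_loop])
    show "width (fst (fst (main_init x))) \<le> width (fst x)" for x by (simp add: main_init_def Let_def)
    have "poly_bounded (\<lambda>_. True) esize (\<lambda>x. esize (main_init x))"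
      using ptime_main_init unfolding ptime_def by blast
    then show "poly_bounded ?D esize (\<lambda>x. esize (fst (main_init x)))"
      by (rule poly_bounded_mono) (simp_all add: esize_fst)
  qed
  moreover have "ptimed (\<lambda>_. True) (\<lambda>_. 0) (\<lambda>y :: main_state. snd (snd y))"
    by (intro ptimed_unary ptimed_id)
  ultimately show ?thesis
    unfolding decide_def[abs_def] by (rule xtimed_post) (simp_all add: poly_bounded_const)
qed

text \<open>Execution starts at function 0, so a forwarding body is put in front and the program is
  shifted by one. The 4 counts two calls and two variable accesses.\<close>

lemma timed_run:
  assumes "timed D f T"
  shows "\<exists>P. \<forall>x. D x \<longrightarrow> (\<exists>t \<le> T x + 4. run P (enc x) (enc (f x)) t)"
proof -
  obtain P i where P: "computes P i D f T" using assms unfolding timed_def by blast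
  let ?e = "ECall (length [ELeaf] + i) [EVar 0]"
  let ?Q = "[?e] @ map (shift (length [?e])) P"
  have Q: "computes ?Q (length [?e] + i) D f T" by (rule computes_shift[OF P])
  have "\<exists>t \<le> T x + 4. run ?Q (enc x) (enc (f x)) t" if "D x" for x
  proof -
    have "eval_within ?Q [enc x] (ECall (length [?e] + i) [EVar 0]) (enc (f x)) (1 + T x + 1)"
      by (rule eval_within_computed[OF Q that eval_within_Var0])
    then have "eval_within ?Q [enc x] (?Q ! 0) (enc (f x)) (1 + T x + 1)" by simp
    from eval_within_Call[OF eval_within_Var0 this]
    have "eval_within ?Q [enc x] (ECall 0 [EVar 0]) (enc (f x)) (1 + (1 + T x + 1) + 1)" by simp
    then have "eval_within ?Q [enc x] (ECall 0 [EVar 0]) (enc (f x)) (T x + 4)"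
      by (rule eval_within_mono) simp
    then show ?thesis unfolding eval_within_def run_def .
  qed
  then show ?thesis by blast
qed

section \<open>Translation to graphs\<close>

text \<open>Sliding is transported along an isomorphism; for both directions of the equivalence it
  is applied to the enumeration of the vertices and to its inverse.\<close>

lemma slide_image:
  assumes inj: "inj_on f I" and adj: "\<And>i j. i \<in> I \<Longrightarrow> j \<in> I \<Longrightarrow> adj (f i) (f j) \<longleftrightarrow> adj' i j"
    and X: "X \<subseteq> I" and reach: "slides adj' I X Y"
  shows "Y \<subseteq> I \<and> slides adj (f ` I) (f ` X) (f ` Y)"
  using reach
proof (induction rule: rtranclp_induct)
  case base
  then show ?case using X by simp
next
  case (step Y Z)
  then obtain u v where uv: "u \<in> Y" "v \<in> I" "v \<notin> Y" "adj' u v" "Z = insert v (Y - {u})"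
    and Y: "Y \<subseteq> I" "indep adj' Y" and Z: "indep adj' Z"
    unfolding slide_def by blast
  have ZI: "Z \<subseteq> I" using uv Y by auto
  have indep: "indep adj (f ` A)" if "A \<subseteq> I" "indep adj' A" for A
    unfolding indep_def
  proof (intro ballI)
    fix a b assume "a \<in> f ` A" "b \<in> f ` A"
    then obtain i j where "i \<in> A" "j \<in> A" "a = f i" "b = f j" by blast
    then show "\<not> adj a b" using adj[of i j] that unfolding indep_def by auto
  qed
  have "slide adj (f ` I) (f ` Y) (f ` Z)"
    unfolding slide_def
  proof (intro conjI bexI)
    show "f ` Y \<subseteq> f ` I" using Y by blast
    show "indep adj (f ` Y)" "indep adj (f ` Z)" using indep Y Z ZI by auto
    show "adj (f u) (f v)" using adj uv Y by auto
    show "f u \<in> f ` Y" using uv by simp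
    have "f v \<notin> f ` Y" using inj_on_image_mem_iff[OF inj uv(2) Y(1)] uv(3) by simp
    then show "f v \<in> f ` I - f ` Y" using uv by simp
    have "f ` (Y - {u}) = f ` Y - {f u}"
      using inj_on_image_set_diff[OF inj, of Y "{u}"] uv Y by auto
    then show "f ` Z = insert (f v) (f ` Y - {f u})" by (simp add: uv(5))
  qed
  then show ?case using step.IH ZI by (meson rtranclp.rtrancl_into_rtrancl)
qed

lemma ts_step_slide:
  assumes fin: "finite (verts G)" and sym: "\<And>u v. u \<rightarrow>\<^bsub>G\<^esub> v \<Longrightarrow> v \<rightarrow>\<^bsub>G\<^esub> u"
  shows "ts_step G X Y \<longleftrightarrow> slide (dominates G) (verts G) X Y"
proof
  assume ts: "ts_step G X Y"
  then have X: "X \<subseteq> verts G" "indep (dominates G) X" and Y: "Y \<subseteq> verts G" "indep (dominates G) Y"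
    unfolding ts_step_def indep_set_def indep_def by auto
  from ts obtain u v where uv: "sym_diff X Y = {u, v}" "u \<rightarrow>\<^bsub>G\<^esub> v" unfolding ts_step_def by blast
  have fXY: "finite X" "finite Y" using X Y fin finite_subset by auto
  have "card X = card (X \<inter> Y) + card (X - Y)" "card Y = card (X \<inter> Y) + card (Y - X)"
    using card_Int_Diff[OF fXY(1), of Y] card_Int_Diff[OF fXY(2), of X] by (simp_all add: Int_commute)
  moreover have "card X = card Y" using ts unfolding ts_step_def by blast
  moreover have "card (sym_diff X Y) = card (X - Y) + card (Y - X)"
    by (rule card_Un_disjoint) (use fXY in auto)
  moreover have "card (sym_diff X Y) = 2" using ts unfolding ts_step_def by blast
  \<comment> \<open>Equal cardinalities force the two differences to have the same size, and
    together they have two elements.\<close>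
  ultimately have "card (X - Y) = 1" "card (Y - X) = 1" by linarith+
  then obtain a b where ab: "X - Y = {a}" "Y - X = {b}" by (metis card_1_singletonE)
  then have "{a, b} = {u, v}" using uv by auto
  then have "a \<rightarrow>\<^bsub>G\<^esub> b \<or> a = b" using uv sym by (metis doubleton_eq_iff)
  moreover have "a \<noteq> b" using ab by blast
  ultimately have "a \<rightarrow>\<^bsub>G\<^esub> b" by blast
  moreover have "Y = insert b (X - {a})" "a \<in> X" "b \<in> verts G - X" using ab Y by auto
  ultimately show "slide (dominates G) (verts G) X Y"
    unfolding slide_def using X Y by blast
next
  assume "slide (dominates G) (verts G) X Y"
  then obtain u v where X: "X \<subseteq> verts G" "indep (dominates G) X" and Y: "indep (dominates G) Y"
    and uv: "u \<in> X" "v \<in> verts G" "v \<notin> X" "u \<rightarrow>\<^bsub>G\<^esub> v" "Y = insert v (X - {u})"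
    unfolding slide_def by blast
  have "finite X" using X fin finite_subset by blast
  then have "card Y = Suc (card (X - {u}))"
    unfolding uv(5) using uv(3) by (intro card_insert_disjoint) auto
  with \<open>finite X\<close> have "card Y = card X" using card.remove[of X u] uv(1) by metis
  moreover have "sym_diff X Y = {u, v}" using uv by auto
  moreover have "u \<noteq> v" using uv by auto
  then have "card {u, v} = 2" by simp
  moreover have "Y \<subseteq> verts G" using uv X by auto
  ultimately show "ts_step G X Y"
    unfolding ts_step_def indep_set_def using X Y uv(4) unfolding indep_def by auto
qed

definition adjacency :: "('a, 'b) pre_digraph \<Rightarrow> 'a list \<Rightarrow> bool list list" where
  "adjacency G vs = map (\<lambda>u. map (\<lambda>v. u \<rightarrow>\<^bsub>G\<^esub> v) vs) vs"

lemma madj_adjacency: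
  "madj (adjacency G vs) i j \<longleftrightarrow> i < length vs \<and> j < length vs \<and> vs ! i \<rightarrow>\<^bsub>G\<^esub> vs ! j"
  by (auto simp: madj_def adjacency_def nth_default_def)

text \<open>The modules found in the graph are pulled back along the enumeration, which is injective
  on indices, so the preimages again form a partition into proper modules.\<close>

lemma splittable_mw:
  assumes vs: "distinct vs" "set vs = verts G"
  shows "splittable (mw G) (adjacency G vs)"
  unfolding splittable_def
proof (intro allI impI)
  let ?m = "adjacency G vs"
  fix W assume "W \<subseteq> {..<length ?m}" and card: "2 \<le> card W"
  then have W: "W \<subseteq> {..<length vs}" by (simp add: adjacency_def)
  let ?f = "\<lambda>i. vs ! i"
  have inj: "inj_on ?f {..<length vs}" using vs(1) by (simp add: inj_on_nth)
  have injW: "inj_on ?f W" using inj W inj_on_subset by blast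
  have le: "mw_le (mw G) G" using mw_le_mw vs(2) by (metis List.finite_set)
  have sub: "?f ` W \<subseteq> verts G" using W vs(2) by (auto simp: subset_iff)
  have two: "2 \<le> card (?f ` W)" using card_image[OF injW] card by simp
  from mw_le_modules[OF le sub two] obtain \<V> where V: "partition_on (?f ` W) \<V>" "finite \<V>" "card \<V> \<le> mw G"
    "\<forall>M\<in>\<V>. module_on (dominates G) (?f ` W) M \<and> M \<noteq> ?f ` W"
    by (elim exE conjE)
  have U: "\<Union>\<V> = ?f ` W" using V(1) by (simp add: partition_on_def)
  define g where "g M = {i \<in> W. ?f i \<in> M}" for M
  have fg: "?f ` g M = M" if M: "M \<in> \<V>" for M
  proof
    show "?f ` g M \<subseteq> M" unfolding g_def by auto
    have "M \<subseteq> ?f ` W" using M unfolding U[symmetric] by (rule Union_upper)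
    then show "M \<subseteq> ?f ` g M" unfolding g_def by auto
  qed
  show "\<exists>\<V>. partition_on W \<V> \<and> finite \<V> \<and> card \<V> \<le> mw G \<and> (\<forall>M\<in>\<V>. module_on (madj ?m) W M \<and> M \<noteq> W)"
  proof (intro exI[of _ "g ` \<V>"] conjI ballI)
    show "partition_on W (g ` \<V>)"
      unfolding partition_on_def disjoint_def
    proof (intro conjI ballI impI)
      show "\<Union>(g ` \<V>) = W"
      proof
        show "\<Union>(g ` \<V>) \<subseteq> W" unfolding g_def by auto
        show "W \<subseteq> \<Union>(g ` \<V>)"
        proof
          fix i assume i: "i \<in> W"
          then obtain M where "M \<in> \<V>" "?f i \<in> M" using U by blast
          then show "i \<in> \<Union>(g ` \<V>)" unfolding g_def using i by blast
        qed
      qed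
      show "{} \<notin> g ` \<V>"
      proof
        assume "{} \<in> g ` \<V>"
        then obtain M where M: "M \<in> \<V>" "g M = {}" by (metis imageE)
        then have "M = {}" using fg[OF M(1)] by simp
        then show False using V(1) M(1) by (simp add: partition_on_def)
      qed
      fix A B assume "A \<in> g ` \<V>" "B \<in> g ` \<V>" "A \<noteq> B"
      then obtain M N where MN: "M \<in> \<V>" "N \<in> \<V>" "A = g M" "B = g N" "M \<noteq> N" by blast
      then have "M \<inter> N = {}" using V(1) by (simp add: partition_on_def disjoint_def)
      then show "A \<inter> B = {}" unfolding MN g_def by blast
    qed
    show "finite (g ` \<V>)" using V(2) by simp
    show "card (g ` \<V>) \<le> mw G" using card_image_le[OF V(2), of g] V(3) by simp
    fix A assume "A \<in> g ` \<V>"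
    then obtain M where M: "M \<in> \<V>" "A = g M" by blast
    show "A \<noteq> W" using fg[OF M(1)] V(4) M by metis
    show "module_on (madj ?m) W A"
      unfolding module_on_def
    proof (intro conjI ballI impI)
      show "A \<subseteq> W" unfolding M g_def by blast
      fix x y z assume x: "x \<in> W - A" and yz: "y \<in> A" "z \<in> A" and xy: "madj ?m x y"
      have f: "?f x \<in> ?f ` W" "?f x \<notin> M" "?f y \<in> M" "?f z \<in> M" "z \<in> W" "x \<in> W"
        using x yz unfolding M g_def by auto
      have "module_on (dominates G) (?f ` W) M" using bspec[OF V(4) M(1)] by (rule conjunct1)
      from module_onD[OF this f(1-4)] xy have "?f x \<rightarrow>\<^bsub>G\<^esub> ?f z" by (simp add: madj_adjacency)
      then show "madj ?m x z" unfolding madj_adjacency using W f(5,6) by auto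
    qed
  qed
qed

lemma splittable_width:
  assumes "distinct vs" "set vs = verts G"
  shows "splittable (width (adjacency G vs)) (adjacency G vs)" "width (adjacency G vs) \<le> mw G"
  unfolding width_def using splittable_mw[OF assms] by (rule LeastI, rule Least_le)

definition raw :: "('a, 'b) pre_digraph \<Rightarrow> 'a list \<Rightarrow> 'a set \<Rightarrow> 'a set \<Rightarrow> raw_instance" where
  "raw G vs S T = (adjacency G vs, (map (\<lambda>v. v \<in> S) vs, (map (\<lambda>v. v \<in> T) vs, ())))"

lemma enc_instance_raw: "enc_instance G vs S T = enc (raw G vs S T)"
  by (simp add: enc_instance_def raw_def adjacency_def enc_set_def enc_list_def list_enc bool_enc o_def)

lemma ts_reachable_decide:
  fixes G :: "('a, 'b) pre_digraph"
  assumes sym: "\<And>u v. u \<rightarrow>\<^bsub>G\<^esub> v \<Longrightarrow> v \<rightarrow>\<^bsub>G\<^esub> u" and irrefl: "\<And>u. \<not> u \<rightarrow>\<^bsub>G\<^esub> u"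
    and vs: "distinct vs" "set vs = verts G" and S: "indep_set G S" and T: "indep_set G T"
  shows "main_dom (main_init (raw G vs S T))" "decide (raw G vs S T) \<longleftrightarrow> ts_reachable G S T"
proof -
  define m where "m = adjacency G vs"
  define pre where "pre X = filter (\<lambda>i. nth_default False (map (\<lambda>v. v \<in> X) vs) i) (indices m)" for X
  have len: "length m = length vs" by (simp add: m_def adjacency_def)
  have init: "main_init (raw G vs S T) = ((m, (pre S, pre T)), ([indices m], True))"
    by (simp add: main_init_def raw_def m_def pre_def Let_def)
  let ?f = "\<lambda>i. vs ! i"
  let ?I = "{..<length vs}"
  have pre: "set (pre X) = {i \<in> ?I. ?f i \<in> X}" for X
    unfolding pre_def using set_indices(1)[of m] len by (auto simp: nth_default_def)
  have gm: "graph_matrix m"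
    unfolding graph_matrix_def m_def madj_adjacency using sym irrefl by blast
  have indep: "indep (madj m) (set (pre X))" if "indep_set G X" for X
    using that unfolding indep_def indep_set_def pre m_def madj_adjacency by blast
  have sum: "main_fuel ((m, (pre S, pre T)), ([indices m], True)) = length m ^ 2 + 1"
    by (simp add: main_fuel_def set_indices)
  show dom: "main_dom (main_init (raw G vs S T))"
    unfolding init main_dom_def Let_def
    using gm indep S T splittable_width(1)[OF vs] sum by (simp add: set_indices m_def)
  have f: "inj_on ?f ?I" "?f ` ?I = verts G"
    using vs by (auto simp: inj_on_nth set_conv_nth)
  define h where "h = inv_into ?I ?f"
  have h: "inj_on h (verts G)" "h ` verts G = ?I" "\<And>u. u \<in> verts G \<Longrightarrow> h u < length vs \<and> ?f (h u) = u"
  proof -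
    show "inj_on h (verts G)" unfolding h_def using f(2) by (metis inj_on_inv_into order_refl)
    show hf: "h u < length vs \<and> ?f (h u) = u" if "u \<in> verts G" for u
      using that f(2) f_inv_into_f[of u ?f ?I] inv_into_into[of u ?f ?I] unfolding h_def by auto
    have "h (?f i) = i" if "i \<in> ?I" for i unfolding h_def using f(1) that by (rule inv_into_f_f)
    then show "h ` verts G = ?I" unfolding f(2)[symmetric] by (simp add: image_image)
  qed
  have fpre: "?f ` set (pre X) = X" if "indep_set G X" for X
  proof -
    have "X \<subseteq> ?f ` ?I" using that f(2) unfolding indep_set_def by simp
    then show ?thesis unfolding pre by auto
  qed
  have hpre: "h ` X = set (pre X)" if "indep_set G X" for X
  proof -
    have "h (?f i) = i" if "i \<in> ?I" for i unfolding h_def using f(1) that by (rule inv_into_f_f)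
    then have "h ` ?f ` set (pre X) = set (pre X)" unfolding image_image pre by force
    then show ?thesis using fpre[OF that] by simp
  qed
  have sub: "set (pre X) \<subseteq> ?I" for X unfolding pre by blast
  let ?adj = "dominates G"
  have "decide (raw G vs S T) \<longleftrightarrow> reach m (pre S) (pre T) (indices m)"
    unfolding decide_def init using main_loop_correct dom[unfolded init] by blast
  also have "\<dots> \<longleftrightarrow> slides (madj m) ?I (set (pre S)) (set (pre T))"
  proof -
    have "set (pre X) \<inter> ?I = set (pre X)" for X using sub by blast
    then show ?thesis unfolding set_indices len by simp
  qed
  also have "\<dots> \<longleftrightarrow> slides ?adj (verts G) S T"
  proof
    assume "slides (madj m) ?I (set (pre S)) (set (pre T))"
    note * = this
    have "?adj (?f i) (?f j) \<longleftrightarrow> madj m i j" if "i \<in> ?I" "j \<in> ?I" for i j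
      using that unfolding m_def madj_adjacency by simp
    from slide_image[where adj = ?adj, OF f(1) this sub *]
    show "slides ?adj (verts G) S T"
      unfolding f(2) fpre[OF S] fpre[OF T] by blast
  next
    assume *: "slides ?adj (verts G) S T"
    have "S \<subseteq> verts G" using S unfolding indep_set_def by blast
    have "madj m (h u) (h v) \<longleftrightarrow> ?adj u v" if "u \<in> verts G" "v \<in> verts G" for u v
      using h(3)[OF that(1)] h(3)[OF that(2)] unfolding m_def madj_adjacency by simp
    from slide_image[OF h(1) this \<open>S \<subseteq> verts G\<close> *]
    show "slides (madj m) ?I (set (pre S)) (set (pre T))"
      unfolding h(2) hpre[OF S] hpre[OF T] by blast
  qed
  also have "\<dots> \<longleftrightarrow> ts_reachable G S T"
  proof -
    have fin: "finite (verts G)" using vs(2) by (metis List.finite_set)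
    have "ts_step G X Y \<longleftrightarrow> slide ?adj (verts G) X Y" for X Y
      by (rule ts_step_slide[OF fin]) (erule sym)
    then have "ts_step G = slide ?adj (verts G)" by blast
    then show ?thesis using S unfolding ts_reachable_def by simp
  qed
  finally show "decide (raw G vs S T) \<longleftrightarrow> ts_reachable G S T" .
qed

theorem theorem4:
  shows "\<exists>(P :: program) (p :: nat poly).
    \<forall>(G :: nat pair_pre_digraph) (vs :: nat list) (S :: nat set) (T :: nat set).
      pair_graph G \<and> distinct vs \<and> set vs = pverts G \<and>
      indep_set (with_proj G) S \<and> indep_set (with_proj G) T \<longrightarrow>
      (\<exists>v t. run P (enc_instance (with_proj G) vs S T) v t \<and>
             v = enc_bool (ts_reachable (with_proj G) S T) \<and>
             t \<le> 2 ^ mw (with_proj G) * poly p (size (enc_instance (with_proj G) vs S T)))"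
proof -
  obtain p where "timed (\<lambda>x. main_dom (main_init x)) decide (\<lambda>x. 2 ^ width (fst x) * poly p (esize x))"
    using xtimed_decide unfolding xtimed_def by blast
  from timed_run[OF this] obtain P where P: "\<And>x. main_dom (main_init x) \<Longrightarrow>
      \<exists>t \<le> 2 ^ width (fst x) * poly p (esize x) + 4. run P (enc x) (enc (decide x)) t"
    by blast
  \<comment> \<open>The summand \<open>[:4:]\<close> absorbs the 4 additional steps of starting the
    program.\<close>
  show ?thesis
  proof (intro exI[of _ P] exI[of _ "p + [:4:]"] allI impI, elim conjE)
    fix G :: "nat pair_pre_digraph" and vs S T
    assume G: "pair_graph G" and vs: "distinct vs" "set vs = pverts G"
      and ST: "indep_set (with_proj G) S" "indep_set (with_proj G) T"
    let ?G = "with_proj G" and ?x = "raw (with_proj G) vs S T"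
    interpret pair_graph G by (rule G)
    have sym: "u \<rightarrow>\<^bsub>?G\<^esub> v \<Longrightarrow> v \<rightarrow>\<^bsub>?G\<^esub> u" and irrefl: "\<not> u \<rightarrow>\<^bsub>?G\<^esub> u" for u v
      using graph_symmetric adj_not_same by auto
    have vs': "set vs = verts ?G" using vs(2) by simp
    have dom: "main_dom (main_init ?x)" and dec: "decide ?x \<longleftrightarrow> ts_reachable ?G S T"
      by (rule ts_reachable_decide[OF _ _ vs(1) vs' ST]; (rule irrefl | erule sym))+
    from P[OF dom] obtain t where t: "t \<le> 2 ^ width (fst ?x) * poly p (esize ?x) + 4"
      "run P (enc ?x) (enc (decide ?x)) t" by blast
    have "(2 :: nat) ^ width (fst ?x) \<le> 2 ^ mw ?G"
      using splittable_width(2)[OF vs(1) vs'] by (intro power_increasing) (simp_all add: raw_def)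
    from mult_le_mono1[OF this, of "poly p (esize ?x)"] t(1) le_two_power_mult[of 4 "mw ?G"]
    have "t \<le> 2 ^ mw ?G * poly p (esize ?x) + 2 ^ mw ?G * 4" by linarith
    also have "\<dots> = 2 ^ mw ?G * poly (p + [:4:]) (esize ?x)" by (simp add: distrib_left)
    finally have "t \<le> 2 ^ mw ?G * poly (p + [:4:]) (size (enc_instance ?G vs S T))"
      by (simp add: enc_instance_raw esize_def)
    moreover have "run P (enc_instance ?G vs S T) (enc_bool (ts_reachable ?G S T)) t"
      using t(2) by (simp add: enc_instance_raw dec bool_enc)
    ultimately show "\<exists>v t. run P (enc_instance ?G vs S T) v t \<and> v = enc_bool (ts_reachable ?G S T) \<and>
        t \<le> 2 ^ mw ?G * poly (p + [:4:]) (size (enc_instance ?G vs S T))"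
      by blast
  qed
qed

end
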